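(* Let $E$ be a symmetric space on $I$ with order continuous norm. Then the following conditions are equivalent: (i) $E$ is strictly $K$-monotone, and for every $x\in E$ and every sequence $(x_n)\subset E$ such that $x_n^{**}\to x^{**}$ in measure and $\|x_n\|_E\to\|x\|_E$, we have $\|x_n^*-x^*\|_E\to 0$. (ii) $E$ is lower locally uniformly $K$-monotone and has the Kadec-Klee property for global convergence in measure. (iii) $E$ is strictly $K$-monotone and has the Kadec-Klee property for global convergence in measure. (iv) $E$ is strictly $K$-monotone and has the Kadec-Klee property for local convergence in measure. (v) $E$ is upper locally uniformly $K$-monotone.
   Context: Let $I=[0,\alpha)$ with $\alpha=1$ or $\alpha=\infty$, with Lebesgue measure $\mu$, and let $L^0$ be the set of (equivalence classes of) extended real valued measurable functions on $I$. A Banach function space $(E,\|\cdot\|_E)$ is a Banach lattice that is a sublattice of $L^0$ such that (1) $x\in L^0$, $y\in E$, $|x|\le|y|$ a.e. imply $x\in E$ and $\|x\|_E\le\|y\|_E$; (2) $E$ contains a strictly positive function. $E^+=\{x\in E:x\ge0\}$. For $x\in L^0$: $d_x(\lambda)=\mu\{s\in I:|x(s)|>\lambda\}$, $x^*(t)=\inf\{\lambda>0:d_x(\lambda)\le t\}$, $x^{**}(t)=\frac1t\int_0^t x^*(s)\,ds$. $E$ is symmetric if $x\in L^0$, $y\in E$, $d_x=d_y$ imply $x\in E$ and $\|x\|_E=\|y\|_E$. Standing assumption: $E$ has the Fatou property, i.e. if $(x_n)\subset E^+$, $\sup_n\|x_n\|_E<\infty$ and $x_n\uparrow x\in L^0$,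 then $x\in E$ and $\|x_n\|_E\uparrow\|x\|_E$. For $x,y\in L^1+L^\infty$, $x\prec y$ means $x^{**}(t)\le y^{**}(t)$ for all $t>0$. $E$ is order continuous (has order continuous norm) if for every $x\in E$ and every $(x_n)\subset E^+$ with $x_n\le|x|$ and $x_n\to0$ a.e. we have $\|x_n\|_E\to0$. $E$ is strictly $K$-monotone if for all $x,y\in E$ with $x^*\ne y^*$ and $y\prec x$ we have $\|y\|_E<\|x\|_E$. $E$ is upper (resp. lower) locally uniformly $K$-monotone if for every $x\in E$ and every $(x_n)\subset E$ with $x\prec x_n$ for all $n$ (resp. $x_n\prec x$ for all $n$) and $\|x_n\|_E\to\|x\|_E$ we have $\|x^*-x_n^*\|_E\to0$. "In measure" and "globally in measure" mean $\mu\{|x_n-x|>\epsilon\}\to0$ for all $\epsilon>0$; "locally in measure" means convergence in measure on every set of finite measure. $E$ has the Kadec-Klee property for global (resp. local) convergence in measure if for every $x\in E$ and $(x_n)\subset E$ with $x_n\to x$ globally (resp. locally) in measure and $\|x_n\|_E\to\|x\|_E$ we have $\|x_n-x\|_E\to0$. *)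

theory Defs
  imports "HOL-Analysis.Analysis"
begin

text \<open>
  Elements of \<open>L\<^sup>0\<close> are represented by Lebesgue measurable functions \<open>real \<Rightarrow> ereal\<close>, of which only
  the values on \<open>I\<close> matter. A function space is a set \<open>E\<close> of representatives together with a
  functional \<open>N\<close> (its norm). Equalities and inequalities between elements of \<open>L\<^sup>0\<close> are
  a.e. statements; the ideal property of \<open>E\<close> makes both \<open>E\<close> and \<open>N\<close> invariant under a.e. equality.
\<close>

abbreviation L0 :: "real set \<Rightarrow> (real \<Rightarrow> ereal) set"
  where "L0 I \<equiv> borel_measurable (lebesgue_on I)"

definition distr_fun :: "real set \<Rightarrow> (real \<Rightarrow> ereal) \<Rightarrow> real \<Rightarrow> ennreal"
  where "distr_fun I x r = emeasure (lebesgue_on I) {s \<in> I. \<bar>x s\<bar> > ereal r}"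

text \<open>The infimum is taken in \<open>ereal\<close>, so that it is \<open>\<infinity>\<close> over the empty set.\<close>

definition rearr :: "real set \<Rightarrow> (real \<Rightarrow> ereal) \<Rightarrow> real \<Rightarrow> ereal"
  where "rearr I x t = (INF r\<in>{r. 0 < r \<and> distr_fun I x r \<le> ennreal t}. ereal r)"

text \<open>
  For \<open>I = [0,1)\<close> and \<open>t \<ge> 1\<close> one has \<open>rearr I x t = 0\<close>, the usual extension of \<open>x\<^sup>*\<close> by zero, so
  \<open>maximal_fun I x t\<close> is meaningful for every \<open>t > 0\<close>.
\<close>

definition maximal_fun :: "real set \<Rightarrow> (real \<Rightarrow> ereal) \<Rightarrow> real \<Rightarrow> ereal"
  where "maximal_fun I x t =
    enn2ereal ((\<integral>\<^sup>+ s\<in>{0..t}. e2ennreal (rearr I x s) \<partial>lebesgue) / ennreal t)"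

text \<open>
  The relation \<open>x \<prec> y\<close>. It is meant for functions in \<open>L\<^sup>1 + L\<^sup>\<infinity>\<close>; below it is only applied to
  elements of a symmetric space, and these belong to \<open>L\<^sup>1 + L\<^sup>\<infinity>\<close>.
\<close>

definition submajorized :: "real set \<Rightarrow> (real \<Rightarrow> ereal) \<Rightarrow> (real \<Rightarrow> ereal) \<Rightarrow> bool"
  where "submajorized I x y \<longleftrightarrow> (\<forall>t>0. maximal_fun I x t \<le> maximal_fun I y t)"

text \<open>
  A.e. finiteness of the elements of \<open>E\<close>, needed for the pointwise sum to be meaningful, is not
  listed because it follows: if \<open>\<bar>x\<bar> = \<infinity>\<close> on \<open>A\<close>, then \<open>u = \<infinity> \<cdot> 1\<^sub>A\<close> belongs to \<open>E\<close> by
  \<open>ideal\<close> and \<open>2 u = u\<close>, hence \<open>N u = 0\<close> and \<open>A\<close> is a null set. Pointwise differences such as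
  \<open>\<lambda>s. x s - y s\<close> of elements of \<open>E\<close> thus involve the convention for \<open>\<infinity> - \<infinity>\<close> only on null sets.
\<close>

locale banach_function_space =
  fixes I :: "real set" and E :: "(real \<Rightarrow> ereal) set" and N :: "(real \<Rightarrow> ereal) \<Rightarrow> real"
  assumes interval: "I = {0..<1} \<or> I = {0..}"
    and measurable: "E \<subseteq> L0 I"
    and zero_mem: "(\<lambda>s. 0) \<in> E"
    and add_mem: "\<And>x y. x \<in> E \<Longrightarrow> y \<in> E \<Longrightarrow> (\<lambda>s. x s + y s) \<in> E"
    and scale_mem: "\<And>c x. x \<in> E \<Longrightarrow> (\<lambda>s. ereal c * x s) \<in> E"
    and sup_mem: "\<And>x y. x \<in> E \<Longrightarrow> y \<in> E \<Longrightarrow> (\<lambda>s. max (x s) (y s)) \<in> E"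
    and inf_mem: "\<And>x y. x \<in> E \<Longrightarrow> y \<in> E \<Longrightarrow> (\<lambda>s. min (x s) (y s)) \<in> E"
    and norm_nonneg: "\<And>x. x \<in> E \<Longrightarrow> 0 \<le> N x"
    and norm_eq_zero: "\<And>x. x \<in> E \<Longrightarrow> N x = 0 \<longleftrightarrow> (AE s in lebesgue_on I. x s = 0)"
    and norm_scale: "\<And>c x. x \<in> E \<Longrightarrow> N (\<lambda>s. ereal c * x s) = \<bar>c\<bar> * N x"
    and norm_triangle: "\<And>x y. x \<in> E \<Longrightarrow> y \<in> E \<Longrightarrow> N (\<lambda>s. x s + y s) \<le> N x + N y"
    and complete: "\<And>X. (\<forall>n. X n \<in> E) \<Longrightarrow>
      (\<forall>\<epsilon>>0. \<exists>n\<^sub>0. \<forall>m\<ge>n\<^sub>0. \<forall>n\<ge>n\<^sub>0. N (\<lambda>s. X m s - X n s) < \<epsilon>) \<Longrightarrow>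
      \<exists>x\<in>E. (\<lambda>n::nat. N (\<lambda>s. X n s - x s)) \<longlonglongrightarrow> 0"
    and ideal: "\<And>x y. x \<in> L0 I \<Longrightarrow> y \<in> E \<Longrightarrow> (AE s in lebesgue_on I. \<bar>x s\<bar> \<le> \<bar>y s\<bar>) \<Longrightarrow>
      x \<in> E \<and> N x \<le> N y"
    and strictly_positive: "\<exists>w\<in>E. AE s in lebesgue_on I. 0 < w s"

locale symmetric_space = banach_function_space +
  assumes symmetric: "\<And>x y. x \<in> L0 I \<Longrightarrow> y \<in> E \<Longrightarrow> distr_fun I x = distr_fun I y \<Longrightarrow>
    x \<in> E \<and> N x = N y"

definition pos_cone :: "real set \<Rightarrow> (real \<Rightarrow> ereal) set \<Rightarrow> (real \<Rightarrow> ereal) set"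
  where "pos_cone I E = {x \<in> E. AE s in lebesgue_on I. 0 \<le> x s}"

definition fatou_property ::
  "real set \<Rightarrow> (real \<Rightarrow> ereal) set \<Rightarrow> ((real \<Rightarrow> ereal) \<Rightarrow> real) \<Rightarrow> bool"
  where "fatou_property I E N \<longleftrightarrow>
    (\<forall>X x. (\<forall>n. X n \<in> pos_cone I E) \<and> bdd_above (range (\<lambda>n. N (X n))) \<and> x \<in> L0 I \<and>
       (AE s in lebesgue_on I. incseq (\<lambda>n. X n s) \<and> (\<lambda>n. X n s) \<longlonglongrightarrow> x s)
     \<longrightarrow> x \<in> E \<and> incseq (\<lambda>n. N (X n)) \<and> (\<lambda>n. N (X n)) \<longlonglongrightarrow> N x)"

definition order_continuous_norm ::
  "real set \<Rightarrow> (real \<Rightarrow> ereal) set \<Rightarrow> ((real \<Rightarrow> ereal) \<Rightarrow> real) \<Rightarrow> bool"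
  where "order_continuous_norm I E N \<longleftrightarrow>
    (\<forall>x\<in>E. \<forall>X. (\<forall>n. X n \<in> pos_cone I E) \<and>
       (\<forall>n. AE s in lebesgue_on I. X n s \<le> \<bar>x s\<bar>) \<and>
       (AE s in lebesgue_on I. (\<lambda>n. X n s) \<longlonglongrightarrow> 0)
     \<longrightarrow> (\<lambda>n. N (X n)) \<longlonglongrightarrow> 0)"

definition strictly_K_monotone ::
  "real set \<Rightarrow> (real \<Rightarrow> ereal) set \<Rightarrow> ((real \<Rightarrow> ereal) \<Rightarrow> real) \<Rightarrow> bool"
  where "strictly_K_monotone I E N \<longleftrightarrow>
    (\<forall>x\<in>E. \<forall>y\<in>E. \<not> (AE s in lebesgue_on I. rearr I x s = rearr I y s) \<and> submajorized I y x
     \<longrightarrow> N y < N x)"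

definition upper_loc_unif_K_monotone ::
  "real set \<Rightarrow> (real \<Rightarrow> ereal) set \<Rightarrow> ((real \<Rightarrow> ereal) \<Rightarrow> real) \<Rightarrow> bool"
  where "upper_loc_unif_K_monotone I E N \<longleftrightarrow>
    (\<forall>x\<in>E. \<forall>X. (\<forall>n. X n \<in> E) \<and> (\<forall>n. submajorized I x (X n)) \<and> (\<lambda>n. N (X n)) \<longlonglongrightarrow> N x
     \<longrightarrow> (\<lambda>n. N (\<lambda>s. rearr I x s - rearr I (X n) s)) \<longlonglongrightarrow> 0)"

definition lower_loc_unif_K_monotone ::
  "real set \<Rightarrow> (real \<Rightarrow> ereal) set \<Rightarrow> ((real \<Rightarrow> ereal) \<Rightarrow> real) \<Rightarrow> bool"
  where "lower_loc_unif_K_monotone I E N \<longleftrightarrow>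
    (\<forall>x\<in>E. \<forall>X. (\<forall>n. X n \<in> E) \<and> (\<forall>n. submajorized I (X n) x) \<and> (\<lambda>n. N (X n)) \<longlonglongrightarrow> N x
     \<longrightarrow> (\<lambda>n. N (\<lambda>s. rearr I x s - rearr I (X n) s)) \<longlonglongrightarrow> 0)"

definition converges_globally_in_measure ::
  "real set \<Rightarrow> (nat \<Rightarrow> real \<Rightarrow> ereal) \<Rightarrow> (real \<Rightarrow> ereal) \<Rightarrow> bool"
  where "converges_globally_in_measure I X x \<longleftrightarrow>
    (\<forall>\<epsilon>::real. \<epsilon> > 0 \<longrightarrow>
      (\<lambda>n. emeasure (lebesgue_on I) {s \<in> I. \<bar>X n s - x s\<bar> > ereal \<epsilon>}) \<longlonglongrightarrow> 0)"

definition converges_locally_in_measure ::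
  "real set \<Rightarrow> (nat \<Rightarrow> real \<Rightarrow> ereal) \<Rightarrow> (real \<Rightarrow> ereal) \<Rightarrow> bool"
  where "converges_locally_in_measure I X x \<longleftrightarrow>
    (\<forall>A\<in>sets (lebesgue_on I). emeasure (lebesgue_on I) A < \<infinity> \<longrightarrow>
      (\<forall>\<epsilon>::real. \<epsilon> > 0 \<longrightarrow>
        (\<lambda>n. emeasure (lebesgue_on I) {s \<in> A. \<bar>X n s - x s\<bar> > ereal \<epsilon>}) \<longlonglongrightarrow> 0))"

definition kadec_klee_global ::
  "real set \<Rightarrow> (real \<Rightarrow> ereal) set \<Rightarrow> ((real \<Rightarrow> ereal) \<Rightarrow> real) \<Rightarrow> bool"
  where "kadec_klee_global I E N \<longleftrightarrow>
    (\<forall>x\<in>E. \<forall>X. (\<forall>n. X n \<in> E) \<and> converges_globally_in_measure I X x \<and> (\<lambda>n. N (X n)) \<longlonglongrightarrow> N x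
     \<longrightarrow> (\<lambda>n. N (\<lambda>s. X n s - x s)) \<longlonglongrightarrow> 0)"

definition kadec_klee_local ::
  "real set \<Rightarrow> (real \<Rightarrow> ereal) set \<Rightarrow> ((real \<Rightarrow> ereal) \<Rightarrow> real) \<Rightarrow> bool"
  where "kadec_klee_local I E N \<longleftrightarrow>
    (\<forall>x\<in>E. \<forall>X. (\<forall>n. X n \<in> E) \<and> converges_locally_in_measure I X x \<and> (\<lambda>n. N (X n)) \<longlonglongrightarrow> N x
     \<longrightarrow> (\<lambda>n. N (\<lambda>s. X n s - x s)) \<longlonglongrightarrow> 0)"

end

theory Submission
  imports Defs
begin

text \<open>
  Write \<open>\<Phi>\<^sub>x t\<close> for the integral of \<open>x\<^sup>*\<close> over \<open>[0,t]\<close>; these functions are concave, and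
  \<open>x \<prec> y\<close> means \<open>\<Phi>\<^sub>x \<le> \<Phi>\<^sub>y\<close>. Let \<open>E\<close> be strictly \<open>K\<close>-monotone and let the norms of \<open>x\<^sub>n\<close> tend to the
  norm of \<open>x\<close>. If \<open>x \<prec> x\<^sub>n\<close> for all \<open>n\<close>, or \<open>x\<^sub>n \<prec> x\<close> for all \<open>n\<close>, then \<open>\<Phi>\<close> of \<open>x\<^sub>n\<close> converges pointwise
  to \<open>\<Phi>\<^sub>x\<close>: otherwise there is a fixed \<open>z\<close> strictly between \<open>x\<close> and infinitely many \<open>x\<^sub>n\<close>, where \<open>\<Phi>\<^sub>z\<close>
  is the concave hull of \<open>\<Phi>\<^sub>x\<close> and a point above its graph, or the minimum of \<open>\<Phi>\<^sub>x\<close> and a line, and the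
  norm of \<open>z\<close> separates the norms of \<open>x\<^sub>n\<close> from that of \<open>x\<close>. By concavity the derivatives \<open>x\<^sub>n\<^sup>*\<close> then
  converge to \<open>x\<^sup>*\<close> a.e., and a Kadec-Klee property gives convergence in norm. This yields (i), (ii)
  and (v) from (iv).

  Conversely, let \<open>x\<^sub>n\<close> converge to \<open>x\<close> locally in measure. Then \<open>max x\<^sub>n\<^sup>* x\<^sup>*\<close> majorizes \<open>x\<^sup>*\<close>, and by order
  continuity it differs little from \<open>x\<^sub>n\<^sup>*\<close> in norm. Hence again \<open>\<Phi>\<close> of \<open>x\<^sub>n\<close> converges to \<open>\<Phi>\<^sub>x\<close>, and the
  convergence of \<open>x\<^sub>n\<close> is in fact global in measure, so that (iii) implies (iv). Since global
  convergence in measure together with norm convergence of the rearrangements entails norm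
  convergence, (i) and (v) imply (iv) as well. Finally, the local uniform conditions, applied to
  constant sequences and to multiples, imply strict \<open>K\<close>-monotonicity.
\<close>

section \<open>Decreasing functions and their primitives\<close>

text \<open>Strict K-monotonicity compares one fixed pair and gives no uniform gap, so every limit
  argument needs comparison elements that do not depend on n. The two directions are not symmetric.
  Among the concave functions above \<Phi> of x and above a given point there is a least one, so a
  single hull serves all n. Below x there is no greatest concave function that stays under a given
  point: its supporting line at that point may have any slope. These slopes are bounded, and
  rounding them to a finite grid leaves finitely many cuts. Order continuity enters in two ways: as
  dominated convergence in norm, and through the finiteness of distribution functions at positive
  levels. The latter makes x* vanish at infinity, hence \<Phi>(t)/t tends to 0; this sublinearity
  yields the right tangents and the second crossing points. Under local convergence in measure the
  functions x_n* and x* need not be comparable; only a lower bound for x_n* survives, and the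
  maximum turns it into exact majorization. Condition (iv) is the hub because a.e. convergence of
  rearrangements gives local convergence in measure at once.\<close>

text \<open>
  Nothing is required at \<open>0\<close>: a rearrangement may be infinite there, and its real version then takes
  the junk value \<open>0\<close>.
\<close>

definition decr :: "(real \<Rightarrow> real) \<Rightarrow> bool"
  where "decr g \<longleftrightarrow> (\<forall>s t. 0 < s \<longrightarrow> s \<le> t \<longrightarrow> g t \<le> g s) \<and> (\<forall>t. 0 \<le> g t) \<and> (\<forall>t. g integrable_on {0..t})"

definition cumul :: "(real \<Rightarrow> real) \<Rightarrow> real \<Rightarrow> real"
  where "cumul g t = integral {0..t} g"

lemma decrD:
  assumes "decr g"
  shows decr_antimono: "0 < s \<Longrightarrow> s \<le> t \<Longrightarrow> g t \<le> g s"
    and decr_nonneg: "0 \<le> g t"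
    and decr_integrable: "0 \<le> a \<Longrightarrow> g integrable_on {a..b}"
proof -
  show "0 < s \<Longrightarrow> s \<le> t \<Longrightarrow> g t \<le> g s" "0 \<le> g t"
    using assms by (auto simp: decr_def)
  have "g integrable_on {0..b}" using assms by (auto simp: decr_def)
  then show "0 \<le> a \<Longrightarrow> g integrable_on {a..b}"
    by (rule integrable_subinterval_real) auto
qed

lemma borel_measurable_antimono_pos:
  fixes h :: "real \<Rightarrow> real"
  assumes "\<And>s t. 0 < s \<Longrightarrow> s \<le> t \<Longrightarrow> h t \<le> h s"
  shows "(\<lambda>s. if 0 < s then h s else 0) \<in> borel_measurable borel"
proof -
  have "(\<lambda>s. - (if 0 < s then h s else 0)) \<in> borel_measurable borel"
    by (rule borel_measurable_piecewise_mono[of "{{0<..},{..0}}"])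
       (auto simp: mono_on_def assms)
  then have "(\<lambda>s. - (- (if 0 < s then h s else 0))) \<in> borel_measurable borel"
    by (rule borel_measurable_uminus)
  then show ?thesis by simp
qed

text \<open>Monotonicity supplies measurability, so domination by an integrable function is enough.
  The point 0, where nothing is known, is overwritten in both functions.\<close>

lemma integrable_antimono_bounded:
  fixes h :: "real \<Rightarrow> real"
  assumes "\<And>s t. 0 < s \<Longrightarrow> s \<le> t \<Longrightarrow> h t \<le> h s" "\<And>s. 0 < s \<Longrightarrow> 0 \<le> h s"
    and "k integrable_on {0..t}" "\<And>s. 0 < s \<Longrightarrow> s \<le> t \<Longrightarrow> h s \<le> k s"
  shows "h integrable_on {0..t}"
proof -
  let ?h = "\<lambda>s. if 0 < s then h s else 0"
  let ?k = "\<lambda>s. if 0 < s then k s else 0"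
  have k: "?k integrable_on {0..t}"
    by (rule integrable_spike[OF assms(3), of "{0}"]) auto
  have "?h absolutely_integrable_on {0..t}"
  proof (rule measurable_bounded_by_integrable_imp_absolutely_integrable[OF _ _ k])
    have "?h \<in> borel_measurable borel"
      by (rule borel_measurable_antimono_pos) (use assms(1) in auto)
    then have "?h \<in> borel_measurable lborel" by simp
    then have "?h \<in> borel_measurable lebesgue"
      by (rule measurable_completion)
    then show "?h \<in> borel_measurable (lebesgue_on {0..t})"
      by (rule measurable_restrict_space1)
  qed (use assms in auto)
  then have "?h integrable_on {0..t}"
    by (rule absolutely_integrable_on_def[THEN iffD1, THEN conjunct1])
  then show ?thesis
    by (rule integrable_spike[of _ _ "{0}"]) auto
qed

lemma cumul_0 [simp]: "cumul g 0 = 0"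
  by (simp add: cumul_def)

lemma cumul_scale: "cumul (\<lambda>s. c * g s) t = c * cumul g t"
  by (simp add: cumul_def)

lemma cumul_add:
  assumes "decr g" "0 \<le> s" "s \<le> t"
  shows "cumul g t = cumul g s + integral {s..t} g"
  unfolding cumul_def
  using Henstock_Kurzweil_Integration.integral_combine[OF assms(2,3) decr_integrable[OF assms(1) order.refl]] by simp

lemma cumul_le_right:
  assumes "decr g" "0 < s" "s \<le> t"
  shows "cumul g t \<le> cumul g s + g s * (t - s)"
proof -
  have "integral {s..t} g \<le> integral {s..t} (\<lambda>_. g s)"
    by (rule integral_le) (use assms decr_integrable decr_antimono in auto)
  then show ?thesis using cumul_add[OF assms(1) _ assms(3)] assms by (simp add: mult.commute)
qed

lemma cumul_ge_left:
  assumes "decr g" "0 \<le> s" "s \<le> t" "0 < t"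
  shows "cumul g s + g t * (t - s) \<le> cumul g t"
proof -
  \<comment> \<open>The case s = 0 is allowed and \<open>g 0\<close> may lie below
    \<open>g t\<close>, so the integrand is corrected at 0.\<close>
  have "integral {s..t} (\<lambda>_. g t) \<le> integral {s..t} (\<lambda>r. if r \<in> {0} then g t else g r)"
  proof (rule integral_le)
    show "(\<lambda>r. if r \<in> {0} then g t else g r) integrable_on {s..t}"
      by (rule integrable_spike[OF decr_integrable[OF assms(1,2)], of "{0}"]) auto
  qed (use assms decr_antimono[OF assms(1)] in auto)
  also have "\<dots> = integral {s..t} g"
    by (rule integral_spike[of "{0}"]) auto
  finally show ?thesis using cumul_add[OF assms(1-3)] assms by (simp add: mult.commute)
qed

text \<open>\<open>g s\<close> is a supergradient at s of the concave function
  \<open>cumul g\<close>.\<close>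

lemma cumul_support:
  assumes "decr g" "0 < s" "0 \<le> t"
  shows "cumul g t \<le> cumul g s + g s * (t - s)"
  using cumul_le_right[OF assms(1,2), of t] cumul_ge_left[OF assms(1,3), of s] assms(2)
  by (cases "s \<le> t") (auto simp: algebra_simps)

lemma cumul_mono:
  assumes "decr g" "0 \<le> s" "s \<le> t"
  shows "cumul g s \<le> cumul g t"
  using cumul_add[OF assms] integral_nonneg[OF decr_integrable[OF assms(1,2)] decr_nonneg[OF assms(1)]]
  by simp

lemma cumul_nonneg: "decr g \<Longrightarrow> 0 \<le> t \<Longrightarrow> 0 \<le> cumul g t"
  using cumul_mono[of g 0 t] by simp

text \<open>Concavity without division, so that degenerate intervals are allowed: \<open>g t\<close>
  separates the slopes of the two chords that meet at t.\<close>

lemma cumul_chord: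
  assumes "decr g" "0 \<le> a" "a \<le> t" "t \<le> b"
  shows "(cumul g b - cumul g t) * (t - a) \<le> (cumul g t - cumul g a) * (b - t)"
proof (cases "t = 0")
  case False
  then have t: "0 < t" using assms by auto
  have "(cumul g b - cumul g t) * (t - a) \<le> g t * (b - t) * (t - a)"
    using cumul_le_right[OF assms(1) t assms(4)] assms by (intro mult_right_mono) auto
  also have "\<dots> = g t * (t - a) * (b - t)" by simp
  also have "\<dots> \<le> (cumul g t - cumul g a) * (b - t)"
    using cumul_ge_left[OF assms(1-3) t] assms by (intro mult_right_mono) auto
  finally show ?thesis .
qed (use assms in auto)

lemma continuous_on_cumul:
  assumes "decr g"
  shows "continuous_on {0..b} (cumul g)"
  unfolding cumul_def[abs_def]
  by (rule indefinite_integral_continuous_1[OF decr_integrable[OF assms order.refl]])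

lemma cumul_average_antimono:
  assumes "decr g" "0 < s" "s \<le> t"
  shows "cumul g t / t \<le> cumul g s / s"
  using cumul_chord[OF assms(1), of 0 s t] assms
  by (simp add: field_simps)

lemma decr_le_cumul_average:
  assumes "decr g" "0 < t"
  shows "g t \<le> cumul g t / t"
  using cumul_ge_left[OF assms(1), of 0 t] assms by (simp add: field_simps)

lemma cumul_average_tendsto_0:
  assumes g: "decr g" and lim: "(g \<longlongrightarrow> 0) at_top"
  shows "((\<lambda>t. cumul g t / t) \<longlongrightarrow> 0) at_top"
proof (rule order_tendstoI)
  fix e :: real assume e: "e < 0"
  show "\<forall>\<^sub>F t in at_top. e < cumul g t / t"
    using eventually_gt_at_top[of 0]
  proof eventually_elim
    case (elim t)
    then have "0 \<le> cumul g t / t" using cumul_nonneg[OF g, of t] by simp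
    with e show ?case by linarith
  qed
next
  fix e :: real assume e: "0 < e"
  then have "\<forall>\<^sub>F t in at_top. g t < e / 2 \<and> 0 < t"
    using order_tendstoD(2)[OF lim, of "e / 2"] eventually_gt_at_top[of 0]
    by (intro eventually_conj) auto
  then obtain s where s: "g s < e / 2" "0 < s"
    by (auto simp: eventually_at_top_linorder)
  \<comment> \<open>From here on the mass on [0,s] contributes less than e/2 to the average; the
    rest contributes at most e/2 because g is below e/2 from s on.\<close>
  have "\<forall>\<^sub>F t in at_top. max s (2 * cumul g s / e) < t" by (rule eventually_gt_at_top)
  then show "\<forall>\<^sub>F t in at_top. cumul g t / t < e"
  proof eventually_elim
    case (elim t)
    then have t: "s < t" "2 * cumul g s / e < t" by auto
    then have "cumul g s < e / 2 * t" using e by (simp add: field_simps)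
    moreover have "g s * (t - s) \<le> e / 2 * (t - s)"
      using s t by (intro mult_right_mono) auto
    moreover have "e / 2 * (t - s) \<le> e / 2 * t" using s e by simp
    ultimately have "cumul g t < e * t"
      using cumul_le_right[OF g s(2), of t] t by (simp add: algebra_simps)
    then show ?case using s t by (simp add: field_simps)
  qed
qed

text \<open>By concavity \<open>G n t\<close> lies between the difference quotients of
  \<open>cumul (G n)\<close> to the right and to the left of t. These converge to quotients of
  \<open>cumul g\<close>, which are close to \<open>g t\<close> by continuity.\<close>

lemma cumul_tendsto_imp_tendsto:
  assumes G: "\<And>n. decr (G n)" and g: "decr g" and t: "0 < t" "t < \<alpha>" and c: "isCont g t"
    and lim: "\<And>s. 0 < s \<Longrightarrow> s < \<alpha> \<Longrightarrow> (\<lambda>n. cumul (G n) s) \<longlonglongrightarrow> cumul g s"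
  shows "(\<lambda>n. G n t) \<longlonglongrightarrow> g t"
proof (rule order_tendstoI)
  fix a assume "a < g t"
  then have "\<forall>\<^sub>F y in at t. a < g y"
    using order_tendstoD(1)[OF c[unfolded isCont_def]] by simp
  then obtain d where "d > 0" "\<And>y. y \<noteq> t \<Longrightarrow> \<bar>y - t\<bar> < d \<Longrightarrow> a < g y"
    unfolding eventually_at dist_real_def by auto
  with \<open>a < g t\<close> have d: "d > 0" "\<And>y. \<bar>y - t\<bar> < d \<Longrightarrow> a < g y"
    by metis+
  \<comment> \<open>The second entry keeps s below \<alpha>, the end of the range where convergence
    is assumed.\<close>
  define s where "s = min (t + d / 2) ((t + \<alpha>) / 2)"
  have s: "t < s" "s < \<alpha>" "\<bar>s - t\<bar> < d" using t d(1) by (auto simp: s_def min_def field_simps)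
  have "(\<lambda>n. (cumul (G n) s - cumul (G n) t) / (s - t)) \<longlonglongrightarrow> (cumul g s - cumul g t) / (s - t)"
    using s t by (intro tendsto_intros lim) auto
  moreover have "g s \<le> (cumul g s - cumul g t) / (s - t)"
    using cumul_ge_left[OF g, of t s] s t by (simp add: field_simps)
  then have "a < (cumul g s - cumul g t) / (s - t)" using d(2)[OF s(3)] by simp
  ultimately have "\<forall>\<^sub>F n in sequentially. a < (cumul (G n) s - cumul (G n) t) / (s - t)"
    by (rule order_tendstoD)
  then show "\<forall>\<^sub>F n in sequentially. a < G n t"
  proof eventually_elim
    case (elim n)
    have "(cumul (G n) s - cumul (G n) t) / (s - t) \<le> G n t"
      using cumul_le_right[OF G[of n] t(1), of s] s by (simp add: field_simps)
    with elim show ?case by simp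
  qed
next
  fix a assume "g t < a"
  then have "\<forall>\<^sub>F y in at t. g y < a"
    using order_tendstoD(2)[OF c[unfolded isCont_def]] by simp
  then obtain d where "d > 0" "\<And>y. y \<noteq> t \<Longrightarrow> \<bar>y - t\<bar> < d \<Longrightarrow> g y < a"
    unfolding eventually_at dist_real_def by auto
  with \<open>g t < a\<close> have d: "d > 0" "\<And>y. \<bar>y - t\<bar> < d \<Longrightarrow> g y < a"
    by metis+
  define s where "s = max (t - d / 2) (t / 2)"
  have s: "0 < s" "s < t" "\<bar>s - t\<bar> < d" using t d(1) by (auto simp: s_def max_def field_simps)
  have "(\<lambda>n. (cumul (G n) t - cumul (G n) s) / (t - s)) \<longlonglongrightarrow> (cumul g t - cumul g s) / (t - s)"
    using s t by (intro tendsto_intros lim) auto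
  moreover have "(cumul g t - cumul g s) / (t - s) \<le> g s"
    using cumul_le_right[OF g s(1), of t] s by (simp add: field_simps)
  then have "(cumul g t - cumul g s) / (t - s) < a" using d(2)[OF s(3)] by simp
  ultimately have "\<forall>\<^sub>F n in sequentially. (cumul (G n) t - cumul (G n) s) / (t - s) < a"
    by (rule order_tendstoD)
  then show "\<forall>\<^sub>F n in sequentially. G n t < a"
  proof eventually_elim
    case (elim n)
    have "G n t \<le> (cumul (G n) t - cumul (G n) s) / (t - s)"
      using cumul_ge_left[OF G[of n], of s t] s t by (simp add: field_simps)
    with elim show ?case by simp
  qed
qed

section \<open>Cuts by lines and concave hulls\<close>

lemma cumul_step:
  assumes "decr h" "0 \<le> s" "s \<le> t" "\<And>r. s < r \<Longrightarrow> r < t \<Longrightarrow> h r = c"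
  shows "cumul h t = cumul h s + c * (t - s)"
proof -
  have "integral {s..t} h = integral {s..t} (\<lambda>_. c)"
    by (rule integral_spike[of "{s,t}"]) (use assms in auto)
  then show ?thesis using cumul_add[OF assms(1-3)] assms(3) by (simp add: mult.commute)
qed

lemma cumul_diff_cong:
  assumes "decr h" "decr g" "0 \<le> s" "s \<le> t" "\<And>r. s < r \<Longrightarrow> r < t \<Longrightarrow> h r = g r"
  shows "cumul h t - cumul h s = cumul g t - cumul g s"
proof -
  have "integral {s..t} h = integral {s..t} g"
    by (rule integral_spike[of "{s,t}"]) (use assms in auto)
  then show ?thesis using cumul_add[OF assms(1,3,4)] cumul_add[OF assms(2,3,4)] by simp
qed

text \<open>Compares the affine pieces of the two constructions below with another concave function:
  only the end points of a piece have to be checked.\<close>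

lemma cumul_above_chord:
  assumes k: "decr k" and a: "0 \<le> a" "a \<le> t" "t \<le> b"
    and A: "A \<le> cumul k a" and B: "A + c * (b - a) \<le> cumul k b"
  shows "A + c * (t - a) \<le> cumul k t"
proof (cases "a = b")
  case False
  then have ab: "0 < b - a" using a by auto
  have "(cumul k b - cumul k t) * (t - a) \<le> (cumul k t - cumul k a) * (b - t)"
    by (rule cumul_chord[OF k a])
  then have "cumul k b * (t - a) + cumul k a * (b - t) \<le> cumul k t * (b - a)"
    by (simp add: algebra_simps)
  moreover have "(A + c * (b - a)) * (t - a) \<le> cumul k b * (t - a)"
    using B a by (intro mult_right_mono) auto
  moreover have "A * (b - t) \<le> cumul k a * (b - t)"
    using A a by (intro mult_right_mono) auto
  moreover have "(A + c * (b - a)) * (t - a) + A * (b - t) = (A + c * (t - a)) * (b - a)"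
    by (simp add: algebra_simps)
  ultimately have "(A + c * (t - a)) * (b - a) \<le> cumul k t * (b - a)" by linarith
  then show ?thesis using ab by simp
qed (use a A in auto)

lemma cumul_sublinear:
  assumes "decr g" "(g \<longlongrightarrow> 0) at_top" "0 < q"
  shows "\<forall>\<^sub>F t in at_top. cumul g t < q * t"
  using order_tendstoD(2)[OF cumul_average_tendsto_0[OF assms(1,2)] assms(3)] eventually_gt_at_top[of 0]
  by eventually_elim (simp add: field_simps)

text \<open>
  The function \<open>h\<close> is chosen such that \<open>cumul h\<close> is the minimum of \<open>cumul g\<close> and a line.
\<close>

lemma cut_by_line:
  assumes g: "decr g" and lim: "(g \<longlongrightarrow> 0) at_top"
    and t0: "0 < t0" and \<eta>: "0 < \<eta>" and q: "0 < q" and l0: "q * t0 \<le> cumul g t0 - \<eta>"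
  obtains h b where "decr h" "\<And>s. h s \<le> g s + (if s < b then q else 0)"
    "\<And>t. 0 \<le> t \<Longrightarrow> cumul h t \<le> cumul g t"
    "\<And>t. 0 \<le> t \<Longrightarrow> min (cumul g t) (cumul g t0 - \<eta> + q * (t - t0)) \<le> cumul h t"
    "cumul h t0 < cumul g t0"
proof -
  define l where "l = (\<lambda>t. cumul g t0 - \<eta> + q * (t - t0))"
  define G where "G = (\<lambda>t. cumul g t - l t)"
  have l: "l t = l s + q * (t - s)" for s t by (simp add: l_def algebra_simps)
  have contG: "continuous_on {0..c} G" for c
    unfolding G_def l_def by (intro continuous_intros continuous_on_cumul g)
  \<comment> \<open>A line of positive slope overtakes a sublinear function; this produces the
    crossing point b to the right of t0.\<close>
  have "\<forall>\<^sub>F t in at_top. cumul g t < q * t \<and> t0 < t"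
    by (intro eventually_conj cumul_sublinear g lim q eventually_gt_at_top)
  then obtain T where T: "cumul g T < q * T" "t0 < T"
    by (auto simp: eventually_at_top_linorder)
  \<comment> \<open>By \<open>l0\<close> the line is nonnegative at 0. So G is nonpositive at 0 and
    at T but equals \<eta> at t0.\<close>
  have G0: "G 0 \<le> 0" and Gt0: "G t0 = \<eta>" and GT: "G T \<le> 0"
    using l0 T by (auto simp: G_def l_def algebra_simps)
  obtain a where a: "0 \<le> a" "a \<le> t0" "G a = 0"
    using IVT'[of G 0 0 t0] contG[of t0] G0 Gt0 \<eta> t0 by auto
  obtain b where b: "t0 \<le> b" "b \<le> T" "G b = 0"
    using IVT2'[of G T 0 t0] continuous_on_subset[OF contG[of T], of "{t0..T}"] GT Gt0 \<eta> t0 T by auto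
  have at: "a < t0" and tb: "t0 < b" using a b Gt0 \<eta> by (auto simp: less_le)
  have \<Phi>a: "cumul g a = l a" and \<Phi>b: "cumul g b = l b" and \<Phi>t: "cumul g t0 = l t0 + \<eta>"
    using a b Gt0 by (auto simp: G_def)
  \<comment> \<open>Between a and t0 the primitive gains \<eta> on the line, so its slope at a
    exceeds q; likewise its slope is below q from b on. Hence replacing g by q between a and b keeps
    it decreasing.\<close>
  have ga: "q \<le> g s" if "0 < s" "s \<le> a" for s
  proof -
    have "q * (t0 - a) < g a * (t0 - a)"
      using cumul_le_right[OF g, of a t0] that at l[of t0 a] \<Phi>a \<Phi>t \<eta> by linarith
    then have "q < g a" using at by simp
    then show ?thesis using decr_antimono[OF g that] by simp
  qed
  have gb: "g s \<le> q" if "b \<le> s" for s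
  proof -
    have "g b * (b - t0) < q * (b - t0)"
      using cumul_ge_left[OF g, of t0 b] tb t0 l[of b t0] \<Phi>b \<Phi>t \<eta> by linarith
    then have "g b < q" using tb by simp
    then show ?thesis using decr_antimono[OF g _ that] tb t0 by simp
  qed
  define h where "h = (\<lambda>s. if a < s \<and> s < b then q else g s)"
  have hanti: "h t \<le> h s" if "0 < s" "s \<le> t" for s t
    using that ga[of s] gb[of t] decr_antimono[OF g that] by (auto simp: h_def)
  have hle: "h s \<le> g s + (if s < b then q else 0)" for s
    using decr_nonneg[OF g] q by (auto simp: h_def)
  have h: "decr h"
    unfolding decr_def
  proof (intro conjI allI impI)
    fix t show "h integrable_on {0..t}"
    proof (rule integrable_antimono_bounded[OF hanti])
      show "(\<lambda>s. g s + q) integrable_on {0..t}"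
        by (intro integrable_add decr_integrable[OF g] integrable_const_ivl) auto
      show "h s \<le> g s + q" for s using decr_nonneg[OF g] q by (auto simp: h_def)
    qed (use decr_nonneg[OF g] q in \<open>auto simp: h_def\<close>)
  qed (use hanti decr_nonneg[OF g] q in \<open>auto simp: h_def\<close>)
  have h1: "cumul h t = cumul g t" if "0 \<le> t" "t \<le> a" for t
    using cumul_diff_cong[OF h g, of 0 t] that by (simp add: h_def)
  have h2: "cumul h t = l t" if "a \<le> t" "t \<le> b" for t
    using cumul_step[OF h, of a t q] that a h1[of a] \<Phi>a l[of t a] by (simp add: h_def)
  have h3: "cumul h t = cumul g t" if "b \<le> t" for t
    using cumul_diff_cong[OF h g, of b t] that t0 tb at h2[of b] \<Phi>b by (simp add: h_def)
  have lg: "l t \<le> cumul g t" if "a \<le> t" "t \<le> b" for t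
    using cumul_above_chord[OF g a(1) that, of "l a" q] \<Phi>a \<Phi>b l[of b a] l[of t a] by simp
  show thesis
  proof (rule that[OF h hle])
    fix t :: real assume t: "0 \<le> t"
    show "cumul h t \<le> cumul g t"
      using h1[of t] h2[of t] h3[of t] lg[of t] t by (cases "t \<le> a"; cases "t \<le> b") auto
    show "min (cumul g t) (cumul g t0 - \<eta> + q * (t - t0)) \<le> cumul h t"
      unfolding l_def[symmetric, THEN fun_cong]
      using h1[of t] h2[of t] h3[of t] t by (cases "t \<le> a"; cases "t \<le> b") (auto simp: l_def)
  next
    show "cumul h t0 < cumul g t0" using h2[of t0] at tb \<Phi>t \<eta> by simp
  qed
qed

text \<open>The tangent to the graph of \<open>cumul g\<close> from the point at height \<theta>
  above it at t0. It touches where the line from the graph to the point has least slope; this slope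
  blows up near t0, so the minimum is attained away from t0.\<close>

lemma tangent_left:
  assumes g: "decr g" and t0: "0 < t0" and \<theta>: "0 < \<theta>"
  obtains a c where "0 \<le> a" "a < t0" "cumul g a + c * (t0 - a) = cumul g t0 + \<theta>"
    "\<And>s. 0 \<le> s \<Longrightarrow> s \<le> t0 \<Longrightarrow> cumul g s + c * (t0 - s) \<le> cumul g t0 + \<theta>"
proof -
  define P where "P = cumul g t0 + \<theta>"
  define slope where "slope = (\<lambda>s. (P - cumul g s) / (t0 - s))"
  \<comment> \<open>Chosen such that \<theta>/\<delta> = P/t0 is the slope at 0; closer to t0 than
    \<delta> every slope is larger than that.\<close>
  define \<delta> where "\<delta> = \<theta> * t0 / P"
  have P: "0 < P" "\<theta> \<le> P" using cumul_nonneg[OF g, of t0] t0 \<theta> by (auto simp: P_def)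
  have \<delta>: "0 < \<delta>" "\<delta> \<le> t0" using P t0 \<theta> by (auto simp: \<delta>_def field_simps)
  have "continuous_on {0..t0 - \<delta>} slope"
    unfolding slope_def using \<delta> by (intro continuous_intros continuous_on_cumul g) auto
  then obtain a where a: "a \<in> {0..t0 - \<delta>}" "\<forall>s\<in>{0..t0 - \<delta>}. slope a \<le> slope s"
    using continuous_attains_inf[of "{0..t0 - \<delta>}" slope] \<delta> by auto
  have min: "slope a \<le> slope s" if s: "0 \<le> s" "s < t0" for s
  proof (cases "s \<le> t0 - \<delta>")
    case False
    have "slope a \<le> slope 0" using a \<delta> by auto
    also have "\<dots> = \<theta> / \<delta>" using \<theta> t0 P by (simp add: slope_def \<delta>_def)
    also have "\<dots> \<le> \<theta> / (t0 - s)"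
      using False s \<theta> by (intro divide_left_mono mult_pos_pos) (use \<delta> in auto)
    also have "\<dots> \<le> slope s"
      unfolding slope_def using s cumul_mono[OF g s(1), of t0] by (intro divide_right_mono) (auto simp: P_def)
    finally show ?thesis .
  qed (use a s in auto)
  show thesis
  proof (rule that[of a "slope a"])
    show "0 \<le> a" "a < t0" using a \<delta> by auto
    then show "cumul g a + slope a * (t0 - a) = cumul g t0 + \<theta>"
      by (simp add: slope_def P_def)
    fix s assume s: "0 \<le> s" "s \<le> t0"
    show "cumul g s + slope a * (t0 - s) \<le> cumul g t0 + \<theta>"
    proof (cases "s = t0")
      case False
      then have "slope a * (t0 - s) \<le> slope s * (t0 - s)"
        using min[of s] s by (intro mult_right_mono) auto
      then show ?thesis using False by (simp add: slope_def P_def)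
    qed (use \<theta> in auto)
  qed
qed

text \<open>The counterpart of \<open>tangent_left\<close>, where the slope is maximized. The graph
  has to rise above the point somewhere, at t1, to make the supremum positive; it is then attained,
  since the slope is nonpositive near t0 and small far out by sublinearity.\<close>

lemma tangent_right:
  assumes g: "decr g" and lim: "(g \<longlongrightarrow> 0) at_top" and t0: "0 < t0" and \<theta>: "0 < \<theta>"
    and t1: "t0 < t1" "cumul g t0 + \<theta> < cumul g t1"
  obtains b c where "t0 < b" "0 \<le> c" "cumul g b = cumul g t0 + \<theta> + c * (b - t0)"
    "\<And>s. t0 \<le> s \<Longrightarrow> cumul g s \<le> cumul g t0 + \<theta> + c * (s - t0)"
proof -
  define P where "P = cumul g t0 + \<theta>"
  define slope where "slope = (\<lambda>s. (cumul g s - P) / (s - t0))"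
  \<comment> \<open>Within \<delta> of t0 the primitive rises by at most \<theta>; the added 1
    covers \<open>g t0 = 0\<close>.\<close>
  define \<delta> where "\<delta> = \<theta> / (g t0 + 1)"
  have \<delta>: "0 < \<delta>" using decr_nonneg[OF g, of t0] \<theta> by (auto simp: \<delta>_def field_simps)
  have pos: "0 < slope t1" using t1 by (simp add: slope_def P_def)
  have small: "slope s \<le> 0" if s: "t0 < s" "s \<le> t0 + \<delta>" for s
  proof -
    have "g t0 * (s - t0) \<le> g t0 * \<delta>" using s decr_nonneg[OF g] by (intro mult_left_mono) auto
    also have "\<dots> \<le> \<theta>" using decr_nonneg[OF g, of t0] \<theta> by (auto simp: \<delta>_def field_simps)
    finally have "cumul g s \<le> P" using cumul_le_right[OF g t0, of s] s by (simp add: P_def)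
    then show ?thesis using s by (simp add: slope_def divide_nonpos_pos)
  qed
  have t1\<delta>: "t0 + \<delta> < t1" using small[of t1] t1 pos by force
  \<comment> \<open>Half the slope suffices because t/2 is at most t - t0 once t exceeds 2
    t0.\<close>
  have "\<forall>\<^sub>F t in at_top. cumul g t < slope t1 / 2 * t \<and> max t1 (2 * t0) < t"
    using pos by (intro eventually_conj cumul_sublinear g lim eventually_gt_at_top) auto
  then obtain T where T: "\<And>t. T \<le> t \<Longrightarrow> cumul g t < slope t1 / 2 * t \<and> max t1 (2 * t0) < t"
    unfolding eventually_at_top_linorder by auto
  have T1: "t1 < T" using T[of T] by auto
  have large: "slope s \<le> slope t1" if s: "T \<le> s" for s
  proof -
    have "s / 2 \<le> s - t0" using T[OF s] by auto
    then have "slope t1 * (s / 2) \<le> slope t1 * (s - t0)" using pos by (intro mult_left_mono) auto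
    then have "cumul g s - P \<le> slope t1 * (s - t0)"
      using T[OF s] cumul_nonneg[OF g, of t0] t0 \<theta> by (simp add: P_def)
    then show ?thesis using T[OF s] t1 by (simp add: slope_def divide_le_eq)
  qed
  have "continuous_on {t0 + \<delta>..T} (cumul g)"
    by (rule continuous_on_subset[OF continuous_on_cumul[OF g, of T]]) (use \<delta> t0 in auto)
  then have "continuous_on {t0 + \<delta>..T} slope"
    unfolding slope_def using \<delta> by (intro continuous_intros) auto
  then obtain b where b: "b \<in> {t0 + \<delta>..T}" "\<forall>s\<in>{t0 + \<delta>..T}. slope s \<le> slope b"
    using continuous_attains_sup[of "{t0 + \<delta>..T}" slope] t1\<delta> T1 by auto
  have b1: "slope t1 \<le> slope b" using b t1\<delta> T1 by auto
  have max: "slope s \<le> slope b" if s: "t0 < s" for s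
    using small[OF s] large[of s] b b1 pos by (cases "s \<le> t0 + \<delta>"; cases "s \<le> T") auto
  show thesis
  proof (rule that[of b "slope b"])
    show "t0 < b" "0 \<le> slope b" using b \<delta> b1 pos by auto
    then show "cumul g b = cumul g t0 + \<theta> + slope b * (b - t0)"
      by (simp add: slope_def P_def)
    fix s assume s: "t0 \<le> s"
    show "cumul g s \<le> cumul g t0 + \<theta> + slope b * (s - t0)"
    proof (cases "s = t0")
      case False
      then have "slope s * (s - t0) \<le> slope b * (s - t0)"
        using max[of s] s by (intro mult_right_mono) auto
      then show ?thesis using False by (simp add: slope_def P_def)
    qed (use \<theta> in auto)
  qed
qed

text \<open>
  Here \<open>cumul h\<close> is the concave hull of \<open>cumul g\<close> and of a point slightly above its graph.
\<close>

lemma hull_with_point: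
  assumes g: "decr g" and lim: "(g \<longlongrightarrow> 0) at_top" and t0: "0 < t0" and \<eta>: "0 < \<eta>"
  obtains h b c where "decr h" "\<And>s. 0 < s \<Longrightarrow> h s \<le> g s + (if s \<le> b then c else 0)" "0 \<le> c"
    "\<And>t. 0 \<le> t \<Longrightarrow> cumul g t \<le> cumul h t" "cumul g t0 < cumul h t0"
    "\<And>k t. decr k \<Longrightarrow> (\<And>s. 0 \<le> s \<Longrightarrow> cumul g s \<le> cumul k s) \<Longrightarrow> cumul g t0 + \<eta> \<le> cumul k t0 \<Longrightarrow>
      0 \<le> t \<Longrightarrow> cumul h t \<le> cumul k t"
proof -
  \<comment> \<open>If \<open>cumul g\<close> is constant from t0 on, there is no right tangent, and
    the hull is constant there too: b = t0 and slope 0. The final disjunction records which case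
    holds, since the hull meets the graph at b only in the other one.\<close>
  have "\<exists>\<theta> b c2. 0 < \<theta> \<and> \<theta> \<le> \<eta> \<and> t0 \<le> b \<and> 0 \<le> c2 \<and> c2 \<le> g t0 \<and> (\<forall>s>b. g s \<le> c2) \<and>
     (\<forall>s\<ge>t0. s \<le> b \<longrightarrow> cumul g s \<le> cumul g t0 + \<theta> + c2 * (s - t0)) \<and>
     (b = t0 \<and> (\<forall>s>t0. cumul g s = cumul g t0) \<or>
      (\<exists>s>t0. cumul g s \<noteq> cumul g t0) \<and> cumul g b = cumul g t0 + \<theta> + c2 * (b - t0))"
  proof (cases "\<forall>s>t0. cumul g s = cumul g t0")
    case True
    have "g s = 0" if "t0 < s" for s
    proof -
      have "g s * (s - t0) \<le> 0"
        using cumul_ge_left[OF g, of t0 s] True that t0 by simp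
      then show ?thesis using that decr_nonneg[OF g, of s] by (simp add: mult_le_0_iff)
    qed
    then show ?thesis using True \<eta> decr_nonneg[OF g] by (intro exI[of _ \<eta>] exI[of _ t0] exI[of _ 0]) auto
  next
    case False
    then obtain t1 where "t0 < t1" "cumul g t1 \<noteq> cumul g t0" by auto
    then have t1: "t0 < t1" "cumul g t0 < cumul g t1"
      using cumul_mono[OF g, of t0 t1] t0 by (auto simp: less_le)
    \<comment> \<open>The height is lowered until the graph rises above the point at t1, as
      \<open>tangent_right\<close> requires.\<close>
    define \<theta> where "\<theta> = min \<eta> ((cumul g t1 - cumul g t0) / 2)"
    have \<theta>: "0 < \<theta>" "\<theta> \<le> \<eta>" "cumul g t0 + \<theta> < cumul g t1"
      using \<eta> t1 by (auto simp: \<theta>_def min_def field_simps)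
    obtain b c where b: "t0 < b" "0 \<le> c" "cumul g b = cumul g t0 + \<theta> + c * (b - t0)"
      "\<And>s. t0 \<le> s \<Longrightarrow> cumul g s \<le> cumul g t0 + \<theta> + c * (s - t0)"
      using tangent_right[OF g lim t0 \<theta>(1) t1(1) \<theta>(3)] by metis
    have "c * (b - t0) < g t0 * (b - t0)"
      using cumul_le_right[OF g t0, of b] b \<theta> by linarith
    then have "c \<le> g t0" using b by simp
    moreover have "g s \<le> c" if "b < s" for s
    proof -
      have "g s * (s - b) \<le> c * (s - b)"
        using cumul_ge_left[OF g, of b s] b(4)[of s] b t0 that by (simp add: algebra_simps)
      then show ?thesis using that by simp
    qed
    ultimately show ?thesis using b \<theta> False by (intro exI[of _ \<theta>] exI[of _ b] exI[of _ c]) auto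
  qed
  then obtain \<theta> b c2 where \<theta>: "0 < \<theta>" "\<theta> \<le> \<eta>" and b: "t0 \<le> b" and c2: "0 \<le> c2" "c2 \<le> g t0"
    and gb: "\<And>s. b < s \<Longrightarrow> g s \<le> c2"
    and lb: "\<And>s. t0 \<le> s \<Longrightarrow> s \<le> b \<Longrightarrow> cumul g s \<le> cumul g t0 + \<theta> + c2 * (s - t0)"
    and alt: "b = t0 \<and> (\<forall>s>t0. cumul g s = cumul g t0) \<or>
      (\<exists>s>t0. cumul g s \<noteq> cumul g t0) \<and> cumul g b = cumul g t0 + \<theta> + c2 * (b - t0)"
    by blast
  obtain a c1 where a: "0 \<le> a" "a < t0" "cumul g a + c1 * (t0 - a) = cumul g t0 + \<theta>"
    and la: "\<And>s. 0 \<le> s \<Longrightarrow> s \<le> t0 \<Longrightarrow> cumul g s + c1 * (t0 - s) \<le> cumul g t0 + \<theta>"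
    using tangent_left[OF g t0 \<theta>(1)] by metis
  have ga: "c1 \<le> g s" if "0 < s" "s < a" for s
  proof -
    have "c1 * (a - s) \<le> g s * (a - s)"
      using cumul_le_right[OF g that(1), of a] la[of s] a that by (simp add: algebra_simps)
    then show ?thesis using that by simp
  qed
  \<comment> \<open>The left tangent gains \<theta> on the graph between a and t0, so c1 >
    \<open>g t0\<close> \<ge> c2: the hull bends the right way at t0.\<close>
  have "g t0 * (t0 - a) < c1 * (t0 - a)"
    using cumul_ge_left[OF g, of a t0] a \<theta> t0 by linarith
  then have c1: "g t0 < c1" using a by simp
  then have c1pos: "0 \<le> c1" using decr_nonneg[OF g, of t0] by simp
  define h where "h = (\<lambda>s. if s < a then g s else if s \<le> t0 then c1 else if s \<le> b then c2 else g s)"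
  have hanti: "h t \<le> h s" if "0 < s" "s \<le> t" for s t
    using that ga[of s] gb[of t] decr_antimono[OF g that] c1 c2 decr_antimono[OF g t0, of t] by (auto simp: h_def)
  have hle: "h s \<le> g s + (if s \<le> b then c1 else 0)" for s
    using decr_nonneg[OF g, of s] c1 c2 c1pos b by (auto simp: h_def)
  have h: "decr h"
    unfolding decr_def
  proof (intro conjI allI impI)
    fix t show "h integrable_on {0..t}"
    proof (rule integrable_antimono_bounded[OF hanti])
      show "(\<lambda>s. g s + c1) integrable_on {0..t}"
        by (intro integrable_add decr_integrable[OF g] integrable_const_ivl) auto
      show "h s \<le> g s + c1" for s using hle[of s] c1pos by (auto split: if_splits)
    qed (use decr_nonneg[OF g] c1pos c2 in \<open>auto simp: h_def\<close>)
  qed (use hanti decr_nonneg[OF g] c1pos c2 in \<open>auto simp: h_def\<close>)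
  have h1: "cumul h t = cumul g t" if "0 \<le> t" "t \<le> a" for t
    using cumul_diff_cong[OF h g, of 0 t] that by (simp add: h_def)
  have h2: "cumul h t = cumul g a + c1 * (t - a)" if "a \<le> t" "t \<le> t0" for t
    using cumul_step[OF h, of a t c1] that a h1[of a] by (simp add: h_def)
  have ht0: "cumul h t0 = cumul g t0 + \<theta>" using h2[of t0] a by simp
  have h3: "cumul h t = cumul g t0 + \<theta> + c2 * (t - t0)" if "t0 \<le> t" "t \<le> b" for t
    using cumul_step[OF h, of t0 t c2] that a t0 ht0 by (simp add: h_def)
  have h4: "cumul h t - cumul h b = cumul g t - cumul g b" if "b \<le> t" for t
    using cumul_diff_cong[OF h g, of b t] that b t0 a by (simp add: h_def)
  show thesis
  proof (rule that[OF h hle c1pos])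
    show "cumul g t0 < cumul h t0" using ht0 \<theta> by simp
    show "cumul g t \<le> cumul h t" if t: "0 \<le> t" for t
    proof -
      consider "t \<le> a" | "a \<le> t" "t \<le> t0" | "t0 \<le> t" "t \<le> b" | "b \<le> t" by linarith
      then show ?thesis
      proof cases
        case 1 then show ?thesis using h1 t by simp
      next
        case 2 then show ?thesis using h2[OF 2] la[OF t] a by (simp add: algebra_simps)
      next
        case 3 then show ?thesis using h3 lb by simp
      next
        case 4 then show ?thesis using h4[OF 4] h3[of b] lb[of b] b by simp
      qed
    qed
  next
    fix k t assume k: "decr k" and gk: "\<And>s. 0 \<le> s \<Longrightarrow> cumul g s \<le> cumul k s"
      and kt0: "cumul g t0 + \<eta> \<le> cumul k t0" and t: "0 \<le> (t::real)"
    have P: "cumul g t0 + \<theta> \<le> cumul k t0" using kt0 \<theta> by simp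
    \<comment> \<open>Together with a and t0 this settles all corners of the hull. At b the hull
      meets either the graph of \<open>cumul g\<close> or, if b = t0, the added point; k dominates
      both.\<close>
    have kb: "cumul h b \<le> cumul k b" using alt gk[of b] h3[of b] b t0 P by auto
    consider "t \<le> a" | "a \<le> t" "t \<le> t0" | "t0 \<le> t" "t \<le> b" | "b \<le> t" by linarith
    then show "cumul h t \<le> cumul k t"
    proof cases
      case 1 then show ?thesis using h1[of t] t gk[of t] by simp
    next
      case 2
      then show ?thesis
        using cumul_above_chord[OF k a(1) 2, of "cumul g a" c1] gk[OF a(1)] a P h2[OF 2] by simp
    next
      case 3
      then show ?thesis
        using cumul_above_chord[OF k less_imp_le[OF t0] 3, of "cumul g t0 + \<theta>" c2] kb P h3[OF 3] h3[of b] b by simp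
    next
      case 4
      show ?thesis
      proof (cases "b = t0 \<and> (\<forall>s>t0. cumul g s = cumul g t0)")
        case True
        then have "cumul h t = cumul h b" using h4[OF 4] 4 by (cases "t = b") auto
        then show ?thesis using kb cumul_mono[OF k _ 4] b t0 by simp
      next
        case False
        then have "cumul h b = cumul g b" using alt h3[of b] b by auto
        then show ?thesis using h4[OF 4] gk[OF t] by simp
      qed
    qed
  qed
qed

section \<open>Decreasing rearrangements\<close>

text \<open>\<open>rearr\<close> is the generalized inverse of \<open>distr_fun\<close>. The strict
  form rests on right continuity of the distribution function, that is, on continuity of the measure
  along the increasing sets where \<bar>x\<bar> exceeds r + 1/(n+1).\<close>

lemma less_rearr_iff:
  assumes x: "x \<in> L0 I" and r: "0 \<le> r"
  shows "ereal r < rearr I x t \<longleftrightarrow> ennreal t < distr_fun I x r"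
proof
  have anti: "distr_fun I x b \<le> distr_fun I x a" if "a \<le> b" for a b
    unfolding distr_fun_def
  proof (rule emeasure_mono)
    show "{s \<in> I. ereal b < \<bar>x s\<bar>} \<subseteq> {s \<in> I. ereal a < \<bar>x s\<bar>}"
      using that by (auto intro: le_less_trans[of "ereal a" "ereal b"])
    have "{s \<in> space (lebesgue_on I). ereal a < \<bar>x s\<bar>} \<in> sets (lebesgue_on I)"
      using x by measurable
    then show "{s \<in> I. ereal a < \<bar>x s\<bar>} \<in> sets (lebesgue_on I)" by simp
  qed
  {
    assume *: "ereal r < rearr I x t"
    show "ennreal t < distr_fun I x r"
    proof (rule ccontr)
      assume "\<not> ennreal t < distr_fun I x r"
      then have le: "distr_fun I x r' \<le> ennreal t" if "r \<le> r'" for r'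
        using anti[OF that] by (simp add: not_less)
      have "rearr I x t \<le> ereal r + ereal e" if "0 < e" for e
      proof -
        have "0 < r + e" "distr_fun I x (r + e) \<le> ennreal t" using that r le[of "r + e"] by auto
        then have "r + e \<in> {r. 0 < r \<and> distr_fun I x r \<le> ennreal t}" by blast
        then have "rearr I x t \<le> ereal (r + e)"
          unfolding rearr_def by (rule INF_lower)
        then show ?thesis by (simp only: plus_ereal.simps)
      qed
      then have "rearr I x t \<le> ereal r"
        by (rule ereal_le_epsilon2)
      with * show False by simp
    qed
  }
  {
    assume *: "ennreal t < distr_fun I x r"
    define A where "A = (\<lambda>n::nat. {s \<in> I. ereal (r + 1 / Suc n) < \<bar>x s\<bar>})"
    have A: "A n \<in> sets (lebesgue_on I)" for n
    proof -
      have "{s \<in> space (lebesgue_on I). ereal (r + 1 / Suc n) < \<bar>x s\<bar>} \<in> sets (lebesgue_on I)"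
        using x by measurable
      then show ?thesis by (simp add: A_def)
    qed
    have "incseq A"
    proof (rule incseq_SucI, unfold A_def, safe)
      fix n s assume "ereal (r + 1 / Suc n) < \<bar>x s\<bar>"
      moreover have "r + 1 / Suc (Suc n) \<le> r + 1 / Suc n" by (simp add: field_simps)
      then have "ereal (r + 1 / Suc (Suc n)) \<le> ereal (r + 1 / Suc n)" by simp
      ultimately show "ereal (r + 1 / Suc (Suc n)) < \<bar>x s\<bar>" by (rule le_less_trans[rotated])
    qed
    then have "(\<lambda>n. emeasure (lebesgue_on I) (A n)) \<longlonglongrightarrow> emeasure (lebesgue_on I) (\<Union>n. A n)"
      using A by (intro Lim_emeasure_incseq) auto
    moreover have "(\<Union>n. A n) = {s \<in> I. ereal r < \<bar>x s\<bar>}"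
    proof safe
      fix s n assume "s \<in> A n"
      then show "s \<in> I" and "ereal r < \<bar>x s\<bar>"
        using less_trans[of "ereal r" "ereal (r + 1 / Suc n)" "\<bar>x s\<bar>"] by (auto simp: A_def)
    next
      fix s assume s: "s \<in> I" "ereal r < \<bar>x s\<bar>"
      then obtain z where z: "ereal r < ereal z" "ereal z < \<bar>x s\<bar>"
        using ereal_dense3 by blast
      then obtain n where "1 / Suc n < z - r"
        using nat_approx_posE[of "z - r"] by auto
      then have "ereal (r + 1 / Suc n) < ereal z" by simp
      then have "ereal (r + 1 / Suc n) < \<bar>x s\<bar>" using z(2) by (rule less_trans)
      then have "s \<in> A n" using s by (simp add: A_def)
      then show "s \<in> (\<Union>n. A n)" by auto
    qed
    ultimately have "(\<lambda>n. distr_fun I x (r + 1 / Suc n)) \<longlonglongrightarrow> distr_fun I x r"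
      by (simp add: A_def distr_fun_def)
    then have "\<forall>\<^sub>F n in sequentially. ennreal t < distr_fun I x (r + 1 / Suc n)"
      using * by (rule order_tendstoD)
    then obtain n where n: "ennreal t < distr_fun I x (r + 1 / Suc n)"
      by (auto simp: eventually_sequentially)
    have "ereal (r + 1 / Suc n) \<le> rearr I x t"
      unfolding rearr_def
    proof (rule INF_greatest, safe)
      fix r' assume "distr_fun I x r' \<le> ennreal t"
      then have "\<not> r' \<le> r + 1 / Suc n" using n anti[of r' "r + 1 / Suc n"] by auto
      then show "ereal (r + 1 / Suc n) \<le> ereal r'" by simp
    qed
    moreover have "ereal r < ereal (r + 1 / Suc n)" by simp
    ultimately show "ereal r < rearr I x t" by (rule less_le_trans[rotated])
  }
qed

lemma rearr_nonneg: "0 \<le> rearr I x t"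
  unfolding rearr_def by (rule INF_greatest) auto

lemma rearr_antimono: "s \<le> t \<Longrightarrow> rearr I x t \<le> rearr I x s"
  unfolding rearr_def by (rule INF_superset_mono) (auto intro: order.trans ennreal_leI)

section \<open>Lebesgue measure on the interval, equimeasurability of \<open>x\<close> and
  \<open>rearr I x\<close>\<close>

context banach_function_space
begin

abbreviation M :: "real measure" where "M \<equiv> lebesgue_on I"

lemma I_nonneg: "s \<in> I \<Longrightarrow> 0 \<le> s"
  using interval by auto

lemma I_lebesgue [measurable]: "I \<in> sets lebesgue"
  using interval by auto

lemma I_downward: "t \<in> I \<Longrightarrow> 0 \<le> s \<Longrightarrow> s \<le> t \<Longrightarrow> s \<in> I"
  using interval by auto

lemma I_right_open: "t \<in> I \<Longrightarrow> \<exists>t'\<in>I. t < t'"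
  using interval by (elim disjE) (auto intro: bexI[of _ "t + 1"] bexI[of _ "(t + 1) / 2"])

lemma sets_M: "A \<in> sets lebesgue \<Longrightarrow> A \<subseteq> I \<Longrightarrow> A \<in> sets M"
  by (simp add: sets_restrict_space_iff)

lemma emeasure_M: "A \<subseteq> I \<Longrightarrow> emeasure M A = emeasure lebesgue A"
  by (simp add: emeasure_restrict_space)

lemma emeasure_M_Ico: "{a..<b} \<subseteq> I \<Longrightarrow> a \<le> b \<Longrightarrow> emeasure M {a..<b} = ennreal (b - a)"
  by (simp add: emeasure_M)

lemma M_initial: "m \<in> I \<Longrightarrow> emeasure M {0..<m} = ennreal m" "m \<in> I \<Longrightarrow> {0..<m} \<in> sets M"
  using I_nonneg[of m] I_downward[of m] by (auto intro!: sets_M simp: emeasure_M subset_eq)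

lemma AE_M_iff: "(AE s in M. P s) \<longleftrightarrow> (AE s in lebesgue. s \<in> I \<longrightarrow> P s)"
  by (rule AE_restrict_space_iff) simp

lemma AE_M_pos: "AE s in M. s \<in> I \<and> 0 < s"
proof -
  have "AE s in lborel. s \<noteq> (0::real)" by (rule AE_lborel_singleton)
  then have "AE s in lebesgue. s \<noteq> (0::real)" by (rule AE_completion)
  then show ?thesis
    unfolding AE_M_iff by eventually_elim (use I_nonneg in \<open>auto simp: less_le\<close>)
qed

lemma AE_M_countable:
  assumes "countable C" "\<And>s. s \<in> I \<Longrightarrow> 0 < s \<Longrightarrow> s \<notin> C \<Longrightarrow> P s"
  shows "AE s in M. P s"
proof -
  have "AE s in lborel. s \<notin> C"
    by (rule AE_not_in) (use countable_imp_null_set_lborel[OF assms(1)] in auto)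
  then have "AE s in lebesgue. s \<in> I \<longrightarrow> s \<notin> C" by (intro AE_completion) auto
  then have "AE s in M. s \<notin> C" unfolding AE_M_iff by simp
  with AE_M_pos show ?thesis by eventually_elim (use assms in auto)
qed

text \<open>Every interval at 0 has positive measure. This turns a.e. bounds on a decreasing
  function into bounds at all t > 0, and refutes degenerate a.e. statements.\<close>

lemma M_nonnull: "0 < t \<Longrightarrow> (AE s in M. t \<le> s) \<Longrightarrow> False"
proof -
  assume t: "0 < t" and ae: "AE s in M. t \<le> s"
  define m where "m = min t (1/2)"
  have m: "m \<in> I" "0 < m" "m \<le> t" using interval t by (auto simp: m_def)
  have "AE s in M. s \<notin> {0..<m}"
    using ae by eventually_elim (use m in auto)
  moreover have "{s \<in> space M. \<not> s \<notin> {0..<m}} = {0..<m}"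
    using I_downward[OF m(1)] by auto
  ultimately have "emeasure M {0..<m} = 0"
    using AE_iff_measurable[OF M_initial(2)[OF m(1)], of "\<lambda>s. s \<notin> {0..<m}"] by blast
  then show False using M_initial(1)[OF m(1)] m by simp
qed

lemma I_cases: obtains "I = {0..<1}" "emeasure M I = 1" | "I = {0..}" "emeasure M I = \<infinity>"
proof -
  have "emeasure lebesgue {0::real..} = \<infinity>"
  proof (rule ccontr)
    assume "emeasure lebesgue {0::real..} \<noteq> \<infinity>"
    then obtain m where m: "emeasure lebesgue {0::real..} = ennreal m" "0 \<le> m"
      by (cases "emeasure lebesgue {0::real..}") auto
    have "emeasure lebesgue {0..<m + 1} \<le> emeasure lebesgue {0::real..}"
      by (rule emeasure_mono) auto
    then show False using m by simp
  qed
  then show thesis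
    using that interval emeasure_M[of I] by (elim disjE) auto
qed

text \<open>By \<open>less_rearr_iff\<close> these initial segments are the level sets of a
  rearrangement.\<close>

lemma emeasure_below:
  assumes "d \<le> emeasure M I"
  shows "emeasure M {s \<in> I. ennreal s < d} = d"
proof (cases d)
  case (real m)
  have "{s \<in> I. ennreal s < d} = {0..<m}"
  proof (cases rule: I_cases)
    case 1 then show ?thesis using assms real by (auto simp: ennreal_less_iff)
  next
    case 2 then show ?thesis using assms real by (auto simp: ennreal_less_iff)
  qed
  moreover have "{s \<in> I. ennreal s < d} \<subseteq> I" by auto
  ultimately show ?thesis using real by (simp add: emeasure_M)
next
  case top
  then have "emeasure M I = \<infinity>" using assms by (simp add: top_unique)
  moreover have "{s \<in> I. ennreal s < d} = I" using top by auto
  ultimately show ?thesis using top by simp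
qed

lemma measurable_rearr:
  assumes "x \<in> L0 I" shows "rearr I x \<in> L0 I"
proof (rule borel_measurableI_greater)
  fix y
  have eq: "{s \<in> I. ereal r < rearr I x s} = {s \<in> I. ennreal s < distr_fun I x r}" if "0 \<le> r" for r
    using less_rearr_iff[OF assms that] by auto
  have meas: "{s \<in> I. ennreal s < d} \<in> sets M" for d
  proof (rule sets_M)
    have "{s \<in> space borel. ennreal s < d} \<in> sets borel" by measurable
    then have "I \<inter> {s. ennreal s < d} \<in> sets lebesgue"
      by (intro sets.Int I_lebesgue) auto
    then show "{s \<in> I. ennreal s < d} \<in> sets lebesgue"
      by (simp add: Int_def)
  qed auto
  show "{s \<in> space M. y < rearr I x s} \<in> sets M"
  proof (cases "0 \<le> y")
    case True
    show ?thesis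
      using True eq meas by (cases y) auto
  next
    case False
    then have "{s \<in> space M. y < rearr I x s} = space M"
      using rearr_nonneg by (auto simp: not_le intro: less_le_trans)
    then show ?thesis by simp
  qed
qed

lemma distr_fun_rearr:
  assumes "x \<in> L0 I" shows "distr_fun I (rearr I x) = distr_fun I x"
proof
  fix r
  have le: "distr_fun I y r \<le> emeasure M I" for y
    unfolding distr_fun_def by (rule emeasure_mono) auto
  show "distr_fun I (rearr I x) r = distr_fun I x r"
  proof (cases "0 \<le> r")
    case True
    have "{s \<in> I. ereal r < \<bar>rearr I x s\<bar>} = {s \<in> I. ennreal s < distr_fun I x r}"
      using less_rearr_iff[OF assms True] rearr_nonneg[of I x] by (auto simp: abs_ereal_ge0)
    then show ?thesis using emeasure_below[OF le] by (simp add: distr_fun_def)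
  next
    case False
    then have "{s \<in> I. ereal r < \<bar>z s\<bar>} = I" for z :: "real \<Rightarrow> ereal"
      by (auto intro: less_le_trans[of "ereal r" 0])
    then show ?thesis by (simp add: distr_fun_def)
  qed
qed

end

context symmetric_space
begin

lemma rearr_mem: "x \<in> E \<Longrightarrow> rearr I x \<in> E" and norm_rearr: "x \<in> E \<Longrightarrow> N (rearr I x) = N x"
  using symmetric[of "rearr I x" x] measurable measurable_rearr distr_fun_rearr by auto

end

section \<open>Real-valued representatives\<close>

lemma ereal_measurable_real [measurable]:
  "x \<in> L0 I \<Longrightarrow> (\<lambda>s. real_of_ereal (x s)) \<in> borel_measurable (lebesgue_on I)"
  by measurable

context banach_function_space
begin

text \<open>
  Every element of \<open>E\<close> is a.e. equal to a real-valued function, so that the norm can be studied on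
  real functions, where no convention for \<open>\<infinity> - \<infinity>\<close> intervenes.
\<close>

definition RE :: "(real \<Rightarrow> real) set"
  where "RE = {f. (\<lambda>s. ereal (f s)) \<in> E}"

definition nrm :: "(real \<Rightarrow> real) \<Rightarrow> real"
  where "nrm f = N (\<lambda>s. ereal (f s))"

definition dst :: "(real \<Rightarrow> real) \<Rightarrow> real \<Rightarrow> ennreal"
  where "dst f r = emeasure M {s \<in> I. r < \<bar>f s\<bar>}"

lemma dst_eq: "dst f r = distr_fun I (\<lambda>s. ereal (f s)) r"
  by (simp add: dst_def distr_fun_def)

lemma RE_measurable: "f \<in> RE \<Longrightarrow> f \<in> borel_measurable M"
proof -
  assume "f \<in> RE"
  then have "(\<lambda>s. ereal (f s)) \<in> L0 I" using measurable by (auto simp: RE_def)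
  then have "(\<lambda>s. real_of_ereal (ereal (f s))) \<in> borel_measurable M" by (rule ereal_measurable_real)
  then show ?thesis by simp
qed

lemma RE_idealI:
  assumes "f \<in> borel_measurable M" "g \<in> RE" "AE s in M. \<bar>f s\<bar> \<le> \<bar>g s\<bar>"
  shows RE_ideal: "f \<in> RE" and nrm_mono: "nrm f \<le> nrm g"
  using ideal[of "\<lambda>s. ereal (f s)" "\<lambda>s. ereal (g s)"] assms by (auto simp: RE_def nrm_def)

lemma nrm_cong_AE:
  assumes "f \<in> borel_measurable M" "g \<in> RE" "AE s in M. f s = g s"
  shows "nrm f = nrm g"
proof -
  have le: "AE s in M. \<bar>f s\<bar> \<le> \<bar>g s\<bar>" "AE s in M. \<bar>g s\<bar> \<le> \<bar>f s\<bar>" using assms(3) by auto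
  have f: "f \<in> RE" using RE_ideal[OF assms(1,2) le(1)] .
  show "nrm f = nrm g"
    using nrm_mono[OF assms(1,2) le(1)] nrm_mono[OF RE_measurable[OF assms(2)] f le(2)] by simp
qed

lemma RE_zero: "(\<lambda>s. 0) \<in> RE"
  using zero_mem by (simp add: RE_def zero_ereal_def)

lemma RE_add: "f \<in> RE \<Longrightarrow> g \<in> RE \<Longrightarrow> (\<lambda>s. f s + g s) \<in> RE"
  using add_mem[of "\<lambda>s. ereal (f s)" "\<lambda>s. ereal (g s)"] by (simp add: RE_def)

lemma RE_scale: "f \<in> RE \<Longrightarrow> (\<lambda>s. c * f s) \<in> RE"
  using scale_mem[of "\<lambda>s. ereal (f s)" c] by (simp add: RE_def)

lemma nrm_scale: "f \<in> RE \<Longrightarrow> nrm (\<lambda>s. c * f s) = \<bar>c\<bar> * nrm f"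
  using norm_scale[of "\<lambda>s. ereal (f s)" c] by (simp add: RE_def nrm_def)

lemma nrm_add: "f \<in> RE \<Longrightarrow> g \<in> RE \<Longrightarrow> nrm (\<lambda>s. f s + g s) \<le> nrm f + nrm g"
  using norm_triangle[of "\<lambda>s. ereal (f s)" "\<lambda>s. ereal (g s)"] by (simp add: RE_def nrm_def)

lemma nrm_nonneg: "f \<in> RE \<Longrightarrow> 0 \<le> nrm f"
  using norm_nonneg by (simp add: RE_def nrm_def)

lemma nrm_eq_0: "f \<in> RE \<Longrightarrow> nrm f = 0 \<longleftrightarrow> (AE s in M. f s = 0)"
  using norm_eq_zero[of "\<lambda>s. ereal (f s)"] by (simp add: RE_def nrm_def)

lemma RE_diff: "f \<in> RE \<Longrightarrow> g \<in> RE \<Longrightarrow> (\<lambda>s. f s - g s) \<in> RE"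
  using RE_add[OF _ RE_scale[of g "-1"], of f] by simp

lemma RE_abs: "f \<in> RE \<Longrightarrow> (\<lambda>s. \<bar>f s\<bar>) \<in> RE"
  by (rule RE_ideal[where g = f]) (auto dest: RE_measurable)

lemma nrm_abs: "f \<in> RE \<Longrightarrow> nrm (\<lambda>s. \<bar>f s\<bar>) = nrm f"
  using nrm_mono[of "\<lambda>s. \<bar>f s\<bar>" f] nrm_mono[of f "\<lambda>s. \<bar>f s\<bar>"] RE_abs[of f] RE_measurable[of f] by fastforce

lemma RE_max: "f \<in> RE \<Longrightarrow> g \<in> RE \<Longrightarrow> (\<lambda>s. max (f s) (g s)) \<in> RE"
  using sup_mem[of "\<lambda>s. ereal (f s)" "\<lambda>s. ereal (g s)"] by (simp add: RE_def)

lemma nrm_diff_commute: "f \<in> RE \<Longrightarrow> g \<in> RE \<Longrightarrow> nrm (\<lambda>s. f s - g s) = nrm (\<lambda>s. g s - f s)"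
  using nrm_scale[OF RE_diff, of f g "-1"] by simp

lemma nrm_triangle_diff:
  assumes "f \<in> RE" "g \<in> RE"
  shows "\<bar>nrm f - nrm g\<bar> \<le> nrm (\<lambda>s. f s - g s)"
  using nrm_add[OF RE_diff[OF assms] assms(2)] nrm_add[OF RE_diff[OF assms(2,1)] assms(1)]
    nrm_diff_commute[OF assms] by auto

lemma nrm_diff_le: "f \<in> RE \<Longrightarrow> g \<in> RE \<Longrightarrow> nrm (\<lambda>s. f s - g s) \<le> nrm f + nrm g"
  using nrm_add[OF _ RE_scale[of g "-1"], of f] nrm_scale[of g "-1"] by simp

lemma E_finite:
  assumes x: "x \<in> E"
  shows "AE s in M. \<bar>x s\<bar> \<noteq> \<infinity>"
proof -
  let ?u = "\<lambda>s. if \<bar>x s\<bar> = \<infinity> then \<infinity> else 0 :: ereal"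
  have xm: "x \<in> L0 I" using x measurable by auto
  then have "?u \<in> L0 I" by measurable
  then have u: "?u \<in> E" using ideal[of ?u x] x by auto
  have "(\<lambda>s. ereal 2 * ?u s) = ?u" by (auto simp: fun_eq_iff)
  then have "N ?u = \<bar>2\<bar> * N ?u" using norm_scale[OF u, of 2] by simp
  then have "AE s in M. ?u s = 0" using norm_eq_zero[OF u] by simp
  then show ?thesis by eventually_elim (auto split: if_splits)
qed

lemma E_real:
  assumes x: "x \<in> E"
  shows AE_real_of_E: "AE s in M. ereal (real_of_ereal (x s)) = x s"
    and real_of_E: "(\<lambda>s. real_of_ereal (x s)) \<in> RE"
    and nrm_real_of_E: "nrm (\<lambda>s. real_of_ereal (x s)) = N x"
proof -
  show ae: "AE s in M. ereal (real_of_ereal (x s)) = x s"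
    using E_finite[OF x] by eventually_elim (auto simp: ereal_real)
  have xm: "x \<in> L0 I" using x measurable by auto
  then have m: "(\<lambda>s. ereal (real_of_ereal (x s))) \<in> L0 I" by measurable
  have "AE s in M. \<bar>ereal (real_of_ereal (x s))\<bar> \<le> \<bar>x s\<bar>" "AE s in M. \<bar>x s\<bar> \<le> \<bar>ereal (real_of_ereal (x s))\<bar>"
    using ae by (eventually_elim, simp)+
  then have "(\<lambda>s. ereal (real_of_ereal (x s))) \<in> E \<and> N (\<lambda>s. ereal (real_of_ereal (x s))) = N x"
    using ideal[OF m x] ideal[OF xm, of "\<lambda>s. ereal (real_of_ereal (x s))"] by force
  then show "(\<lambda>s. real_of_ereal (x s)) \<in> RE" "nrm (\<lambda>s. real_of_ereal (x s)) = N x"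
    by (auto simp: RE_def nrm_def)
qed

lemma nrm_diff_real:
  assumes x: "x \<in> E" and y: "y \<in> E"
  shows "N (\<lambda>s. x s - y s) = nrm (\<lambda>s. real_of_ereal (x s) - real_of_ereal (y s))"
proof -
  have m: "(\<lambda>s. x s - y s) \<in> L0 I"
    using measurable x y by (intro borel_measurable_ereal_diff) auto
  have e: "(\<lambda>s. ereal (real_of_ereal (x s) - real_of_ereal (y s))) \<in> E"
    using RE_diff[OF real_of_E[OF x] real_of_E[OF y]] by (simp add: RE_def)
  have ae: "AE s in M. x s - y s = ereal (real_of_ereal (x s) - real_of_ereal (y s))"
    using AE_real_of_E[OF x] AE_real_of_E[OF y] by eventually_elim (metis ereal_minus(1))
  have "AE s in M. \<bar>x s - y s\<bar> \<le> \<bar>ereal (real_of_ereal (x s) - real_of_ereal (y s))\<bar>"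
    "AE s in M. \<bar>ereal (real_of_ereal (x s) - real_of_ereal (y s))\<bar> \<le> \<bar>x s - y s\<bar>"
    using ae by (eventually_elim, simp)+
  with ideal[OF m e] ideal[of "\<lambda>s. ereal (real_of_ereal (x s) - real_of_ereal (y s))" "\<lambda>s. x s - y s"] e measurable
  have "N (\<lambda>s. x s - y s) = N (\<lambda>s. ereal (real_of_ereal (x s) - real_of_ereal (y s)))"
    by (meson antisym subsetD)
  then show ?thesis by (simp add: nrm_def)
qed

end

section \<open>Real-valued rearrangements and indicator functions in symmetric spaces\<close>

context symmetric_space
begin

lemma RE_sym:
  assumes "f \<in> borel_measurable M" "g \<in> RE" "\<And>r. 0 \<le> r \<Longrightarrow> dst f r = dst g r"
  shows RE_equimeasurable: "f \<in> RE" and nrm_equimeasurable: "nrm f = nrm g"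
proof -
  have "dst f r = dst g r" for r
  proof (cases "0 \<le> r")
    case False
    then have "{s \<in> I. r < \<bar>h s\<bar>} = I" for h by auto
    then show ?thesis by (simp add: dst_def)
  qed (rule assms)
  then have "distr_fun I (\<lambda>s. ereal (f s)) = distr_fun I (\<lambda>s. ereal (g s))"
    by (simp add: dst_eq fun_eq_iff)
  then show "f \<in> RE" "nrm f = nrm g"
    using symmetric[of "\<lambda>s. ereal (f s)" "\<lambda>s. ereal (g s)"] assms by (auto simp: RE_def nrm_def)
qed

definition rr :: "(real \<Rightarrow> ereal) \<Rightarrow> real \<Rightarrow> real"
  where "rr x t = real_of_ereal (rearr I x t)"

lemma rearr_finite:
  assumes x: "x \<in> E" and t: "0 < t"
  shows "rearr I x t \<noteq> \<infinity>"
proof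
  assume inf: "rearr I x t = \<infinity>"
  have "AE s in M. t \<le> s"
    using E_finite[OF rearr_mem[OF x]]
  proof eventually_elim
    case (elim s)
    then show ?case using rearr_antimono[of s t I x] inf by (cases "t \<le> s") auto
  qed
  then show False using M_nonnull[OF t] by simp
qed

lemma ereal_rr: "x \<in> E \<Longrightarrow> 0 < t \<Longrightarrow> ereal (rr x t) = rearr I x t"
  using rearr_finite[of x t] rearr_nonneg[of I x t] by (auto simp: rr_def ereal_real)

lemma rr_nonneg: "0 \<le> rr x t"
  unfolding rr_def using rearr_nonneg[of I x t] by (rule real_of_ereal_pos)

lemma rr_antimono: "x \<in> E \<Longrightarrow> 0 < s \<Longrightarrow> s \<le> t \<Longrightarrow> rr x t \<le> rr x s"
  using rearr_antimono[of s t I x] ereal_rr[of x s] ereal_rr[of x t]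
  by (metis ereal_less_eq(3) less_le_trans)

lemma less_rr_iff: "x \<in> E \<Longrightarrow> 0 < t \<Longrightarrow> 0 \<le> r \<Longrightarrow> r < rr x t \<longleftrightarrow> ennreal t < distr_fun I x r"
  using less_rearr_iff[of x I r t] measurable ereal_rr[of x t] by (metis less_ereal.simps(1) subsetD)

lemma rr_mem: "x \<in> E \<Longrightarrow> rr x \<in> RE" and nrm_rr: "x \<in> E \<Longrightarrow> nrm (rr x) = N x"
  unfolding rr_def[abs_def]
  using real_of_E[OF rearr_mem] nrm_real_of_E[OF rearr_mem] norm_rearr by auto

lemma AE_ereal_rr: "x \<in> E \<Longrightarrow> AE s in M. ereal (rr x s) = rearr I x s"
  using AE_M_pos by (eventually_elim) (simp add: ereal_rr)

lemma dst_rr: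
  assumes x: "x \<in> E" shows "dst (rr x) r = distr_fun I x r"
proof -
  have xm: "x \<in> L0 I" using x measurable by auto
  have "dst (rr x) r = emeasure M {s \<in> I. ereal r < \<bar>rearr I x s\<bar>}"
    unfolding dst_def
  proof (rule emeasure_eq_AE)
    show "AE s in M. s \<in> {s \<in> I. r < \<bar>rr x s\<bar>} \<longleftrightarrow> s \<in> {s \<in> I. ereal r < \<bar>rearr I x s\<bar>}"
      using AE_ereal_rr[OF x]
    proof eventually_elim
      case (elim s)
      have "r < \<bar>rr x s\<bar> \<longleftrightarrow> ereal r < \<bar>ereal (rr x s)\<bar>" by simp
      then show ?case unfolding elim by blast
    qed
    have "{s \<in> space M. r < \<bar>rr x s\<bar>} \<in> sets M" using RE_measurable[OF rr_mem[OF x]] by measurable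
    then show "{s \<in> I. r < \<bar>rr x s\<bar>} \<in> sets M" by simp
    have "{s \<in> space M. ereal r < \<bar>rearr I x s\<bar>} \<in> sets M" using measurable_rearr[OF xm] by measurable
    then show "{s \<in> I. ereal r < \<bar>rearr I x s\<bar>} \<in> sets M" by simp
  qed
  also have "\<dots> = distr_fun I x r"
    using distr_fun_rearr[OF xm] by (simp add: distr_fun_def fun_eq_iff)
  finally show ?thesis .
qed

lemma rr_eq_0_outside:
  assumes x: "x \<in> E" and t: "0 < t" "t \<notin> I"
  shows "rr x t = 0"
proof -
  have I: "I = {0..<1}" "1 \<le> t" using interval t by auto
  have "emeasure M I = 1" using I emeasure_M_Ico[of 0 1] by simp
  then have "distr_fun I x 0 \<le> ennreal 1"
    unfolding distr_fun_def using emeasure_mono[of "{s \<in> I. ereal 0 < \<bar>x s\<bar>}" I M] by auto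
  also have "\<dots> \<le> ennreal t" using I by (intro ennreal_leI) auto
  finally have "\<not> 0 < rr x t" using less_rr_iff[OF x t(1), of 0] by (simp add: zero_ereal_def[symmetric] not_less)
  then show ?thesis using rr_nonneg[of x t] by simp
qed

lemma nrm_rr_diff:
  assumes "x \<in> E" "y \<in> E"
  shows "N (\<lambda>s. rearr I x s - rearr I y s) = nrm (\<lambda>s. rr x s - rr y s)"
  using nrm_diff_real[OF rearr_mem rearr_mem, OF assms] by (simp add: rr_def)

text \<open>A decreasing function is its own rearrangement except perhaps at jumps, where
  \<open>rr\<close> takes the right limit and g may not.\<close>

lemma rr_decreasing:
  assumes g: "g \<in> RE" and anti: "\<And>s t. 0 < s \<Longrightarrow> s \<le> t \<Longrightarrow> g t \<le> g s" and nonneg: "\<And>t. 0 \<le> g t"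
    and out: "\<And>t. 0 < t \<Longrightarrow> t \<notin> I \<Longrightarrow> g t = 0"
  obtains C where "countable C" "\<And>t. 0 < t \<Longrightarrow> t \<notin> C \<Longrightarrow> rr (\<lambda>s. ereal (g s)) t = g t"
proof -
  let ?x = "\<lambda>s. ereal (g s)"
  have x: "?x \<in> E" using g by (simp add: RE_def)
  have gm: "g \<in> borel_measurable M" using g by (rule RE_measurable)
  define C where "C = {t \<in> {0<..}. \<not> isCont (\<lambda>s. - g s) t}"
  have "countable C"
    unfolding C_def by (rule mono_on_ctble_discont_open) (auto simp: mono_on_def anti)
  moreover have "rr ?x t = g t" if t: "0 < t" "t \<notin> C" for t
  proof (rule antisym)
    have "\<not> g t < rr ?x t"
    proof -
      have "distr_fun I ?x (g t) \<le> emeasure lebesgue {0..<t}"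
        unfolding distr_fun_def
      proof (subst emeasure_M, blast, rule emeasure_mono, safe)
        fix s assume s: "s \<in> I" "ereal (g t) < \<bar>ereal (g s)\<bar>"
        then have "g t < g s" using nonneg[of s] by simp
        then have "s < t" using anti[of t s] t by force
        then show "s \<in> {0..<t}" using I_nonneg[OF s(1)] by simp
      qed auto
      then show ?thesis
        using less_rr_iff[OF x t(1) nonneg] t by (simp add: not_less)
    qed
    then show "rr ?x t \<le> g t" by simp
  next
    have cont: "isCont g t"
      using t isCont_minus[of t "\<lambda>s. - g s"] by (auto simp: C_def)
    show "g t \<le> rr ?x t"
    proof (rule ccontr)
      assume "\<not> g t \<le> rr ?x t"
      then have lt: "rr ?x t < g t" by simp
      then have "\<forall>\<^sub>F y in at t. rr ?x t < g y"
        using order_tendstoD(1)[OF cont[unfolded isCont_def]] by simp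
      then obtain d where d: "d > 0" "\<And>y. y \<noteq> t \<Longrightarrow> \<bar>y - t\<bar> < d \<Longrightarrow> rr ?x t < g y"
        unfolding eventually_at dist_real_def by auto
      define t' where "t' = t + d / 2"
      have t': "t < t'" "rr ?x t < g t'" using d(1) d(2)[of t'] by (auto simp: t'_def)
      \<comment> \<open>\<open>g t'\<close> is positive, so \<open>out\<close> excludes that t' lies
        beyond the interval, where it would not count for the distribution function.\<close>
      then have "t' \<in> I" using out[of t'] t rr_nonneg[of ?x t] by force
      then have sub: "{0<..<t'} \<subseteq> I" using I_downward by auto
      have "{0<..<t'} \<subseteq> {s \<in> I. ereal (rr ?x t) < \<bar>ereal (g s)\<bar>}"
      proof
        fix s assume s: "s \<in> {0<..<t'}"
        then have "rr ?x t < g s" using anti[of s t'] t' by auto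
        then show "s \<in> {s \<in> I. ereal (rr ?x t) < \<bar>ereal (g s)\<bar>}" using sub s by auto
      qed
      moreover have "{s \<in> space M. ereal (rr ?x t) < \<bar>ereal (g s)\<bar>} \<in> sets M"
        using gm by measurable
      ultimately have "emeasure M {0<..<t'} \<le> distr_fun I ?x (rr ?x t)"
        unfolding distr_fun_def by (intro emeasure_mono) auto
      then have "ennreal t' \<le> distr_fun I ?x (rr ?x t)" using emeasure_M[OF sub] t t' by simp
      then have "ennreal t < distr_fun I ?x (rr ?x t)"
        by (rule less_le_trans[rotated]) (use t t' in \<open>auto intro: ennreal_lessI\<close>)
      then have "rr ?x t < rr ?x t" using less_rr_iff[OF x t(1) rr_nonneg[of ?x t]] by simp
      then show False by simp
    qed
  qed
  ultimately show thesis by (rule that)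
qed

text \<open>The rearrangement of a strictly positive w cannot vanish on all of t > 0, and being
  decreasing it dominates a multiple of the indicator of [0,t0) as soon as it is positive at
  t0.\<close>

lemma ex_indicator: "\<exists>t0>0. t0 \<in> I \<and> indicator {0..<t0} \<in> RE"
proof -
  obtain w where w: "w \<in> E" "AE s in M. 0 < w s" using strictly_positive by auto
  have "\<exists>t0>0. 0 < rr w t0"
  proof (rule ccontr)
    assume "\<not> (\<exists>t0>0. 0 < rr w t0)"
    then have "rr w t = 0" if "0 < t" for t using that rr_nonneg[of w t] by (auto simp: less_le)
    then have "AE s in M. rr w s = 0" using AE_M_pos by (auto elim: eventually_mono)
    then have "N w = 0" using nrm_eq_0[OF rr_mem] nrm_rr w by auto
    then have "AE s in M. w s = 0" using norm_eq_zero w by auto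
    with w(2) have "AE s in M. 1 \<le> s" by eventually_elim simp
    then show False using M_nonnull[of 1] by simp
  qed
  then obtain t0 where t0: "0 < t0" "0 < rr w t0" by auto
  then have tI: "t0 \<in> I" using rr_eq_0_outside[OF w(1)] by force
  have "indicator {0..<t0} \<in> RE"
  proof (rule RE_ideal)
    show "(\<lambda>s. (1 / rr w t0) * rr w s) \<in> RE" by (rule RE_scale[OF rr_mem[OF w(1)]])
    show "indicator {0..<t0} \<in> borel_measurable M"
      by (rule borel_measurable_indicator[OF M_initial(2)[OF tI]])
    show "AE s in M. \<bar>indicator {0..<t0} s\<bar> \<le> \<bar>1 / rr w t0 * rr w s\<bar>"
      using AE_M_pos
    proof eventually_elim
      case (elim s)
      then show ?case using rr_antimono[OF w(1), of s t0] t0 by (auto simp: indicator_def)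
    qed
  qed
  then show ?thesis using t0 tI by auto
qed

lemma dst_indicator:
  assumes "A \<in> sets M"
  shows "dst (indicator A) r = (if r < 0 then emeasure M I else if r < 1 then emeasure M A else 0)"
proof -
  have "A \<subseteq> I" using sets.sets_into_space[OF assms] by simp
  then have "{s \<in> I. r < \<bar>indicator A s :: real\<bar>} = (if r < 0 then I else if r < 1 then A else {})"
    by (auto simp: indicator_def)
  then show ?thesis by (simp add: dst_def)
qed

text \<open>Symmetry carries the indicator of [0,t0) to all sets of measure at most t0, and finitely
  many such pieces cover [0,b).\<close>

lemma indicator_bounded_RE: "indicator {0..<b} \<in> RE"
proof -
  obtain t0 where t0: "0 < t0" "t0 \<in> I" "indicator {0..<t0} \<in> RE" using ex_indicator by auto
  have small: "indicator A \<in> RE" if A: "A \<in> sets M" "emeasure M A \<le> ennreal t0" for A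
  proof -
    obtain m where m: "0 \<le> m" "emeasure M A = ennreal m" "m \<le> t0"
      using A t0 by (cases "emeasure M A") (auto simp: top_unique)
    have mI: "m \<in> I" using I_downward[OF t0(2) m(1,3)] .
    have "indicator {0..<m} \<in> RE"
      by (rule RE_ideal[OF borel_measurable_indicator[OF M_initial(2)[OF mI]] t0(3)])
        (use m in \<open>auto simp: indicator_def\<close>)
    then show ?thesis
      by (rule RE_equimeasurable[OF borel_measurable_indicator[OF A(1)]])
        (simp add: dst_indicator A(1) M_initial[OF mI] m)
  qed
  have "indicator ({0..<real n * t0} \<inter> I) \<in> RE" for n
  proof (induction n)
    case 0
    then show ?case using RE_zero by (simp add: indicator_def)
  next
    case (Suc n)
    let ?A = "{real n * t0..<real (Suc n) * t0} \<inter> I"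
    have "emeasure M ?A \<le> emeasure lebesgue {real n * t0..<real (Suc n) * t0}"
      by (subst emeasure_M, blast, rule emeasure_mono) auto
    also have "\<dots> = ennreal t0" using t0 by (simp add: algebra_simps)
    finally have "indicator ?A \<in> RE" by (intro small sets_M) auto
    from RE_add[OF Suc this] show ?case
    proof (rule back_subst[of "\<lambda>f. f \<in> RE"])
      have "real n * t0 \<le> real (Suc n) * t0" "0 \<le> real n * t0" using t0 by (auto simp: mult_right_mono)
      then show "(\<lambda>s. indicator ({0..<real n * t0} \<inter> I) s + indicator ?A s) =
        (indicator ({0..<real (Suc n) * t0} \<inter> I) :: real \<Rightarrow> real)"
        by (auto simp: fun_eq_iff indicator_def)
    qed
  qed
  moreover obtain n where n: "b < real n * t0" using ex_less_of_nat_mult[OF t0(1)] by auto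
  ultimately have bnd: "indicator ({0..<real n * t0} \<inter> I) \<in> RE" by simp
  have meas: "(indicator {0..<b} :: real \<Rightarrow> real) \<in> borel_measurable M"
    by (intro measurable_restrict_space1 borel_measurable_indicator) auto
  have "AE s in M. \<bar>indicator {0..<b} s :: real\<bar> \<le> \<bar>indicator ({0..<real n * t0} \<inter> I) s\<bar>"
    using AE_M_pos by eventually_elim (use n in \<open>auto simp: indicator_def\<close>)
  with meas bnd show ?thesis by (rule RE_ideal)
qed

end

section \<open>Order continuous norms\<close>

lemma AE_tendsto_imp_in_measure:
  fixes F :: "nat \<Rightarrow> 'a \<Rightarrow> real"
  assumes A: "A \<in> sets M" "emeasure M A < \<infinity>"
    and [measurable]: "\<And>n. F n \<in> borel_measurable M" "f \<in> borel_measurable M"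
    and lim: "AE s in M. s \<in> A \<longrightarrow> (\<lambda>n. F n s) \<longlonglongrightarrow> f s" and \<epsilon>: "0 < \<epsilon>"
  shows "(\<lambda>n. emeasure M {s \<in> A. \<epsilon> < \<bar>F n s - f s\<bar>}) \<longlonglongrightarrow> 0"
proof -
  let ?B = "\<lambda>n. {s \<in> A. \<epsilon> < \<bar>F n s - f s\<bar>}"
  have eq: "?B n = A \<inter> {s \<in> space M. \<epsilon> < \<bar>F n s - f s\<bar>}" for n
    using sets.sets_into_space[OF A(1)] by auto
  have B [measurable]: "?B n \<in> sets M" for n
    unfolding eq by (rule sets.Int[OF A(1)]) measurable
  have "(\<lambda>n. \<integral>\<^sup>+s. indicator (?B n) s \<partial>M) \<longlonglongrightarrow> (\<integral>\<^sup>+s. 0 \<partial>M)"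
  proof (rule nn_integral_dominated_convergence[where w = "indicator A"])
    show "(\<integral>\<^sup>+s. indicator A s \<partial>M) < \<infinity>" using A by simp
    show "AE s in M. (\<lambda>n. indicator (?B n) s :: ennreal) \<longlonglongrightarrow> 0"
      using lim
    proof eventually_elim
      case (elim s)
      have "\<forall>\<^sub>F n in sequentially. indicator (?B n) s = (0::ennreal)"
      proof (cases "s \<in> A")
        case True
        then have "\<forall>\<^sub>F n in sequentially. dist (F n s) (f s) < \<epsilon>"
          using elim \<epsilon> by (auto dest: tendstoD)
        then show ?thesis by eventually_elim (auto simp: dist_real_def)
      qed (simp add: eventually_sequentially)
      then show ?case by (rule tendsto_eventually)
    qed
    show "\<And>n. AE s in M. indicator (?B n) s \<le> (indicator A s :: ennreal)"
      by (auto simp: indicator_def)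
  qed (use A(1) in measurable)
  then show ?thesis using B by simp
qed

locale order_continuous_symmetric_space = symmetric_space +
  assumes order_continuous: "order_continuous_norm I E N"
begin

lemma nrm_dominated_convergence:
  assumes f: "f \<in> RE" and G: "\<And>n. G n \<in> borel_measurable M"
    and le: "\<And>n. AE s in M. \<bar>G n s\<bar> \<le> \<bar>f s\<bar>" and lim: "AE s in M. (\<lambda>n. G n s) \<longlonglongrightarrow> 0"
  shows "(\<lambda>n. nrm (G n)) \<longlonglongrightarrow> 0"
proof -
  have GR: "G n \<in> RE" for n using RE_ideal[OF G f le] .
  let ?X = "\<lambda>n s. ereal \<bar>G n s\<bar>"
  have "(\<lambda>n. N (?X n)) \<longlonglongrightarrow> 0"
  proof (rule order_continuous[unfolded order_continuous_norm_def, rule_format, of "\<lambda>s. ereal (f s)"])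
    show "(\<lambda>s. ereal (f s)) \<in> E" using f by (simp add: RE_def)
    have "?X n \<in> pos_cone I E" for n
      using RE_abs[OF GR[of n]] by (simp add: pos_cone_def RE_def)
    moreover have "AE s in M. ?X n s \<le> \<bar>ereal (f s)\<bar>" for n using le[of n] by simp
    moreover have "AE s in M. (\<lambda>n. ?X n s) \<longlonglongrightarrow> 0"
      using lim
    proof eventually_elim
      case (elim s)
      then have "(\<lambda>n. \<bar>G n s\<bar>) \<longlonglongrightarrow> 0" by (simp add: tendsto_rabs_zero_iff)
      then show ?case using tendsto_ereal[of "\<lambda>n. \<bar>G n s\<bar>" 0] by (simp add: zero_ereal_def)
    qed
    ultimately show "(\<forall>n. ?X n \<in> pos_cone I E) \<and> (\<forall>n. AE s in M. ?X n s \<le> \<bar>ereal (f s)\<bar>) \<and>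
      (AE s in M. (\<lambda>n. ?X n s) \<longlonglongrightarrow> 0)" by auto
  qed
  then show ?thesis using nrm_abs[OF GR] by (simp add: nrm_def)
qed

text \<open>If a level set had infinite measure, the constant r would belong to E. Its restrictions
  to [n,\<infinity>) are equimeasurable with it, so their norms are all equal, whereas they decrease
  to 0 and order continuity forces these norms to 0.\<close>

lemma distr_fun_finite:
  assumes x: "x \<in> E" and r: "0 < r"
  shows "distr_fun I x r < \<infinity>"
proof (rule ccontr)
  assume "\<not> distr_fun I x r < \<infinity>"
  then have inf: "distr_fun I x r = \<infinity>" by (simp add: top.not_eq_extremum[symmetric])
  moreover have "distr_fun I x r \<le> emeasure M I"
    unfolding distr_fun_def by (rule emeasure_mono) auto
  ultimately have I: "I = {0..}" by (cases rule: I_cases) (auto simp: top_unique)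
  have le: "AE s in M. \<bar>r\<bar> \<le> \<bar>rr x s\<bar>"
    using AE_M_pos
  proof eventually_elim
    case (elim s)
    then have "r < rr x s" using less_rr_iff[OF x, of s r] inf r by simp
    then show ?case using r by simp
  qed
  have c: "(\<lambda>s. r) \<in> RE" by (rule RE_ideal[OF _ rr_mem[OF x] le]) auto
  define G where "G = (\<lambda>n s. r * indicator {real n..} s)"
  have G: "G n \<in> borel_measurable M" for n
    unfolding G_def by (intro borel_measurable_times measurable_restrict_space1 borel_measurable_indicator) auto
  have "nrm (G n) = nrm (\<lambda>s. r)" for n
  proof (rule nrm_equimeasurable[OF G c])
    fix \<rho> :: real assume \<rho>: "0 \<le> \<rho>"
    have "{s \<in> I. \<rho> < \<bar>G n s\<bar>} = (if \<rho> < r then {real n..} else {})"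
      "{s \<in> I. \<rho> < \<bar>r\<bar>} = (if \<rho> < r then {0..} else {})"
      using I r \<rho> by (auto simp: G_def indicator_def)
    moreover have "emeasure M {real n..} = \<infinity>" for n
    proof (rule ccontr)
      assume "emeasure M {real n..} \<noteq> \<infinity>"
      moreover have "emeasure M {0..<real n} = ennreal (real n)" using I by (intro M_initial(1)) auto
      moreover have "emeasure M I \<le> emeasure M {0..<real n} + emeasure M {real n..}"
      proof (rule order.trans[OF emeasure_mono emeasure_subadditive])
        show "I \<subseteq> {0..<real n} \<union> {real n..}" using I by auto
        show sets: "{0..<real n} \<in> sets M" "{real n..} \<in> sets M"
          by (auto intro!: sets_M simp del: sets_lebesgue_on_refl) (use I in auto)
        then show "{0..<real n} \<union> {real n..} \<in> sets M" by (rule sets.Un)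
      qed
      ultimately show False using I by (cases rule: I_cases) (auto simp: top_unique)
    qed
    moreover from this[of 0] have "emeasure M {0..} = \<infinity>" by simp
    ultimately show "dst (G n) \<rho> = dst (\<lambda>s. r) \<rho>" by (simp add: dst_def)
  qed
  moreover have "(\<lambda>n. nrm (G n)) \<longlonglongrightarrow> 0"
  proof (rule nrm_dominated_convergence[OF c G])
    show "AE s in M. (\<lambda>n. G n s) \<longlonglongrightarrow> 0"
    proof (rule AE_I2, rule tendsto_eventually)
      fix s
      obtain k :: nat where "s < real k" using reals_Archimedean2 by auto
      then show "\<forall>\<^sub>F n in sequentially. G n s = 0"
        by (intro eventually_sequentiallyI[of k]) (auto simp: G_def indicator_def)
    qed
  qed (auto simp: G_def indicator_def)
  ultimately have "nrm (\<lambda>s. r) = 0" by (simp add: LIMSEQ_const_iff)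
  then have "AE s in M. r = 0" using nrm_eq_0[OF c] by simp
  then have "AE s in M. 1 \<le> s" by eventually_elim (use r in simp)
  then show False using M_nonnull[of 1] by simp
qed

lemma rr_tendsto_0:
  assumes x: "x \<in> E"
  shows "(rr x \<longlongrightarrow> 0) at_top"
proof (rule order_tendstoI)
  fix e :: real assume "e < 0"
  then show "\<forall>\<^sub>F t in at_top. e < rr x t"
    using rr_nonneg by (intro always_eventually allI) (rule less_le_trans)
next
  fix e :: real assume e: "0 < e"
  then obtain m where m: "distr_fun I x (e/2) = ennreal m"
    using distr_fun_finite[OF x, of "e/2"] by (cases "distr_fun I x (e/2)") auto
  show "\<forall>\<^sub>F t in at_top. rr x t < e"
    using eventually_gt_at_top[of "max 0 m"]
  proof eventually_elim
    case (elim t)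
    then have "\<not> e / 2 < rr x t" using less_rr_iff[OF x, of t "e/2"] e m by (auto simp: not_less intro: ennreal_leI)
    then show ?case using e by simp
  qed
qed

section \<open>Maximal functions and decreasing elements of E\<close>

lemma nn_integral_rearr:
  assumes x: "x \<in> E"
  shows "(\<integral>\<^sup>+ s\<in>{0..t}. e2ennreal (rearr I x s) \<partial>lebesgue) = (\<integral>\<^sup>+ s. ennreal (indicator {0..t} s * rr x s) \<partial>lebesgue)"
proof (rule nn_integral_cong_AE)
  have "AE s in lebesgue. s \<noteq> (0::real)" by (intro AE_completion AE_lborel_singleton)
  then show "AE s in lebesgue. e2ennreal (rearr I x s) * indicator {0..t} s = ennreal (indicator {0..t} s * rr x s)"
  proof eventually_elim
    case (elim s)
    then show ?case
      using ereal_rr[OF x, of s, symmetric] by (cases "s \<in> {0..t}") auto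
  qed
qed

lemma measurable_cut_rr:
  assumes x: "x \<in> E" shows "(\<lambda>s. indicator {0..t} s * rr x s) \<in> borel_measurable lebesgue"
proof -
  have "(\<lambda>s. if 0 < s then rr x s else 0) \<in> borel_measurable lborel"
    using borel_measurable_antimono_pos[of "rr x"] rr_antimono[OF x] by simp
  then have "(\<lambda>s. if 0 < s then rr x s else 0) \<in> borel_measurable lebesgue" by (rule measurable_completion)
  then have "(\<lambda>s. indicator {0..t} s * (if 0 < s then rr x s else 0)) \<in> borel_measurable lebesgue"
    by (intro borel_measurable_times borel_measurable_indicator) auto
  then have "(\<lambda>s. indicator {0..t} s * (if 0 < s then rr x s else 0) + indicator {0} s * (if 0 \<le> t then rr x 0 else 0)) \<in> borel_measurable lebesgue"
    by (rule borel_measurable_add) (auto intro!: borel_measurable_times borel_measurable_indicator)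
  moreover have "(\<lambda>s. indicator {0..t} s * (if 0 < s then rr x s else 0) + indicator {0} s * (if 0 \<le> t then rr x 0 else 0)) = (\<lambda>s. indicator {0..t} s * rr x s)"
    by (auto simp: fun_eq_iff indicator_def)
  ultimately show ?thesis by simp
qed

lemma maximal_fun_eq:
  assumes x: "x \<in> E" and d: "decr (rr x)" and t: "0 < t"
  shows "maximal_fun I x t = ereal (cumul (rr x) t / t)"
proof -
  have "((\<lambda>s. indicator {0..t} s * rr x s) has_integral cumul (rr x) t) UNIV"
  proof -
    have "(rr x has_integral cumul (rr x) t) {0..t}"
      unfolding cumul_def by (rule integrable_integral[OF decr_integrable[OF d]]) simp
    then have "((\<lambda>s. if s \<in> {0..t} then rr x s else 0) has_integral cumul (rr x) t) UNIV"
      by (simp only: has_integral_restrict_UNIV)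
    moreover have "(\<lambda>s. if s \<in> {0..t} then rr x s else 0) = (\<lambda>s. indicator {0..t} s * rr x s)"
      by (auto simp: fun_eq_iff indicator_def)
    ultimately show ?thesis by simp
  qed
  then have "(\<integral>\<^sup>+ s. ennreal (indicator {0..t} s * rr x s) \<partial>lebesgue) = ennreal (cumul (rr x) t)"
    by (subst (asm) has_integral_iff_nn_integral_lebesgue) (auto simp: rr_nonneg)
  then show ?thesis
    unfolding maximal_fun_def nn_integral_rearr[OF x]
    using t cumul_nonneg[OF d, of t] by (simp add: divide_ennreal)
qed

text \<open>One finite value of the maximal function is enough, because the integral of a decreasing
  function can diverge only at 0.\<close>

lemma decr_rr:
  assumes x: "x \<in> E" and t: "0 < t" and fin: "maximal_fun I x t \<noteq> \<infinity>"
  shows "decr (rr x)"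
proof -
  let ?J = "\<integral>\<^sup>+ s. ennreal (indicator {0..t} s * rr x s) \<partial>lebesgue"
  have "?J \<noteq> \<infinity>"
  proof
    assume "?J = \<infinity>"
    then have "maximal_fun I x t = \<infinity>"
      unfolding maximal_fun_def nn_integral_rearr[OF x] using t by (simp add: ennreal_top_divide)
    with fin show False by simp
  qed
  then obtain r where r: "0 \<le> r" "?J = ennreal r" by (cases ?J) auto
  have "((\<lambda>s. indicator {0..t} s * rr x s) has_integral r) UNIV"
    by (subst has_integral_iff_nn_integral_lebesgue) (use r measurable_cut_rr[OF x] in \<open>auto simp: rr_nonneg\<close>)
  moreover have "(\<lambda>s. if s \<in> {0..t} then rr x s else 0) = (\<lambda>s. indicator {0..t} s * rr x s)"
    by (auto simp: fun_eq_iff indicator_def)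
  ultimately have "((\<lambda>s. if s \<in> {0..t} then rr x s else 0) has_integral r) UNIV" by simp
  then have "(rr x has_integral r) {0..t}" by (simp only: has_integral_restrict_UNIV)
  then have it: "rr x integrable_on {0..t}" by auto
  have "rr x integrable_on {0..u}" for u
  proof (cases "u \<le> t")
    case True
    then show ?thesis by (intro integrable_subinterval_real[OF it]) auto
  next
    case False
    have "(\<lambda>s. - rr x s) integrable_on {t..u}"
      by (rule integrable_on_mono_on) (use t rr_antimono[OF x] in \<open>auto simp: mono_on_def\<close>)
    then have "rr x integrable_on {t..u}" using integrable_neg_iff by blast
    then show ?thesis using Henstock_Kurzweil_Integration.integrable_combine[OF _ _ it, of u] False t by simp
  qed
  then show ?thesis using rr_antimono[OF x] rr_nonneg by (auto simp: decr_def)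
qed

text \<open>The class of rearrangements up to a.e. equality. The extension by 0 beyond [0,1) agrees
  with that of \<open>rr\<close>, so primitives can be compared at every t > 0 for both
  intervals.\<close>

definition dec_elem :: "(real \<Rightarrow> real) \<Rightarrow> bool"
  where "dec_elem g \<longleftrightarrow> decr g \<and> g \<in> RE \<and> (\<forall>t>0. t \<notin> I \<longrightarrow> g t = 0)"

lemma dec_elemD:
  assumes "dec_elem g"
  shows dec_elem_decr: "decr g" and dec_elem_RE: "g \<in> RE" and dec_elem_out: "0 < t \<Longrightarrow> t \<notin> I \<Longrightarrow> g t = 0"
  using assms by (auto simp: dec_elem_def)

lemma dec_elem_rr: "x \<in> E \<Longrightarrow> decr (rr x) \<Longrightarrow> dec_elem (rr x)"
  by (simp add: dec_elem_def rr_mem rr_eq_0_outside)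

lemma dec_elem_mem: "dec_elem g \<Longrightarrow> (\<lambda>s. ereal (g s)) \<in> E"
  by (simp add: dec_elem_def RE_def)

lemma rr_dec_elem:
  assumes g: "dec_elem g"
  shows dec_elem_rr_ae: "AE s in M. rr (\<lambda>s. ereal (g s)) s = g s"
    and dec_elem_cumul_rr: "cumul (rr (\<lambda>s. ereal (g s))) = cumul g"
    and dec_elem_tendsto_0: "(g \<longlongrightarrow> 0) at_top"
proof -
  let ?x = "\<lambda>s. ereal (g s)"
  note d = dec_elem_decr[OF g]
  have x: "?x \<in> E" by (rule dec_elem_mem[OF g])
  obtain C where C: "countable C" "\<And>t. 0 < t \<Longrightarrow> t \<notin> C \<Longrightarrow> rr ?x t = g t"
    using rr_decreasing[OF dec_elem_RE[OF g]] decr_antimono[OF d] decr_nonneg[OF d] dec_elem_out[OF g] by metis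
  show "AE s in M. rr ?x s = g s" by (rule AE_M_countable[OF C(1)]) (use C in auto)
  have neg: "negligible (C \<union> {0})" using C(1) by (intro negligible_Un) (auto simp: negligible_iff_null_sets dest!: countable_imp_null_set_lborel intro: null_sets_completionI)
  show "cumul (rr ?x) = cumul g"
    unfolding cumul_def[abs_def] by (rule ext, rule integral_spike[OF neg]) (use C in auto)
  show "(g \<longlongrightarrow> 0) at_top"
  proof (rule tendsto_sandwich[OF always_eventually _ tendsto_const])
    show "\<forall>t. 0 \<le> g t" using decr_nonneg[OF d] by simp
    \<comment> \<open>The two functions agree only off C; the shift by 1 leaves an interval, hence a
      point outside C, between the arguments.\<close>
    have "((\<lambda>t. rr ?x (t - 1)) \<longlongrightarrow> 0) at_top"
      by (rule filterlim_compose[OF rr_tendsto_0[OF x]])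
        (use filterlim_tendsto_add_at_top[OF tendsto_const filterlim_ident, of "-1"] in simp)
    then show "((\<lambda>t. rr ?x (t - 1)) \<longlongrightarrow> 0) at_top" .
    show "\<forall>\<^sub>F t in at_top. g t \<le> rr ?x (t - 1)"
      using eventually_gt_at_top[of 1]
    proof eventually_elim
      case (elim t)
      have "uncountable {t - 1<..<t}" by (simp add: uncountable_open_interval)
      then have "\<not> {t - 1<..<t} \<subseteq> C" using C(1) countable_subset by metis
      then obtain u where u: "u \<in> {t - 1<..<t}" "u \<notin> C" by blast
      have "g t \<le> g u" using u elim by (intro decr_antimono[OF d]) auto
      also have "\<dots> = rr ?x u" using C(2)[of u] u elim by auto
      also have "\<dots> \<le> rr ?x (t - 1)" using u elim by (intro rr_antimono[OF x]) auto
      finally show ?case .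
    qed
  qed
qed

lemma dec_elem_cumul_outside:
  assumes g: "dec_elem g" and t: "0 \<le> t" "t \<notin> I"
  shows "cumul g t = cumul g 1" "1 \<le> t"
proof -
  show 1: "1 \<le> t" using interval t by auto
  have "I = {0..<1}" using interval t by auto
  then have "cumul g t = cumul g 1 + 0 * (t - 1)"
    using 1 by (intro cumul_step[OF dec_elem_decr[OF g]] dec_elem_out[OF g]) auto
  then show "cumul g t = cumul g 1" by simp
qed

text \<open>
  For \<open>I = [0,1)\<close> the functions produced by \<open>cut_by_line\<close> and \<open>hull_with_point\<close> need not vanish
  beyond \<open>1\<close>.
\<close>

definition cut_off :: "(real \<Rightarrow> real) \<Rightarrow> real \<Rightarrow> real"
  where "cut_off h s = (if 0 < s \<and> s \<notin> I then 0 else h s)"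

text \<open>The bound \<open>le\<close> is what keeps the function in E: the excess over g is
  bounded and lives on a bounded interval.\<close>

lemma dec_elem_cut:
  assumes h: "decr h" and g: "dec_elem g" and le: "\<And>s. 0 < s \<Longrightarrow> h s \<le> g s + (if s < b then c else 0)" and c: "0 \<le> c"
  shows "dec_elem (cut_off h)"
proof -
  have anti: "cut_off h t \<le> cut_off h s" if "0 < s" "s \<le> t" for s t
    using decr_antimono[OF h that] decr_nonneg[OF h] I_downward[of t s] that by (auto simp: cut_off_def)
  have pos: "0 \<le> cut_off h s" "cut_off h s \<le> h s" for s using decr_nonneg[OF h] by (auto simp: cut_off_def)
  have d: "decr (cut_off h)"
    unfolding decr_def
  proof (intro conjI allI impI)
    show "cut_off h integrable_on {0..t}" for t
      by (rule integrable_antimono_bounded[OF anti _ decr_integrable[OF h order.refl]]) (use pos in auto)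
  qed (use anti pos in auto)
  have "cut_off h \<in> RE"
  proof (rule RE_ideal)
    show "(\<lambda>s. g s + c * indicator {0..<b} s) \<in> RE"
      by (intro RE_add RE_scale indicator_bounded_RE dec_elem_RE[OF g])
    have "(\<lambda>s. if 0 < s then cut_off h s else 0) \<in> borel_measurable borel"
      by (rule borel_measurable_antimono_pos[OF anti])
    then have "(\<lambda>s. if 0 < s then cut_off h s else 0) \<in> borel_measurable lborel" by simp
    then have m: "(\<lambda>s. if 0 < s then cut_off h s else 0) \<in> borel_measurable M"
      by (intro measurable_restrict_space1 measurable_completion)
    have "(\<lambda>s. (if 0 < s then cut_off h s else 0) + (if s \<in> {0} then cut_off h 0 else 0)) \<in> borel_measurable M"
    proof (intro borel_measurable_add[OF m] measurable_restrict_space1)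
      show "(\<lambda>s. if s \<in> {0} then cut_off h 0 else 0) \<in> borel_measurable lebesgue"
        by (rule measurable_If_set) auto
    qed
    then show "cut_off h \<in> borel_measurable M"
      by (rule measurable_cong[THEN iffD1, rotated]) (use I_nonneg in \<open>force simp: less_le\<close>)
    show "AE s in M. \<bar>cut_off h s\<bar> \<le> \<bar>g s + c * indicator {0..<b} s\<bar>"
      using AE_M_pos
    proof eventually_elim
      case (elim s)
      then show ?case
        using pos[of s] le[of s] c decr_nonneg[OF dec_elem_decr[OF g], of s] by (auto simp: indicator_def)
    qed
  qed
  then show ?thesis using d by (simp add: dec_elem_def cut_off_def)
qed

text \<open>The point 1 is included although it may lie outside the interval, because
  \<open>dec_elem_cumul_outside\<close> reduces every t beyond the interval to it.\<close>

lemma cumul_cut: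
  assumes h: "decr h" "dec_elem (cut_off h)"
  shows cumul_cut_in: "0 \<le> t \<Longrightarrow> t \<in> I \<or> t = 1 \<Longrightarrow> cumul (cut_off h) t = cumul h t"
    and cumul_cut_le: "0 \<le> t \<Longrightarrow> cumul (cut_off h) t \<le> cumul h t"
proof -
  show *: "cumul (cut_off h) t = cumul h t" if t: "0 \<le> t" "t \<in> I \<or> t = 1" for t
  proof -
    have "cut_off h r = h r" if "0 < r" "r < t" for r
      using that t interval by (auto simp: cut_off_def)
    then show ?thesis
      using cumul_diff_cong[OF dec_elem_decr[OF h(2)] h(1) order.refl t(1)] by simp
  qed
  show "cumul (cut_off h) t \<le> cumul h t" if t: "0 \<le> t" for t
  proof (cases "t \<in> I")
    case False
    note o = dec_elem_cumul_outside[OF h(2) t False]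
    show ?thesis using o *[of 1] cumul_mono[OF h(1), of 1 t] by simp
  qed (use * t in auto)
qed

lemma dec_elem_tendsto:
  assumes G: "\<And>n. dec_elem (G n)" and g: "dec_elem g"
    and lim: "\<And>t. t \<in> I \<Longrightarrow> 0 < t \<Longrightarrow> (\<lambda>n. cumul (G n) t) \<longlonglongrightarrow> cumul g t"
  obtains C where "countable C" "\<And>s. s \<in> I \<Longrightarrow> 0 < s \<Longrightarrow> s \<notin> C \<Longrightarrow> (\<lambda>n. G n s) \<longlonglongrightarrow> g s"
proof
  show "countable {t \<in> {0<..}. \<not> isCont (\<lambda>s. - g s) t}"
    by (rule mono_on_ctble_discont_open) (auto simp: mono_on_def decr_antimono[OF dec_elem_decr[OF g]])
  fix s assume s: "s \<in> I" "0 < s" "s \<notin> {t \<in> {0<..}. \<not> isCont (\<lambda>s. - g s) t}"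
  then have "isCont g s" using isCont_minus[of s "\<lambda>s. - g s"] by auto
  moreover obtain t' where "t' \<in> I" "s < t'" using I_right_open[OF s(1)] by auto
  ultimately show "(\<lambda>n. G n s) \<longlonglongrightarrow> g s"
    using cumul_tendsto_imp_tendsto[of G g s t'] lim I_downward[of t'] s
      dec_elem_decr[OF G] dec_elem_decr[OF g] by simp
qed

lemma dec_elem_tendsto_AE:
  assumes G: "\<And>n. dec_elem (G n)" and g: "dec_elem g"
    and lim: "\<And>t. t \<in> I \<Longrightarrow> 0 < t \<Longrightarrow> (\<lambda>n. cumul (G n) t) \<longlonglongrightarrow> cumul g t"
  shows "AE s in M. (\<lambda>n. G n s) \<longlonglongrightarrow> g s"
proof (rule dec_elem_tendsto[OF G g])
  fix C assume "countable C" "\<And>s. s \<in> I \<Longrightarrow> 0 < s \<Longrightarrow> s \<notin> C \<Longrightarrow> (\<lambda>n. G n s) \<longlonglongrightarrow> g s"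
  then show ?thesis by (rule AE_M_countable)
qed (rule lim)

text \<open>The distribution functions of both truncations are determined by that of f, so symmetry
  allows f to be replaced by its rearrangement.\<close>

lemma equimeasurable_truncations:
  assumes f: "f \<in> RE" and c: "0 \<le> c"
  shows RE_min: "(\<lambda>s. min \<bar>f s\<bar> c) \<in> RE" and RE_excess: "(\<lambda>s. max 0 (\<bar>f s\<bar> - c)) \<in> RE"
    and nrm_min_rr: "nrm (\<lambda>s. min \<bar>f s\<bar> c) = nrm (\<lambda>s. min (rr (\<lambda>s. ereal (f s)) s) c)"
    and nrm_excess_rr: "nrm (\<lambda>s. max 0 (\<bar>f s\<bar> - c)) = nrm (\<lambda>s. max 0 (rr (\<lambda>s. ereal (f s)) s - c))"
proof -
  let ?x = "\<lambda>s. ereal (f s)"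
  have x: "?x \<in> E" using f by (simp add: RE_def)
  have R: "(\<lambda>s. min \<bar>k s\<bar> c) \<in> RE" "(\<lambda>s. max 0 (\<bar>k s\<bar> - c)) \<in> RE" if k: "k \<in> RE" for k
  proof -
    note [measurable] = RE_measurable[OF k]
    show "(\<lambda>s. min \<bar>k s\<bar> c) \<in> RE" "(\<lambda>s. max 0 (\<bar>k s\<bar> - c)) \<in> RE"
      by (rule RE_ideal[OF _ k]; use c in auto)+
  qed
  show "(\<lambda>s. min \<bar>f s\<bar> c) \<in> RE" "(\<lambda>s. max 0 (\<bar>f s\<bar> - c)) \<in> RE" using R[OF f] by auto
  have eq: "dst f r = dst (rr ?x) r" for r
    using dst_rr[OF x, of r] dst_eq[of f r] by simp
  have d: "dst (\<lambda>s. min \<bar>k s\<bar> c) r = (if r < c then dst k r else 0)"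
    "dst (\<lambda>s. max 0 (\<bar>k s\<bar> - c)) r = dst k (r + c)" if "0 \<le> r" for k r
  proof -
    have "{s \<in> I. r < \<bar>min \<bar>k s\<bar> c\<bar>} = (if r < c then {s \<in> I. r < \<bar>k s\<bar>} else {})"
      using c that by (auto simp: min_def)
    then show "dst (\<lambda>s. min \<bar>k s\<bar> c) r = (if r < c then dst k r else 0)" by (simp add: dst_def)
    have "{s \<in> I. r < \<bar>max 0 (\<bar>k s\<bar> - c)\<bar>} = {s \<in> I. r + c < \<bar>k s\<bar>}"
      using c that by (auto simp: max_def)
    then show "dst (\<lambda>s. max 0 (\<bar>k s\<bar> - c)) r = dst k (r + c)" by (simp add: dst_def)
  qed
  have "nrm (\<lambda>s. min \<bar>f s\<bar> c) = nrm (\<lambda>s. min \<bar>rr ?x s\<bar> c)"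
    by (rule nrm_equimeasurable[OF RE_measurable[OF R(1)[OF f]] R(1)[OF rr_mem[OF x]]]) (simp add: d eq)
  then show "nrm (\<lambda>s. min \<bar>f s\<bar> c) = nrm (\<lambda>s. min (rr ?x s) c)" by (simp add: rr_nonneg)
  have "nrm (\<lambda>s. max 0 (\<bar>f s\<bar> - c)) = nrm (\<lambda>s. max 0 (\<bar>rr ?x s\<bar> - c))"
    by (rule nrm_equimeasurable[OF RE_measurable[OF R(2)[OF f]] R(2)[OF rr_mem[OF x]]]) (simp add: d eq)
  then show "nrm (\<lambda>s. max 0 (\<bar>f s\<bar> - c)) = nrm (\<lambda>s. max 0 (rr ?x s - c))" by (simp add: rr_nonneg)
qed

text \<open>
  Both truncations of \<open>F n\<close> in the estimate
  \<open>\<bar>F n - f\<bar> \<le> min \<bar>F n\<bar> \<epsilon> + min \<bar>f\<bar> \<epsilon> + (\<bar>F n\<bar> - c)\<^sup>+ + (\<bar>f\<bar> - c)\<^sup>+ + 2 c 1\<^bsub>{\<bar>F n - f\<bar> > \<epsilon>}\<^esub>\<close>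
  have norms that only depend on the rearrangement.
\<close>

lemma nrm_tendsto_of_rearr:
  assumes F: "\<And>n. F n \<in> RE" and f: "f \<in> RE"
    and meas: "\<And>\<epsilon>. 0 < \<epsilon> \<Longrightarrow> (\<lambda>n. emeasure M {s \<in> I. \<epsilon> < \<bar>F n s - f s\<bar>}) \<longlonglongrightarrow> 0"
    and rearr: "(\<lambda>n. nrm (\<lambda>s. rr (\<lambda>s. ereal (F n s)) s - rr (\<lambda>s. ereal (f s)) s)) \<longlonglongrightarrow> 0"
  shows "(\<lambda>n. nrm (\<lambda>s. F n s - f s)) \<longlonglongrightarrow> 0"
proof (rule LIMSEQ_I)
  fix e :: real assume e: "0 < e"
  let ?g = "rr (\<lambda>s. ereal (f s))" and ?G = "\<lambda>n. rr (\<lambda>s. ereal (F n s))"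
  have fE: "(\<lambda>s. ereal (f s)) \<in> E" and FE: "\<And>n. (\<lambda>s. ereal (F n s)) \<in> E"
    using f F by (auto simp: RE_def)
  have gR: "?g \<in> RE" and GR: "?G n \<in> RE" for n using rr_mem fE FE by auto
  note [measurable] = RE_measurable[OF f] RE_measurable[OF F] RE_measurable[OF gR] RE_measurable[OF GR]
  \<comment> \<open>The five terms of the estimate cost less than 2 + 1 + 2 + 1 + 1 times \<delta>,
    which leaves room.\<close>
  define \<delta> where "\<delta> = e / 12"
  have \<delta>: "0 < \<delta>" using e by (simp add: \<delta>_def)
  have "(\<lambda>k. nrm (\<lambda>s. min \<bar>f s\<bar> (1 / Suc k))) \<longlonglongrightarrow> 0"
  proof (rule nrm_dominated_convergence[OF f])
    show "AE s in M. (\<lambda>k. min \<bar>f s\<bar> (1 / Suc k)) \<longlonglongrightarrow> 0"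
    proof (rule AE_I2)
      fix s
      have "(\<lambda>k. min \<bar>f s\<bar> (1 / Suc k)) \<longlonglongrightarrow> min \<bar>f s\<bar> 0"
        by (intro tendsto_intros LIMSEQ_inverse_real_of_nat[unfolded inverse_eq_divide])
      then show "(\<lambda>k. min \<bar>f s\<bar> (1 / Suc k)) \<longlonglongrightarrow> 0" by simp
    qed
  qed auto
  then have "\<forall>\<^sub>F k in sequentially. nrm (\<lambda>s. min \<bar>f s\<bar> (1 / Suc k)) < \<delta>"
    using \<delta> by (rule order_tendstoD)
  then obtain k where k: "nrm (\<lambda>s. min \<bar>f s\<bar> (1 / Suc k)) < \<delta>"
    unfolding eventually_sequentially by blast
  define \<epsilon> where "\<epsilon> = 1 / real (Suc k)"
  have \<epsilon>: "0 < \<epsilon>" "nrm (\<lambda>s. min \<bar>f s\<bar> \<epsilon>) < \<delta>" using k by (auto simp: \<epsilon>_def)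
  have "(\<lambda>k. nrm (\<lambda>s. max 0 (\<bar>f s\<bar> - real k))) \<longlonglongrightarrow> 0"
  proof (rule nrm_dominated_convergence[OF f])
    show "AE s in M. (\<lambda>k. max 0 (\<bar>f s\<bar> - real k)) \<longlonglongrightarrow> 0"
    proof (rule AE_I2, rule tendsto_eventually)
      fix s
      obtain m :: nat where "\<bar>f s\<bar> < real m" using reals_Archimedean2 by auto
      then show "\<forall>\<^sub>F k in sequentially. max 0 (\<bar>f s\<bar> - real k) = 0"
        by (intro eventually_sequentiallyI[of m]) auto
    qed
  qed auto
  then have "\<forall>\<^sub>F c in sequentially. nrm (\<lambda>s. max 0 (\<bar>f s\<bar> - real c)) < \<delta>"
    using \<delta> by (rule order_tendstoD)
  then obtain c where c: "nrm (\<lambda>s. max 0 (\<bar>f s\<bar> - real c)) < \<delta>"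
    unfolding eventually_sequentially by blast
  define D where "D = (\<lambda>n. {s \<in> I. \<epsilon> < \<bar>F n s - f s\<bar>})"
  have Dm: "D n \<in> sets M" for n
  proof -
    have "{s \<in> space M. \<epsilon> < \<bar>F n s - f s\<bar>} \<in> sets M" by measurable
    then show ?thesis by (simp add: D_def)
  qed
  obtain t0 where t0: "0 < t0" "t0 \<in> I" "indicator {0..<t0} \<in> RE" using ex_indicator by auto
  \<comment> \<open>By order continuity indicators of short intervals have small norm; by symmetry
    the same then holds for the exceptional sets \<open>D n\<close>.\<close>
  have "\<exists>m. 0 < m \<and> m \<le> t0 \<and> 2 * real c * nrm (indicator {0..<m}) < \<delta>"
  proof -
    define m where "m = (\<lambda>j::nat. t0 / Suc j)"
    have "(\<lambda>j. nrm (indicator {0..<m j})) \<longlonglongrightarrow> 0"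
    proof (rule nrm_dominated_convergence[OF t0(3)])
      show "indicator {0..<m j} \<in> borel_measurable M" for j
        by (intro measurable_restrict_space1 borel_measurable_indicator) auto
      have "m j \<le> t0" for j using t0 by (simp add: m_def field_simps)
      then show "AE s in M. \<bar>indicator {0..<m j} s :: real\<bar> \<le> \<bar>indicator {0..<t0} s\<bar>" for j
        by (auto simp: indicator_def intro: less_le_trans)
      show "AE s in M. (\<lambda>j. indicator {0..<m j} s :: real) \<longlonglongrightarrow> 0"
        using AE_M_pos
      proof eventually_elim
        case (elim s)
        obtain j0 :: nat where j0: "t0 / s < real j0" using reals_Archimedean2 by auto
        have "\<forall>\<^sub>F j in sequentially. indicator {0..<m j} s = (0::real)"
        proof (rule eventually_sequentiallyI[of j0])
          fix j assume "j0 \<le> j"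
          then have "t0 / s < real (Suc j)" using j0 by simp
          then have "m j < s" using elim t0 by (simp add: m_def field_simps)
          then show "indicator {0..<m j} s = (0::real)" by simp
        qed
        then show ?case by (rule tendsto_eventually)
      qed
    qed
    then have "(\<lambda>j. 2 * real c * nrm (indicator {0..<m j})) \<longlonglongrightarrow> 2 * real c * 0"
      by (intro tendsto_intros)
    then have "\<forall>\<^sub>F j in sequentially. 2 * real c * nrm (indicator {0..<m j}) < \<delta>"
      using \<delta> by (intro order_tendstoD) auto
    then obtain j where "2 * real c * nrm (indicator {0..<m j}) < \<delta>"
      unfolding eventually_sequentially by blast
    moreover have "0 < m j" "m j \<le> t0" using t0 by (auto simp: m_def field_simps)
    ultimately show ?thesis by blast
  qed
  then obtain m where m: "0 < m" "m \<le> t0" "2 * real c * nrm (indicator {0..<m}) < \<delta>" by blast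
  have mI: "m \<in> I" using I_downward[OF t0(2), of m] m by simp
  have "\<forall>\<^sub>F n in sequentially. emeasure M (D n) < ennreal m"
    using order_tendstoD(2)[OF meas[OF \<epsilon>(1)], of "ennreal m"] m by (simp add: D_def)
  moreover have "\<forall>\<^sub>F n in sequentially. nrm (\<lambda>s. ?G n s - ?g s) < \<delta>"
    using order_tendstoD(2)[OF rearr \<delta>] .
  ultimately have "\<forall>\<^sub>F n in sequentially. nrm (\<lambda>s. F n s - f s) < e"
  proof eventually_elim
    case (elim n)
    obtain d where d: "0 \<le> d" "emeasure M (D n) = ennreal d" "d < m"
      using elim(1) m by (cases "emeasure M (D n)") (auto simp: ennreal_less_iff)
    have dI: "d \<in> I" using I_downward[OF mI d(1)] d by simp
    have ind_m: "indicator {0..<m} \<in> RE" by (rule indicator_bounded_RE)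
    have ind_d: "indicator {0..<d} \<in> RE" by (rule indicator_bounded_RE)
    have indD: "indicator (D n) \<in> RE" "nrm (indicator (D n)) = nrm (indicator {0..<d})"
      using RE_equimeasurable[OF borel_measurable_indicator[OF Dm] ind_d]
        nrm_equimeasurable[OF borel_measurable_indicator[OF Dm] ind_d]
      by (simp_all add: dst_indicator Dm M_initial[OF dI] d)
    have "nrm (indicator {0..<d}) \<le> nrm (indicator {0..<m})"
      by (rule nrm_mono[OF RE_measurable[OF ind_d] ind_m]) (use d in \<open>auto simp: indicator_def\<close>)
    then have "2 * real c * nrm (indicator (D n)) \<le> 2 * real c * nrm (indicator {0..<m})"
      unfolding indD(2) by (intro mult_left_mono) auto
    then have iD: "nrm (\<lambda>s. 2 * real c * indicator (D n) s) < \<delta>"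
      using m(3) nrm_scale[OF indD(1), of "2 * real c"] by simp
    \<comment> \<open>Both truncations are 1-Lipschitz, so those of \<open>?G n\<close> exceed those
      of \<open>?g\<close> by at most \<bar>\<open>?G n\<close> - \<open>?g\<close>\<bar>.\<close>
    have cmp: "nrm u \<le> nrm v + nrm (\<lambda>s. ?G n s - ?g s)"
      if "u \<in> borel_measurable M" "v \<in> RE" "\<And>s. 0 \<le> u s" "\<And>s. 0 \<le> v s" "\<And>s. u s \<le> v s + \<bar>?G n s - ?g s\<bar>" for u v
    proof -
      have ab: "(\<lambda>s. \<bar>?G n s - ?g s\<bar>) \<in> RE" by (intro RE_abs RE_diff GR gR)
      have "nrm u \<le> nrm (\<lambda>s. v s + \<bar>?G n s - ?g s\<bar>)"
        by (rule nrm_mono[OF that(1) RE_add[OF that(2) ab]]) (use that(3-5) in \<open>auto intro: order.trans[OF _ abs_ge_self]\<close>)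
      also have "\<dots> \<le> nrm v + nrm (\<lambda>s. ?G n s - ?g s)"
        using nrm_add[OF that(2) ab] nrm_abs[OF RE_diff[OF GR gR]] by simp
      finally show ?thesis .
    qed
    note mn = equimeasurable_truncations[OF F, of \<epsilon> n] equimeasurable_truncations[OF f, of \<epsilon>]
      and ex = equimeasurable_truncations[OF F, of "real c" n] equimeasurable_truncations[OF f, of "real c"]
    have g1: "(\<lambda>s. min (?g s) \<epsilon>) \<in> RE" "(\<lambda>s. max 0 (?g s - real c)) \<in> RE"
      using RE_min[OF gR, of \<epsilon>] RE_excess[OF gR, of "real c"] \<epsilon> by (simp_all add: rr_nonneg)
    have "nrm (\<lambda>s. min (?G n s) \<epsilon>) \<le> nrm (\<lambda>s. min (?g s) \<epsilon>) + nrm (\<lambda>s. ?G n s - ?g s)"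
      by (rule cmp[OF _ g1(1)]) (use \<epsilon> in \<open>auto simp: rr_nonneg\<close>)
    then have 1: "nrm (\<lambda>s. min \<bar>F n s\<bar> \<epsilon>) < 2 * \<delta>"
      using nrm_min_rr[OF F, of \<epsilon> n] nrm_min_rr[OF f, of \<epsilon>] \<epsilon> elim(2) by simp
    have "nrm (\<lambda>s. max 0 (?G n s - real c)) \<le> nrm (\<lambda>s. max 0 (?g s - real c)) + nrm (\<lambda>s. ?G n s - ?g s)"
      by (rule cmp[OF _ g1(2)]) (auto simp: rr_nonneg)
    then have 2: "nrm (\<lambda>s. max 0 (\<bar>F n s\<bar> - real c)) < 2 * \<delta>"
      using nrm_excess_rr[OF F, of "real c" n] nrm_excess_rr[OF f, of "real c"] c elim(2) by simp
    let ?a = "\<lambda>s. min \<bar>F n s\<bar> \<epsilon> + min \<bar>f s\<bar> \<epsilon>"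
    let ?b = "\<lambda>s. max 0 (\<bar>F n s\<bar> - real c) + max 0 (\<bar>f s\<bar> - real c)"
    let ?c = "\<lambda>s. 2 * real c * indicator (D n) s"
    have R: "(\<lambda>s. min \<bar>F n s\<bar> \<epsilon>) \<in> RE" "(\<lambda>s. min \<bar>f s\<bar> \<epsilon>) \<in> RE"
      "(\<lambda>s. max 0 (\<bar>F n s\<bar> - real c)) \<in> RE" "(\<lambda>s. max 0 (\<bar>f s\<bar> - real c)) \<in> RE" "?c \<in> RE"
      using RE_min[OF F] RE_min[OF f] RE_excess[OF F] RE_excess[OF f] RE_scale[OF indD(1)] \<epsilon> by auto
    have a: "?a \<in> RE" "nrm ?a < 3 * \<delta>"
      using RE_add[OF R(1,2)] nrm_add[OF R(1,2)] 1 \<epsilon> by auto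
    have b: "?b \<in> RE" "nrm ?b < 3 * \<delta>"
      using RE_add[OF R(3,4)] nrm_add[OF R(3,4)] 2 c by auto
    have "nrm (\<lambda>s. F n s - f s) \<le> nrm (\<lambda>s. ?a s + (?b s + ?c s))"
    proof (rule nrm_mono[OF _ RE_add[OF a(1) RE_add[OF b(1) R(5)]]])
      have "\<bar>F n s - f s\<bar> \<le> ?a s + (?b s + ?c s)" if "s \<in> I" for s
      proof (cases "s \<in> D n")
        case True
        have "\<bar>F n s\<bar> - real c \<le> max 0 (\<bar>F n s\<bar> - real c)" "\<bar>f s\<bar> - real c \<le> max 0 (\<bar>f s\<bar> - real c)"
          by simp_all
        moreover have "0 \<le> ?a s" using \<epsilon> by simp
        moreover have "\<bar>F n s - f s\<bar> \<le> \<bar>F n s\<bar> + \<bar>f s\<bar>" by (rule abs_triangle_ineq4)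
        moreover have "?c s = 2 * real c" using True by simp
        ultimately show ?thesis by linarith
      next
        case False
        then have "\<bar>F n s - f s\<bar> \<le> \<epsilon>" using that by (auto simp: D_def)
        moreover have "\<bar>F n s - f s\<bar> \<le> \<bar>F n s\<bar> + \<bar>f s\<bar>" by (rule abs_triangle_ineq4)
        ultimately have "\<bar>F n s - f s\<bar> \<le> ?a s"
          using \<epsilon> by (cases "\<bar>F n s\<bar> \<le> \<epsilon>"; cases "\<bar>f s\<bar> \<le> \<epsilon>") simp_all
        moreover have "0 \<le> ?b s" by simp
        moreover have "?c s = 0" using False by simp
        ultimately show ?thesis by linarith
      qed
      then show "AE s in M. \<bar>F n s - f s\<bar> \<le> \<bar>?a s + (?b s + ?c s)\<bar>"
        by (intro AE_I2 order.trans[OF _ abs_ge_self]) simp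
    qed (intro borel_measurable_diff RE_measurable F f)
    also have "\<dots> \<le> nrm ?a + (nrm ?b + nrm ?c)"
      using nrm_add[OF a(1) RE_add[OF b(1) R(5)]] nrm_add[OF b(1) R(5)] by simp
    also have "\<dots> < 12 * \<delta>" using a(2) b(2) iD \<delta> by simp
    finally show ?case by (simp add: \<delta>_def)
  qed
  then show "\<exists>no. \<forall>n\<ge>no. norm (nrm (\<lambda>s. F n s - f s) - 0) < e"
    using nrm_nonneg[OF RE_diff[OF F f]] by (auto simp: eventually_sequentially)
qed

text \<open>Only this lower bound can be expected, as parts of \<open>F n\<close> may sit far out
  where local convergence does not see them. A level set of f for some b > a has a part of finite
  measure greater than t, and there \<bar>\<open>F n\<close>\<bar> exceeds a except on a small
  set.\<close>

lemma eventually_less_rr: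
  assumes F: "\<And>n. F n \<in> RE" and f: "f \<in> RE"
    and loc: "\<And>A \<epsilon>. A \<in> sets M \<Longrightarrow> emeasure M A < \<infinity> \<Longrightarrow> 0 < \<epsilon> \<Longrightarrow>
      (\<lambda>n. emeasure M {s \<in> A. \<epsilon> < \<bar>F n s - f s\<bar>}) \<longlonglongrightarrow> 0"
    and t: "0 < t" and a: "0 \<le> a" "a < rr (\<lambda>s. ereal (f s)) t"
  shows "\<forall>\<^sub>F n in sequentially. a < rr (\<lambda>s. ereal (F n s)) t"
proof -
  have fE: "(\<lambda>s. ereal (f s)) \<in> E" and FE: "\<And>n. (\<lambda>s. ereal (F n s)) \<in> E"
    using f F by (auto simp: RE_def)
  note [measurable] = RE_measurable[OF f] RE_measurable[OF F]
  obtain b where b: "a < b" "b < rr (\<lambda>s. ereal (f s)) t" using dense[OF a(2)] by auto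
  have tb: "ennreal t < dst f b" using less_rr_iff[OF fE t, of b] a b by (simp add: dst_eq)
  define A where "A = (\<lambda>k::nat. {s \<in> I. b < \<bar>f s\<bar> \<and> s < real k})"
  have Am: "A k \<in> sets M" for k
  proof -
    have "{s \<in> space M. b < \<bar>f s\<bar>} \<in> sets M" by measurable
    moreover have "I \<inter> {..<real k} \<in> sets M" by (intro sets_M sets.Int) auto
    ultimately have "{s \<in> space M. b < \<bar>f s\<bar>} \<inter> (I \<inter> {..<real k}) \<in> sets M" by (rule sets.Int)
    moreover have "{s \<in> space M. b < \<bar>f s\<bar>} \<inter> (I \<inter> {..<real k}) = A k" by (auto simp: A_def)
    ultimately show ?thesis by simp
  qed
  have "incseq A" by (auto simp: A_def incseq_def intro: less_le_trans)
  then have "(\<lambda>k. emeasure M (A k)) \<longlonglongrightarrow> emeasure M (\<Union>k. A k)"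
    using Am by (intro Lim_emeasure_incseq) auto
  moreover have "(\<Union>k. A k) = {s \<in> I. b < \<bar>f s\<bar>}"
    using reals_Archimedean2 by (auto simp: A_def)
  ultimately have "(\<lambda>k. emeasure M (A k)) \<longlonglongrightarrow> dst f b" by (simp add: dst_def)
  then have "\<forall>\<^sub>F k in sequentially. ennreal t < emeasure M (A k)" using tb by (rule order_tendstoD)
  then obtain k where k: "ennreal t < emeasure M (A k)" unfolding eventually_sequentially by blast
  have "A k \<subseteq> I" "A k \<subseteq> {0..<real k}" by (auto simp: A_def I_nonneg)
  then have "emeasure M (A k) \<le> emeasure lebesgue {0..<real k}"
    by (simp only: emeasure_M) (rule emeasure_mono, auto)
  then have fin: "emeasure M (A k) < \<infinity>" by (rule le_less_trans) simp
  then obtain m where m: "emeasure M (A k) = ennreal m" "t < m"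
    using k t by (cases "emeasure M (A k)") (auto simp: ennreal_less_iff)
  have "\<forall>\<^sub>F n in sequentially. emeasure M {s \<in> A k. b - a < \<bar>F n s - f s\<bar>} < ennreal (m - t)"
    using loc[OF Am fin, of "b - a"] b m by (intro order_tendstoD) auto
  then show ?thesis
  proof eventually_elim
    case (elim n)
    let ?B = "{s \<in> A k. b - a < \<bar>F n s - f s\<bar>}" and ?C = "{s \<in> I. a < \<bar>F n s\<bar>}"
    have Cm: "?C \<in> sets M"
    proof -
      have "{s \<in> space M. a < \<bar>F n s\<bar>} \<in> sets M" by measurable
      then show ?thesis by simp
    qed
    have "?B = A k \<inter> {s \<in> space M. b - a < \<bar>F n s - f s\<bar>}" by (auto simp: A_def)
    moreover have "{s \<in> space M. b - a < \<bar>F n s - f s\<bar>} \<in> sets M" by measurable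
    ultimately have Bm: "?B \<in> sets M" using Am by simp
    have "A k \<subseteq> ?B \<union> ?C"
    proof
      fix s assume "s \<in> A k"
      then show "s \<in> ?B \<union> ?C" by (auto simp: A_def)
    qed
    then have "emeasure M (A k) \<le> emeasure M ?B + emeasure M ?C"
      using emeasure_mono[of "A k" "?B \<union> ?C" M] emeasure_subadditive[OF Bm Cm] Bm Cm
      by (meson order.trans sets.Un)
    then have le: "ennreal m \<le> emeasure M ?B + dst (F n) a" by (simp add: m dst_def)
    have "ennreal t < dst (F n) a"
    proof (rule ccontr)
      assume "\<not> ennreal t < dst (F n) a"
      then have "dst (F n) a \<le> ennreal t" by simp
      then have le': "ennreal m \<le> emeasure M ?B + ennreal t"
        using order.trans[OF le add_left_mono] by blast
      obtain p where p: "0 \<le> p" "emeasure M ?B = ennreal p" "p < m - t"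
        using elim m by (cases "emeasure M ?B") (auto simp: ennreal_less_iff)
      then have "ennreal m \<le> ennreal (p + t)" using le' t by (simp add: ennreal_plus[symmetric] del: ennreal_plus)
      then have "m \<le> p + t" using p(1) t ennreal_le_iff[of "p + t" m] by linarith
      then show False using p(3) by simp
    qed
    then show ?case using less_rr_iff[OF FE t a(1)] by (simp add: dst_eq)
  qed
qed

end

section \<open>Submajorization and strict monotonicity\<close>

text \<open>\<open>decr_rr_E\<close> expresses that E is contained in L^1 + L^\<infinity>. It is
  obtained from the monotonicity conditions, for instance in
  \<open>strictly_K_monotone_imp_loc_integrable\<close>.\<close>

locale loc_integrable_symmetric_space = order_continuous_symmetric_space +
  assumes decr_rr_E: "x \<in> E \<Longrightarrow> decr (rr x)"
begin

lemma dec_elem_rr_E: "x \<in> E \<Longrightarrow> dec_elem (rr x)"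
  by (simp add: dec_elem_rr decr_rr_E)

lemma submajorized_iff:
  assumes "x \<in> E" "y \<in> E"
  shows "submajorized I x y \<longleftrightarrow> (\<forall>t>0. cumul (rr x) t \<le> cumul (rr y) t)"
  unfolding submajorized_def
proof (intro iff_allI imp_cong refl)
  fix t :: real assume "0 < t"
  then show "(maximal_fun I x t \<le> maximal_fun I y t) = (cumul (rr x) t \<le> cumul (rr y) t)"
    using maximal_fun_eq[OF assms(1) decr_rr_E] maximal_fun_eq[OF assms(2) decr_rr_E] assms
    by (simp add: divide_le_cancel)
qed

lemma submajorized_dec_elem:
  assumes "dec_elem g" "dec_elem h"
  shows "submajorized I (\<lambda>s. ereal (g s)) (\<lambda>s. ereal (h s)) \<longleftrightarrow> (\<forall>t>0. cumul g t \<le> cumul h t)"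
  using submajorized_iff[OF dec_elem_mem dec_elem_mem] dec_elem_cumul_rr assms by simp

lemma cumul_eq_of_AE:
  assumes g: "dec_elem g" and h: "dec_elem h" and ae: "AE s in M. g s = h s" and t: "0 \<le> t"
  shows "cumul g t = cumul h t"
proof -
  have "AE s in lebesgue. s \<in> I \<longrightarrow> g s = h s" using ae unfolding AE_M_iff .
  then obtain Z where Z: "Z \<in> null_sets lebesgue" "{s \<in> space lebesgue. \<not> (s \<in> I \<longrightarrow> g s = h s)} \<subseteq> Z"
    by (auto simp: eventually_ae_filter)
  have neg: "negligible (insert 0 Z)" using Z(1) by (simp add: negligible_iff_null_sets)
  have "h s = g s" if "s \<in> {0..t} - insert 0 Z" for s
    using that Z(2) dec_elem_out[OF g, of s] dec_elem_out[OF h, of s] by (cases "s \<in> I") auto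
  then show ?thesis unfolding cumul_def by (rule integral_spike[OF neg])
qed

text \<open>A constant sequence in \<open>dec_elem_tendsto_AE\<close>.\<close>

lemma AE_eq_of_cumul:
  assumes g: "dec_elem g" and h: "dec_elem h" and eq: "\<And>t. 0 < t \<Longrightarrow> cumul g t = cumul h t"
  shows "AE s in M. g s = h s"
  using dec_elem_tendsto_AE[OF g h] eq by (auto simp: LIMSEQ_const_iff)

lemma rearr_eq_iff:
  assumes x: "x \<in> E" and y: "y \<in> E"
  shows "(AE s in M. rearr I x s = rearr I y s) \<longleftrightarrow> (\<forall>t>0. cumul (rr x) t = cumul (rr y) t)"
proof
  assume "AE s in M. rearr I x s = rearr I y s"
  then have "AE s in M. rr x s = rr y s" by eventually_elim (simp add: rr_def)
  then show "\<forall>t>0. cumul (rr x) t = cumul (rr y) t"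
    using cumul_eq_of_AE[OF dec_elem_rr_E[OF x] dec_elem_rr_E[OF y]] by simp
next
  assume "\<forall>t>0. cumul (rr x) t = cumul (rr y) t"
  then have "AE s in M. rr x s = rr y s"
    using AE_eq_of_cumul[OF dec_elem_rr_E[OF x] dec_elem_rr_E[OF y]] by simp
  then show "AE s in M. rearr I x s = rearr I y s"
    using AE_ereal_rr[OF x] AE_ereal_rr[OF y] by eventually_elim simp
qed

end

locale strictly_K_monotone_space = loc_integrable_symmetric_space +
  assumes strictly_K_monotone: "strictly_K_monotone I E N"
begin

lemma nrm_strict_mono_cumul:
  assumes g: "dec_elem g" and h: "dec_elem h" and le: "\<And>t. 0 < t \<Longrightarrow> cumul g t \<le> cumul h t"
    and t0: "0 < t0" "cumul g t0 \<noteq> cumul h t0"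
  shows "nrm g < nrm h"
  unfolding nrm_def
proof (rule strictly_K_monotone[unfolded strictly_K_monotone_def, rule_format])
  show "(\<lambda>s. ereal (g s)) \<in> E" "(\<lambda>s. ereal (h s)) \<in> E" using g h by (auto intro: dec_elem_mem)
  then show "\<not> (AE s in M. rearr I (\<lambda>s. ereal (h s)) s = rearr I (\<lambda>s. ereal (g s)) s) \<and>
    submajorized I (\<lambda>s. ereal (g s)) (\<lambda>s. ereal (h s))"
    using t0 le by (auto simp: rearr_eq_iff submajorized_dec_elem g h dec_elem_cumul_rr)
qed

lemma nrm_mono_cumul:
  assumes g: "dec_elem g" and h: "dec_elem h" and le: "\<And>t. 0 < t \<Longrightarrow> cumul g t \<le> cumul h t"
  shows "nrm g \<le> nrm h"
proof (cases "\<forall>t>0. cumul g t = cumul h t")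
  case True
  then have "AE s in M. g s = h s" using AE_eq_of_cumul[OF g h] by simp
  then show ?thesis using nrm_cong_AE[OF RE_measurable[OF dec_elem_RE[OF g]] dec_elem_RE[OF h]] by simp
next
  case False
  then show ?thesis using nrm_strict_mono_cumul[OF g h le] by (metis less_imp_le)
qed

text \<open>Each \<open>cumul (G n)\<close> that reaches \<open>cumul g t0 + e\<close> at t0 also
  lies above the hull, so the norm of \<open>G n\<close> is at least that of one element of norm
  greater than \<open>nrm g\<close>. This can happen for finitely many n only.\<close>

lemma cumul_tendsto_of_majorizing:
  assumes g: "dec_elem g" and G: "\<And>n. dec_elem (G n)"
    and le: "\<And>n t. 0 < t \<Longrightarrow> cumul g t \<le> cumul (G n) t"
    and lim: "(\<lambda>n. nrm (G n)) \<longlonglongrightarrow> nrm g" and t0: "t0 \<in> I" "0 < t0"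
  shows "(\<lambda>n. cumul (G n) t0) \<longlonglongrightarrow> cumul g t0"
proof (rule LIMSEQ_I)
  fix e :: real assume e: "0 < e"
  note dg = dec_elem_decr[OF g] and dG = dec_elem_decr[OF G]
  obtain h b c where h: "decr h" and hle: "\<And>s. 0 < s \<Longrightarrow> h s \<le> g s + (if s \<le> b then c else 0)" and c: "0 \<le> c"
    and gh: "\<And>t. 0 \<le> t \<Longrightarrow> cumul g t \<le> cumul h t" "cumul g t0 < cumul h t0"
    and hk: "\<And>k t. decr k \<Longrightarrow> (\<And>s. 0 \<le> s \<Longrightarrow> cumul g s \<le> cumul k s) \<Longrightarrow> cumul g t0 + e \<le> cumul k t0 \<Longrightarrow>
      0 \<le> t \<Longrightarrow> cumul h t \<le> cumul k t"
    using hull_with_point[OF dg dec_elem_tendsto_0[OF g] t0(2) e] by metis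
  \<comment> \<open>The shift by 1 passes from s \<le> b to the strict inequality in
    \<open>dec_elem_cut\<close>.\<close>
  have hle': "h s \<le> g s + (if s < b + 1 then c else 0)" if "0 < s" for s
    using hle[OF that] c by (auto split: if_splits)
  have k: "dec_elem (cut_off h)" by (rule dec_elem_cut[OF h g hle' c])
  have gk: "cumul g t \<le> cumul (cut_off h) t" if t: "0 < t" for t
  proof (cases "t \<in> I")
    case True
    then show ?thesis using cumul_cut_in[OF h k, of t] gh(1)[of t] t by simp
  next
    case False
    then show ?thesis
      using dec_elem_cumul_outside[OF g _ False] dec_elem_cumul_outside[OF k _ False]
        cumul_cut_in[OF h k, of 1] gh(1)[of 1] t by simp
  qed
  have "nrm g < nrm (cut_off h)"
    using gh(2) cumul_cut_in[OF h k, of t0] t0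
    by (intro nrm_strict_mono_cumul[OF g k gk t0(2)]) auto
  with lim have "\<forall>\<^sub>F n in sequentially. nrm (G n) < nrm (cut_off h)" by (rule order_tendstoD)
  then have "\<forall>\<^sub>F n in sequentially. cumul (G n) t0 < cumul g t0 + e"
  proof eventually_elim
    case (elim n)
    show ?case
    proof (rule ccontr)
      assume "\<not> cumul (G n) t0 < cumul g t0 + e"
      moreover have "cumul g s \<le> cumul (G n) s" if "0 \<le> s" for s
        using le[of s n] that by (cases "s = 0") auto
      ultimately have hG: "cumul h t \<le> cumul (G n) t" if "0 \<le> t" for t
        using hk[OF dG] that by simp
      have "cumul (cut_off h) t \<le> cumul (G n) t" if "0 < t" for t
        using cumul_cut_le[OF h k, of t] hG[of t] that by simp
      then have "nrm (cut_off h) \<le> nrm (G n)" by (rule nrm_mono_cumul[OF k G])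
      with elim show False by simp
    qed
  qed
  then show "\<exists>no. \<forall>n\<ge>no. norm (cumul (G n) t0 - cumul g t0) < e"
    unfolding eventually_sequentially
  proof (elim exE, intro exI allI impI)
    fix no n assume "\<forall>n\<ge>no. cumul (G n) t0 < cumul g t0 + e" "no \<le> n"
    then have "cumul (G n) t0 < cumul g t0 + e" by blast
    then show "norm (cumul (G n) t0 - cumul g t0) < e" using le[OF t0(2), of n] by simp
  qed
qed

text \<open>
  If \<open>cumul (G n) t0\<close> stays below \<open>cumul g t0 - e\<close>, then \<open>cumul (G n)\<close> lies below one of finitely many
  lines through a point just above \<open>(t0, cumul g t0 - e)\<close>; cutting \<open>cumul g\<close> by each of these lines
  gives finitely many elements of norm strictly less than that of \<open>g\<close>.
\<close>

lemma cumul_tendsto_of_majorized: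
  assumes g: "dec_elem g" and G: "\<And>n. dec_elem (G n)"
    and le: "\<And>n t. 0 < t \<Longrightarrow> cumul (G n) t \<le> cumul g t"
    and lim: "(\<lambda>n. nrm (G n)) \<longlonglongrightarrow> nrm g" and t0: "t0 \<in> I" "0 < t0"
  shows "(\<lambda>n. cumul (G n) t0) \<longlonglongrightarrow> cumul g t0"
proof (rule LIMSEQ_I)
  fix e :: real assume e: "0 < e"
  note dg = dec_elem_decr[OF g] and dG = dec_elem_decr[OF G]
  \<comment> \<open>One half of e is the gap between graph and line at t0, the other half pays for
    rounding the slope.\<close>
  define \<eta> where "\<eta> = e / 2"
  have \<eta>: "0 < \<eta>" using e by (simp add: \<eta>_def)
  define l where "l = (\<lambda>q t. cumul g t0 - \<eta> + q * (t - t0))"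
  have "\<exists>h. 0 < q \<and> q * t0 \<le> cumul g t0 - \<eta> \<longrightarrow>
      dec_elem h \<and> nrm h < nrm g \<and> (\<forall>t\<ge>0. t \<in> I \<or> t = 1 \<longrightarrow> min (cumul g t) (l q t) \<le> cumul h t)" for q
  proof (cases "0 < q \<and> q * t0 \<le> cumul g t0 - \<eta>")
    case True
    then obtain h b where h: "decr h" and hle: "\<And>s. h s \<le> g s + (if s < b then q else 0)"
      and hg: "\<And>t. 0 \<le> t \<Longrightarrow> cumul h t \<le> cumul g t"
      and lh: "\<And>t. 0 \<le> t \<Longrightarrow> min (cumul g t) (cumul g t0 - \<eta> + q * (t - t0)) \<le> cumul h t"
      and lt: "cumul h t0 < cumul g t0"
      using cut_by_line[OF dg dec_elem_tendsto_0[OF g] t0(2) \<eta>, of q] by metis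
    have k: "dec_elem (cut_off h)" using True by (intro dec_elem_cut[OF h g hle]) auto
    have "nrm (cut_off h) < nrm g"
    proof (rule nrm_strict_mono_cumul[OF k g _ t0(2)])
      show "cumul (cut_off h) t \<le> cumul g t" if "0 < t" for t
        using cumul_cut_le[OF h k, of t] hg[of t] that by simp
      show "cumul (cut_off h) t0 \<noteq> cumul g t0" using cumul_cut_in[OF h k, of t0] lt t0 by simp
    qed
    moreover have "min (cumul g t) (l q t) \<le> cumul (cut_off h) t" if "0 \<le> t" "t \<in> I \<or> t = 1" for t
      using cumul_cut_in[OF h k that] lh[OF that(1)] by (simp add: l_def)
    ultimately show ?thesis using k by blast
  qed auto
  then obtain H where H: "\<And>q. 0 < q \<Longrightarrow> q * t0 \<le> cumul g t0 - \<eta> \<Longrightarrow>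
      dec_elem (H q) \<and> nrm (H q) < nrm g \<and> (\<forall>t\<ge>0. t \<in> I \<or> t = 1 \<longrightarrow> min (cumul g t) (l q t) \<le> cumul (H q) t)"
    by metis
  \<comment> \<open>Slopes are rounded up to multiples of \<epsilon>. To the right of t0 this only
    raises the line; to the left it lowers it by at most \<epsilon> t0 = \<eta>.\<close>
  define \<epsilon> where "\<epsilon> = \<eta> / t0"
  have \<epsilon>: "0 < \<epsilon>" "\<epsilon> * t0 = \<eta>" using \<eta> t0 by (auto simp: \<epsilon>_def)
  define q where "q = (\<lambda>j::nat. (real j + 1) * \<epsilon>)"
  have q: "0 < q j" for j using \<epsilon> by (simp add: q_def add_nonneg_pos)
  \<comment> \<open>The slope of \<open>cumul (G n)\<close> at t0 is at most its average there,
    hence at most \<open>cumul g t0 / t0\<close>; so only the indices up to J occur.\<close>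
  define J where "J = nat \<lfloor>cumul g t0 / t0 / \<epsilon>\<rfloor>"
  define S where "S = (\<lambda>j. nrm (H (q j))) ` {j. j \<le> J \<and> q j * t0 \<le> cumul g t0 - \<eta>}"
  have S: "finite S" "\<And>v. v \<in> S \<Longrightarrow> v < nrm g" using H q by (auto simp: S_def)
  \<comment> \<open>The extra number \<open>nrm g - 1\<close> only makes the set nonempty.\<close>
  define V where "V = Max (insert (nrm g - 1) S)"
  have "V < nrm g" using S by (simp add: V_def)
  then have "\<forall>\<^sub>F n in sequentially. V < nrm (G n)" using order_tendstoD(1)[OF lim] by simp
  then have "\<forall>\<^sub>F n in sequentially. cumul g t0 - e < cumul (G n) t0"
  proof eventually_elim
    case (elim n)
    show ?case
    proof (rule ccontr)
      assume "\<not> cumul g t0 - e < cumul (G n) t0"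
      then have bad: "cumul (G n) t0 \<le> cumul g t0 - 2 * \<eta>" by (simp add: \<eta>_def)
      define p where "p = G n t0"
      define j where "j = nat \<lfloor>p / \<epsilon>\<rfloor>"
      have p: "0 \<le> p" using decr_nonneg[OF dG] by (simp add: p_def)
      have j: "real j * \<epsilon> \<le> p" "p < q j"
      proof -
        have "0 \<le> p / \<epsilon>" using p \<epsilon> by simp
        then have rj: "real j = of_int \<lfloor>p / \<epsilon>\<rfloor>" by (simp add: j_def)
        have "real j \<le> p / \<epsilon>" "p / \<epsilon> < real j + 1" unfolding rj by linarith+
        then show "real j * \<epsilon> \<le> p" "p < q j" using \<epsilon> by (simp_all add: q_def field_simps)
      qed
      have "p \<le> cumul (G n) t0 / t0" unfolding p_def by (rule decr_le_cumul_average[OF dG t0(2)])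
      also have "\<dots> \<le> cumul g t0 / t0" using le[OF t0(2), of n] t0 by (intro divide_right_mono) auto
      finally have "p / \<epsilon> \<le> cumul g t0 / t0 / \<epsilon>" using \<epsilon> by (intro divide_right_mono) auto
      then have jJ: "j \<le> J" unfolding j_def J_def by (intro nat_mono floor_mono)
      have line: "cumul (G n) t \<le> l (q j) t" if t: "0 \<le> t" for t
      proof -
        have sup: "cumul (G n) t \<le> cumul g t0 - 2 * \<eta> + p * (t - t0)"
          using cumul_support[OF dG t0(2) t, of n] bad by (simp add: p_def)
        show ?thesis
        proof (cases "t0 \<le> t")
          case True
          then have "p * (t - t0) \<le> q j * (t - t0)" using j by (intro mult_right_mono) auto
          then show ?thesis using sup \<eta> by (simp add: l_def)
        next
          case False
          then have "real j * \<epsilon> * (t0 - t) \<le> p * (t0 - t)" using j by (intro mult_right_mono) auto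
          moreover have "q j * (t0 - t) = real j * \<epsilon> * (t0 - t) + \<epsilon> * (t0 - t)" by (simp add: q_def algebra_simps)
          moreover have "\<epsilon> * (t0 - t) \<le> \<eta>" using \<epsilon> t by (simp add: algebra_simps)
          ultimately have "p * (t - t0) - \<eta> \<le> q j * (t - t0)" by (simp add: algebra_simps)
          then show ?thesis using sup by (simp add: l_def)
        qed
      qed
      \<comment> \<open>\<open>cumul (G n)\<close> vanishes at 0 and lies below the line, so the
        line is nonnegative there, as \<open>cut_by_line\<close> requires.\<close>
      have valid: "q j * t0 \<le> cumul g t0 - \<eta>" using line[of 0] by (simp add: l_def)
      note Hj = H[OF q valid]
      have "cumul (G n) t \<le> cumul (H (q j)) t" if t: "0 < t" for t
      proof -
        have in_I: "cumul (G n) s \<le> cumul (H (q j)) s" if "s \<in> I \<or> s = 1" "0 < s" for s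
        proof -
          have "min (cumul g s) (l (q j) s) \<le> cumul (H (q j)) s"
            by (rule Hj[THEN conjunct2, THEN conjunct2, rule_format, OF less_imp_le[OF that(2)] that(1)])
          then show ?thesis using line[of s] le[OF that(2), of n] that by simp
        qed
        show ?thesis
        proof (cases "t \<in> I")
          case False
          have "cumul (G n) 1 \<le> cumul (H (q j)) 1" using in_I[of 1] by simp
          then show ?thesis
            using dec_elem_cumul_outside[OF G _ False] dec_elem_cumul_outside[OF _ _ False, of "H (q j)"] Hj t by simp
        qed (use in_I t in auto)
      qed
      then have "nrm (G n) \<le> nrm (H (q j))" using Hj by (intro nrm_mono_cumul[OF G]) auto
      also have "\<dots> \<le> V" unfolding V_def using S(1) jJ valid by (intro Max_ge) (auto simp: S_def)
      finally show False using elim by simp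
    qed
  qed
  then show "\<exists>no. \<forall>n\<ge>no. norm (cumul (G n) t0 - cumul g t0) < e"
    unfolding eventually_sequentially
  proof (elim exE, intro exI allI impI)
    fix no n assume "\<forall>n\<ge>no. cumul g t0 - e < cumul (G n) t0" "no \<le> n"
    then have "cumul g t0 - e < cumul (G n) t0" by blast
    then show "norm (cumul (G n) t0 - cumul g t0) < e" using le[OF t0(2), of n] by simp
  qed
qed

end

section \<open>Convergence in measure\<close>

context order_continuous_symmetric_space
begin

definition loc_meas :: "(nat \<Rightarrow> real \<Rightarrow> real) \<Rightarrow> (real \<Rightarrow> real) \<Rightarrow> bool"
  where "loc_meas F f \<longleftrightarrow> (\<forall>A\<in>sets M. emeasure M A < \<infinity> \<longrightarrow>
    (\<forall>\<epsilon>>0. (\<lambda>n. emeasure M {s \<in> A. \<epsilon> < \<bar>F n s - f s\<bar>}) \<longlonglongrightarrow> 0))"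

definition glob_meas :: "(nat \<Rightarrow> real \<Rightarrow> real) \<Rightarrow> (real \<Rightarrow> real) \<Rightarrow> bool"
  where "glob_meas F f \<longleftrightarrow> (\<forall>\<epsilon>>0. (\<lambda>n. emeasure M {s \<in> I. \<epsilon> < \<bar>F n s - f s\<bar>}) \<longlonglongrightarrow> 0)"

lemma deviation_sets:
  fixes f g :: "real \<Rightarrow> real"
  assumes "f \<in> borel_measurable M" "g \<in> borel_measurable M" "A \<in> sets M"
  shows "{s \<in> A. \<epsilon> < \<bar>f s - g s\<bar>} \<in> sets M"
proof -
  note [measurable] = assms(1,2)
  have "{s \<in> space M. \<epsilon> < \<bar>f s - g s\<bar>} \<in> sets M" by measurable
  then have "A \<inter> {s \<in> space M. \<epsilon> < \<bar>f s - g s\<bar>} \<in> sets M" by (rule sets.Int[OF assms(3)])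
  moreover have "A \<inter> {s \<in> space M. \<epsilon> < \<bar>f s - g s\<bar>} = {s \<in> A. \<epsilon> < \<bar>f s - g s\<bar>}"
    using sets.sets_into_space[OF assms(3)] by auto
  ultimately show ?thesis by simp
qed

lemma glob_meas_imp_loc_meas:
  assumes "glob_meas F f" "\<And>n. F n \<in> borel_measurable M" "f \<in> borel_measurable M"
  shows "loc_meas F f"
  unfolding loc_meas_def
proof (intro ballI impI allI)
  fix A and \<epsilon> :: real assume A: "A \<in> sets M" and \<epsilon>: "0 < \<epsilon>"
  have "A \<subseteq> I" using sets.sets_into_space[OF A] by simp
  then have "emeasure M {s \<in> A. \<epsilon> < \<bar>F n s - f s\<bar>} \<le> emeasure M {s \<in> I. \<epsilon> < \<bar>F n s - f s\<bar>}" for n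
    by (intro emeasure_mono deviation_sets assms) auto
  note le = this
  have "(\<lambda>n. emeasure M {s \<in> I. \<epsilon> < \<bar>F n s - f s\<bar>}) \<longlonglongrightarrow> 0"
    using assms(1) \<epsilon> by (simp add: glob_meas_def)
  then show "(\<lambda>n. emeasure M {s \<in> A. \<epsilon> < \<bar>F n s - f s\<bar>}) \<longlonglongrightarrow> 0"
    by (rule tendsto_sandwich[OF always_eventually always_eventually tendsto_const, rotated 2])
      (use le in auto)
qed

lemma emeasure_deviation_real:
  assumes x: "x \<in> E" and y: "y \<in> E" and A: "A \<in> sets M"
  shows "emeasure M {s \<in> A. \<bar>x s - y s\<bar> > ereal \<epsilon>} =
    emeasure M {s \<in> A. \<epsilon> < \<bar>real_of_ereal (x s) - real_of_ereal (y s)\<bar>}"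
proof (rule emeasure_eq_AE)
  show "AE s in M. s \<in> {s \<in> A. \<bar>x s - y s\<bar> > ereal \<epsilon>} \<longleftrightarrow>
    s \<in> {s \<in> A. \<epsilon> < \<bar>real_of_ereal (x s) - real_of_ereal (y s)\<bar>}"
    using AE_real_of_E[OF x] AE_real_of_E[OF y]
  proof eventually_elim
    case (elim s)
    have "x s - y s = ereal (real_of_ereal (x s) - real_of_ereal (y s))"
      using elim by (metis ereal_minus(1))
    then show ?case by simp
  qed
  have [measurable]: "x \<in> L0 I" "y \<in> L0 I" using x y measurable by auto
  have "{s \<in> space M. \<bar>x s - y s\<bar> > ereal \<epsilon>} \<in> sets M" by measurable
  then have "A \<inter> {s \<in> space M. \<bar>x s - y s\<bar> > ereal \<epsilon>} \<in> sets M" by (rule sets.Int[OF A])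
  moreover have "A \<inter> {s \<in> space M. \<bar>x s - y s\<bar> > ereal \<epsilon>} = {s \<in> A. \<bar>x s - y s\<bar> > ereal \<epsilon>}"
    using sets.sets_into_space[OF A] by auto
  ultimately show "{s \<in> A. \<bar>x s - y s\<bar> > ereal \<epsilon>} \<in> sets M" by simp
  show "{s \<in> A. \<epsilon> < \<bar>real_of_ereal (x s) - real_of_ereal (y s)\<bar>} \<in> sets M"
    by (intro deviation_sets RE_measurable real_of_E x y A)
qed

lemma converges_locally_iff:
  assumes "x \<in> E" "\<And>n. X n \<in> E"
  shows "converges_locally_in_measure I X x \<longleftrightarrow>
    loc_meas (\<lambda>n s. real_of_ereal (X n s)) (\<lambda>s. real_of_ereal (x s))"
  unfolding converges_locally_in_measure_def loc_meas_def
  by (simp add: emeasure_deviation_real assms cong: ball_cong)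

lemma converges_globally_iff:
  assumes "x \<in> E" "\<And>n. X n \<in> E"
  shows "converges_globally_in_measure I X x \<longleftrightarrow>
    glob_meas (\<lambda>n s. real_of_ereal (X n s)) (\<lambda>s. real_of_ereal (x s))"
  unfolding converges_globally_in_measure_def glob_meas_def
  by (simp add: emeasure_deviation_real assms sets.top[of M, simplified])

lemma kadec_klee_local_iff:
  "kadec_klee_local I E N \<longleftrightarrow> (\<forall>f\<in>RE. \<forall>F. (\<forall>n. F n \<in> RE) \<and> loc_meas F f \<and>
    (\<lambda>n. nrm (F n)) \<longlonglongrightarrow> nrm f \<longrightarrow> (\<lambda>n. nrm (\<lambda>s. F n s - f s)) \<longlonglongrightarrow> 0)" (is "?L \<longleftrightarrow> ?R")
proof
  assume L: ?L
  show ?R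
  proof (intro ballI allI impI, elim conjE)
    fix f F assume a: "f \<in> RE" "\<forall>n. F n \<in> RE" "loc_meas F f" "(\<lambda>n. nrm (F n)) \<longlonglongrightarrow> nrm f"
    then have "(\<lambda>n. N (\<lambda>s. ereal (F n s) - ereal (f s))) \<longlonglongrightarrow> 0"
      by (intro L[unfolded kadec_klee_local_def, rule_format] conjI)
        (auto simp: RE_def converges_locally_iff nrm_def)
    then show "(\<lambda>n. nrm (\<lambda>s. F n s - f s)) \<longlonglongrightarrow> 0" by (simp add: nrm_def)
  qed
next
  assume R: ?R
  show ?L
    unfolding kadec_klee_local_def
  proof (intro ballI allI impI, elim conjE)
    fix x X assume a: "x \<in> E" "\<forall>n. X n \<in> E" "converges_locally_in_measure I X x" "(\<lambda>n. N (X n)) \<longlonglongrightarrow> N x"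
    then show "(\<lambda>n. N (\<lambda>s. X n s - x s)) \<longlonglongrightarrow> 0"
      by (subst nrm_diff_real) (auto intro!: R[rule_format] simp: real_of_E nrm_real_of_E converges_locally_iff)
  qed
qed

lemma kadec_klee_global_iff:
  "kadec_klee_global I E N \<longleftrightarrow> (\<forall>f\<in>RE. \<forall>F. (\<forall>n. F n \<in> RE) \<and> glob_meas F f \<and>
    (\<lambda>n. nrm (F n)) \<longlonglongrightarrow> nrm f \<longrightarrow> (\<lambda>n. nrm (\<lambda>s. F n s - f s)) \<longlonglongrightarrow> 0)" (is "?L \<longleftrightarrow> ?R")
proof
  assume L: ?L
  show ?R
  proof (intro ballI allI impI, elim conjE)
    fix f F assume a: "f \<in> RE" "\<forall>n. F n \<in> RE" "glob_meas F f" "(\<lambda>n. nrm (F n)) \<longlonglongrightarrow> nrm f"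
    then have "(\<lambda>n. N (\<lambda>s. ereal (F n s) - ereal (f s))) \<longlonglongrightarrow> 0"
      by (intro L[unfolded kadec_klee_global_def, rule_format] conjI)
        (auto simp: RE_def converges_globally_iff nrm_def)
    then show "(\<lambda>n. nrm (\<lambda>s. F n s - f s)) \<longlonglongrightarrow> 0" by (simp add: nrm_def)
  qed
next
  assume R: ?R
  show ?L
    unfolding kadec_klee_global_def
  proof (intro ballI allI impI, elim conjE)
    fix x X assume a: "x \<in> E" "\<forall>n. X n \<in> E" "converges_globally_in_measure I X x" "(\<lambda>n. N (X n)) \<longlonglongrightarrow> N x"
    then show "(\<lambda>n. N (\<lambda>s. X n s - x s)) \<longlonglongrightarrow> 0"
      by (subst nrm_diff_real) (auto intro!: R[rule_format] simp: real_of_E nrm_real_of_E converges_globally_iff)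
  qed
qed

lemma kadec_klee_local_imp_global: "kadec_klee_local I E N \<Longrightarrow> kadec_klee_global I E N"
  unfolding kadec_klee_local_iff kadec_klee_global_iff
  using glob_meas_imp_loc_meas RE_measurable by blast

section \<open>Strict K-monotonicity and local integrability from the other conditions\<close>

text \<open>
  If \<open>rr x\<close> is not locally integrable, then \<open>x\<close> majorizes every function, in particular \<open>2 x\<close> and all
  multiples of an indicator function. Each of the monotonicity conditions excludes this, so that
  local integrability need not be derived from the completeness of \<open>E\<close>.
\<close>

lemma maximal_fun_infinite: "x \<in> E \<Longrightarrow> \<not> decr (rr x) \<Longrightarrow> 0 < t \<Longrightarrow> maximal_fun I x t = \<infinity>"
  using decr_rr by blast

lemma decr_rr_bounded:
  assumes x: "x \<in> E" and ae: "AE s in M. rr x s \<le> c"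
  shows "decr (rr x)"
proof -
  have le: "rr x s \<le> c" if s: "0 < s" for s
  proof (rule ccontr)
    assume c: "\<not> rr x s \<le> c"
    have "AE r in M. s \<le> r"
      using ae AE_M_pos
    proof eventually_elim
      case (elim r)
      then show ?case using rr_antimono[OF x, of r s] c by linarith
    qed
    then show False using M_nonnull[OF s] by simp
  qed
  have "rr x integrable_on {0..t}" for t
  proof (rule integrable_antimono_bounded)
    show "(\<lambda>_. c) integrable_on {0..t}" by (rule integrable_const_ivl)
  qed (use le rr_antimono[OF x] rr_nonneg in auto)
  then show ?thesis using rr_antimono[OF x] rr_nonneg by (auto simp: decr_def)
qed

lemma strictly_K_monotone_imp_loc_integrable:
  assumes "strictly_K_monotone I E N" and x: "x \<in> E"
  shows "decr (rr x)"
proof (rule ccontr)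
  assume nd: "\<not> decr (rr x)"
  let ?y = "\<lambda>s. ereal 2 * x s"
  have y: "?y \<in> E" "N ?y = 2 * N x" using scale_mem[OF x, of 2] norm_scale[OF x, of 2] by auto
  have "submajorized I ?y x"
    unfolding submajorized_def using maximal_fun_infinite[OF x nd] by simp
  moreover have "\<not> N ?y < N x" using y norm_nonneg[OF x] by simp
  ultimately have "AE s in M. rearr I x s = rearr I ?y s"
    using assms(1) x y(1) unfolding strictly_K_monotone_def by blast
  then have "AE s in M. rr x s = rr ?y s" by eventually_elim (simp add: rr_def)
  then have "nrm (rr x) = nrm (rr ?y)"
    by (rule nrm_cong_AE[OF RE_measurable[OF rr_mem[OF x]] rr_mem[OF y(1)]])
  then have "nrm (rr x) = 0" using nrm_rr[OF x] nrm_rr[OF y(1)] y(2) by simp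
  then have "AE s in M. rr x s = 0" using nrm_eq_0[OF rr_mem[OF x]] by simp
  then have "AE s in M. rr x s \<le> 0" by eventually_elim simp
  with nd decr_rr_bounded[OF x] show False by blast
qed

text \<open>Rigidity treats elements of equal norm. If y were majorized by x with larger norm,
  shrinking y to the norm of x would make its rearrangement equal to that of x; majorization of y
  itself then forces both primitives to vanish.\<close>

lemma strictly_K_monotone_of_rigid:
  assumes rigid: "\<And>x y. x \<in> E \<Longrightarrow> y \<in> E \<Longrightarrow> submajorized I y x \<Longrightarrow> N y = N x \<Longrightarrow>
    nrm (\<lambda>s. rr x s - rr y s) = 0"
  shows "strictly_K_monotone I E N"
proof -
  have rigid_AE: "AE s in M. rr x s = rr y s" if "x \<in> E" "y \<in> E" "submajorized I y x" "N y = N x" for x y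
  proof -
    have "AE s in M. rr x s - rr y s = 0"
      using rigid[OF that] nrm_eq_0[OF RE_diff[OF rr_mem rr_mem]] that by simp
    then show ?thesis by eventually_elim simp
  qed
  have li: "decr (rr x)" if x: "x \<in> E" for x
  proof (rule ccontr)
    assume nd: "\<not> decr (rr x)"
    obtain t0 where t0: "0 < t0" "t0 \<in> I" "indicator {0..<t0} \<in> RE" using ex_indicator by auto
    let ?i = "indicator {0..<t0} :: real \<Rightarrow> real"
    have "nrm ?i \<noteq> 0"
    proof
      assume "nrm ?i = 0"
      then have "AE s in M. ?i s = 0" using nrm_eq_0[OF t0(3)] by simp
      then have "AE s in M. t0 \<le> s" using AE_M_pos by eventually_elim (auto simp: indicator_def split: if_splits)
      then show False using M_nonnull[OF t0(1)] by simp
    qed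
    \<comment> \<open>This multiple of the indicator has the norm of x and is majorized by x.
      Rigidity then makes the rearrangement of x bounded, hence locally integrable.\<close>
    define c where "c = N x / nrm ?i"
    have i: "0 < nrm ?i" using \<open>nrm ?i \<noteq> 0\<close> nrm_nonneg[OF t0(3)] by simp
    then have c: "0 \<le> c" using norm_nonneg[OF x] by (simp add: c_def)
    let ?y = "\<lambda>s. ereal (c * ?i s)"
    have yR: "(\<lambda>s. c * ?i s) \<in> RE" by (rule RE_scale[OF t0(3)])
    then have y: "?y \<in> E" by (simp add: RE_def)
    have "nrm (\<lambda>s. c * ?i s) = N x" using nrm_scale[OF t0(3), of c] norm_nonneg[OF x] i by (simp add: c_def)
    then have "N ?y = N x" by (simp add: nrm_def)
    moreover have "submajorized I ?y x"
      unfolding submajorized_def using maximal_fun_infinite[OF x nd] by simp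
    ultimately have ae: "AE s in M. rr x s = rr ?y s" using rigid_AE[OF x y] by simp
    have "{s \<in> I. ereal c < \<bar>?y s\<bar>} = {}" using c by (auto simp: indicator_def)
    then have "distr_fun I ?y c = 0" by (simp only: distr_fun_def emeasure_empty)
    then have le: "rr ?y s \<le> c" if "0 < s" for s using less_rr_iff[OF y that c] by (simp add: not_less[symmetric])
    have "AE s in M. rr x s \<le> c" using ae AE_M_pos by eventually_elim (simp add: le)
    with nd decr_rr_bounded[OF x] show False by blast
  qed
  interpret li: loc_integrable_symmetric_space I E N
    by unfold_locales (rule li)
  show ?thesis
    unfolding strictly_K_monotone_def
  proof (intro ballI impI, elim conjE, rule ccontr)
    fix x y assume x: "x \<in> E" and y: "y \<in> E" and sub: "submajorized I y x"
      and ne: "\<not> (AE s in M. rearr I x s = rearr I y s)" and "\<not> N y < N x"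
    then have le: "N x \<le> N y" by simp
    note g = li.dec_elem_rr_E[OF y]
    \<comment> \<open>In the second case \<open>N y\<close> exceeds \<open>N x\<close> and is
      therefore positive; the first one covers \<open>N y = 0\<close>.\<close>
    define c where "c = (if N x = N y then 1 else N x / N y)"
    have c: "0 \<le> c" "c \<le> 1" "c * N y = N x" "c = 1 \<or> c < 1"
      using le norm_nonneg[OF x] by (auto simp: c_def divide_le_eq)
    have "(\<lambda>s. c * rr y s) integrable_on {0..t}" for t
      using integrable_cmul[OF decr_integrable[OF dec_elem_decr[OF g] order.refl], of c t] by simp
    then have "decr (\<lambda>s. c * rr y s)"
      unfolding decr_def
      using decr_antimono[OF dec_elem_decr[OF g]] decr_nonneg[OF dec_elem_decr[OF g]] c
      by (auto intro!: mult_left_mono)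
    then have k: "dec_elem (\<lambda>s. c * rr y s)"
      using dec_elem_out[OF g] RE_scale[OF dec_elem_RE[OF g]] by (auto simp: dec_elem_def)
    let ?z = "\<lambda>s. ereal (c * rr y s)"
    have z: "?z \<in> E" by (rule dec_elem_mem[OF k])
    have cum: "cumul (rr y) t \<le> cumul (rr x) t" if "0 < t" for t
      using sub li.submajorized_iff[OF y x] that by blast
    have "N ?z = N x" using nrm_scale[OF dec_elem_RE[OF g], of c] nrm_rr[OF y] c by (simp add: nrm_def)
    moreover have "submajorized I ?z x"
      unfolding li.submajorized_iff[OF z x] dec_elem_cumul_rr[OF k] cumul_scale
    proof (intro allI impI)
      fix t :: real assume t: "0 < t"
      have "c * cumul (rr y) t \<le> 1 * cumul (rr y) t"
        using c cumul_nonneg[OF dec_elem_decr[OF g], of t] t by (intro mult_right_mono) auto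
      then show "c * cumul (rr y) t \<le> cumul (rr x) t" using cum[OF t] by simp
    qed
    ultimately have "AE s in M. rr x s = rr ?z s" using rigid_AE[OF x z] by simp
    then have eq: "cumul (rr x) t = c * cumul (rr y) t" if "0 < t" for t
      using li.cumul_eq_of_AE[OF li.dec_elem_rr_E[OF x] li.dec_elem_rr_E[OF z], of t] that
        dec_elem_cumul_rr[OF k] by (simp add: cumul_scale)
    have "cumul (rr x) t = cumul (rr y) t" if t: "0 < t" for t
    proof (cases "c = 1")
      case False
      then have c1: "c < 1" using c by simp
      have p: "0 \<le> cumul (rr y) t" using cumul_nonneg[OF dec_elem_decr[OF g], of t] t by simp
      have "cumul (rr y) t \<le> c * cumul (rr y) t" using cum[OF t] eq[OF t] by simp
      then have "(1 - c) * cumul (rr y) t \<le> 0" by (simp add: algebra_simps)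
      then have "cumul (rr y) t = 0" using c1 p by (simp add: mult_le_0_iff)
      then show ?thesis using eq[OF t] by simp
    qed (use eq t in simp)
    then show False using ne li.rearr_eq_iff[OF x y] by simp
  qed
qed

lemma lower_imp_strictly_K_monotone:
  assumes "lower_loc_unif_K_monotone I E N"
  shows "strictly_K_monotone I E N"
proof (rule strictly_K_monotone_of_rigid)
  fix x y assume a: "x \<in> E" "y \<in> E" "submajorized I y x" "N y = N x"
  then have "(\<lambda>n::nat. N (\<lambda>s. rearr I x s - rearr I y s)) \<longlonglongrightarrow> 0"
    using assms[unfolded lower_loc_unif_K_monotone_def, rule_format, of x "\<lambda>n. y"] by simp
  then show "nrm (\<lambda>s. rr x s - rr y s) = 0"
    using nrm_rr_diff[OF a(1,2)] by (simp add: LIMSEQ_const_iff)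
qed

lemma upper_imp_strictly_K_monotone:
  assumes "upper_loc_unif_K_monotone I E N"
  shows "strictly_K_monotone I E N"
proof (rule strictly_K_monotone_of_rigid)
  fix x y assume a: "x \<in> E" "y \<in> E" "submajorized I y x" "N y = N x"
  then have "(\<lambda>n::nat. N (\<lambda>s. rearr I y s - rearr I x s)) \<longlonglongrightarrow> 0"
    using assms[unfolded upper_loc_unif_K_monotone_def, rule_format, of y "\<lambda>n. x"] by simp
  then show "nrm (\<lambda>s. rr x s - rr y s) = 0"
    using nrm_rr_diff[OF a(2,1)] nrm_diff_commute[OF rr_mem rr_mem, OF a(1,2)] by (simp add: LIMSEQ_const_iff)
qed

end

section \<open>From local to global convergence in measure\<close>

context loc_integrable_symmetric_space
begin

abbreviation rl :: "(real \<Rightarrow> real) \<Rightarrow> real \<Rightarrow> real"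
  where "rl f \<equiv> rr (\<lambda>s. ereal (f s))"

lemma rl_simps:
  assumes "f \<in> RE"
  shows dec_elem_rl: "dec_elem (rl f)" and nrm_rl: "nrm (rl f) = nrm f" and dst_rl: "dst (rl f) r = dst f r"
  using assms dec_elem_rr_E nrm_rr dst_rr by (auto simp: RE_def nrm_def dst_eq)

lemma dec_elem_max:
  assumes g: "dec_elem g" and h: "dec_elem h"
  shows "dec_elem (\<lambda>s. max (g s) (h s))"
proof -
  have anti: "max (g t) (h t) \<le> max (g s) (h s)" if "0 < s" "s \<le> t" for s t
    using decr_antimono[OF dec_elem_decr[OF g] that] decr_antimono[OF dec_elem_decr[OF h] that] by auto
  have pos: "0 \<le> g s" "0 \<le> h s" for s
    using decr_nonneg[OF dec_elem_decr[OF g]] decr_nonneg[OF dec_elem_decr[OF h]] by auto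
  have "(\<lambda>s. max (g s) (h s)) integrable_on {0..t}" for t
  proof (rule integrable_antimono_bounded[OF anti])
    show "(\<lambda>s. g s + h s) integrable_on {0..t}"
      by (intro integrable_add decr_integrable[OF dec_elem_decr] g h) auto
  qed (use pos in \<open>auto simp: max_def\<close>)
  then have "decr (\<lambda>s. max (g s) (h s))"
    unfolding decr_def using anti pos by (auto simp: max.coboundedI1)
  then show ?thesis
    using RE_max[OF dec_elem_RE[OF g] dec_elem_RE[OF h]] dec_elem_out[OF g] dec_elem_out[OF h]
    by (auto simp: dec_elem_def)
qed

lemma cumul_mono_fun:
  assumes "decr g" "decr h" "\<And>s. 0 < s \<Longrightarrow> g s \<le> h s"
  shows "cumul g t \<le> cumul h t"
proof -
  have "cumul k t = integral {0..t} (\<lambda>s. if s = 0 then 0 else k s)" for k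
    unfolding cumul_def by (rule integral_spike[of "{0}"]) auto
  moreover have "(\<lambda>s. if s = 0 then 0 else k s) integrable_on {0..t}" if "decr k" for k
    by (rule integrable_spike[OF decr_integrable[OF that order.refl], of "{0}"]) auto
  ultimately show ?thesis using assms by (auto intro!: integral_le)
qed

text \<open>
  The functions \<open>y n = max (rl (F n)) (rl f)\<close> majorize \<open>rl f\<close> exactly, and by order continuity they
  differ from \<open>rl (F n)\<close> by little in norm.
\<close>

lemma max_rearr:
  assumes F: "\<And>n. F n \<in> RE" and f: "f \<in> RE" and loc: "loc_meas F f"
    and lim: "(\<lambda>n. nrm (F n)) \<longlonglongrightarrow> nrm f"
  defines "y \<equiv> \<lambda>n s. max (rl (F n) s) (rl f s)"
  shows max_rearr_diff: "(\<lambda>n. nrm (\<lambda>s. y n s - rl (F n) s)) \<longlonglongrightarrow> 0"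
    and max_rearr_nrm: "(\<lambda>n. nrm (y n)) \<longlonglongrightarrow> nrm f"
    and max_rearr_cumul: "(\<lambda>n. cumul (y n) t - cumul (rl (F n)) t) \<longlonglongrightarrow> 0"
proof -
  note g = dec_elem_rl[OF f] and G = dec_elem_rl[OF F]
  have y: "dec_elem (y n)" for n unfolding y_def by (rule dec_elem_max[OF G g])
  have ptw: "(\<lambda>n. y n s - rl (F n) s) \<longlonglongrightarrow> 0" if s: "0 < s" for s
  proof (rule order_tendstoI)
    fix e :: real assume "e < 0"
    then show "\<forall>\<^sub>F n in sequentially. e < y n s - rl (F n) s"
      by (intro always_eventually allI) (auto simp: y_def max_def)
  next
    fix e :: real assume e: "0 < e"
    show "\<forall>\<^sub>F n in sequentially. y n s - rl (F n) s < e"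
    \<comment> \<open>\<open>eventually_less_rr\<close> needs a nonnegative level; below 0 the
      nonnegativity of \<open>rl (F n)\<close> is enough.\<close>
    proof (cases "0 \<le> rl f s - e / 2")
      case True
      have "\<forall>\<^sub>F n in sequentially. rl f s - e / 2 < rl (F n) s"
        using loc e by (intro eventually_less_rr[OF F f _ s True]) (auto simp: loc_meas_def)
      then show ?thesis by eventually_elim (use e in \<open>auto simp: y_def max_def\<close>)
    next
      case False
      have "y n s - rl (F n) s < e" for n
        using False e rr_nonneg[of "\<lambda>s. ereal (F n s)" s] by (auto simp: y_def max_def)
      then show ?thesis by (intro always_eventually allI)
    qed
  qed
  \<comment> \<open>The difference is the positive part of \<open>rl f - rl (F n)\<close>. So
    \<open>rl f\<close> dominates it for all n, both in norm and under the integral.\<close>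
  have bound: "\<bar>y n s - rl (F n) s\<bar> \<le> rl f s" for n s
    using rr_nonneg[of "\<lambda>s. ereal (f s)" s] rr_nonneg[of "\<lambda>s. ereal (F n s)" s] by (auto simp: y_def max_def)
  show diff: "(\<lambda>n. nrm (\<lambda>s. y n s - rl (F n) s)) \<longlonglongrightarrow> 0"
  proof (rule nrm_dominated_convergence[OF dec_elem_RE[OF g]])
    show "(\<lambda>s. y n s - rl (F n) s) \<in> borel_measurable M" for n
      by (intro RE_measurable RE_diff dec_elem_RE y G)
    show "AE s in M. \<bar>y n s - rl (F n) s\<bar> \<le> \<bar>rl f s\<bar>" for n
      by (intro AE_I2 order.trans[OF bound abs_ge_self])
    show "AE s in M. (\<lambda>n. y n s - rl (F n) s) \<longlonglongrightarrow> 0"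
      using AE_M_pos by eventually_elim (simp add: ptw)
  qed
  have "(\<lambda>n. nrm (y n) - nrm (F n)) \<longlonglongrightarrow> 0"
  proof (rule tendsto_rabs_zero_cancel, rule tendsto_sandwich[OF always_eventually always_eventually tendsto_const diff])
    show "\<forall>n. \<bar>nrm (y n) - nrm (F n)\<bar> \<le> nrm (\<lambda>s. y n s - rl (F n) s)"
      using nrm_triangle_diff[OF dec_elem_RE[OF y] dec_elem_RE[OF G]] by (simp add: nrm_rl F)
  qed auto
  from tendsto_add[OF this lim] show "(\<lambda>n. nrm (y n)) \<longlonglongrightarrow> nrm f" by simp
  have int: "(\<lambda>s. y n s - rl (F n) s) integrable_on {0..t}" for n
    by (intro integrable_diff decr_integrable[OF dec_elem_decr] y G order.refl)
  have "(\<lambda>n. integral {0..t} (\<lambda>s. if s = 0 then 0 else y n s - rl (F n) s)) \<longlonglongrightarrow> integral {0..t} (\<lambda>s. 0)"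
  proof (rule dominated_convergence(2))
    show "(\<lambda>s. if s = 0 then 0 else y n s - rl (F n) s) integrable_on {0..t}" for n
      by (rule integrable_spike[OF int, of "{0}"]) auto
    show "rl f integrable_on {0..t}" by (rule decr_integrable[OF dec_elem_decr[OF g] order.refl])
    show "norm (if s = 0 then 0 else y n s - rl (F n) s) \<le> rl f s" for n s
      using bound[of n s] rr_nonneg by auto
    show "(\<lambda>n. if s = 0 then 0 else y n s - rl (F n) s) \<longlonglongrightarrow> 0" if "s \<in> {0..t}" for s
      using ptw[of s] that by (cases "s = 0") auto
  qed
  moreover have "integral {0..t} (\<lambda>s. if s = 0 then 0 else y n s - rl (F n) s) = cumul (y n) t - cumul (rl (F n)) t" for n
  proof -
    have "integral {0..t} (\<lambda>s. if s = 0 then 0 else y n s - rl (F n) s) = integral {0..t} (\<lambda>s. y n s - rl (F n) s)"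
      by (rule integral_spike[of "{0}"]) auto
    also have "\<dots> = cumul (y n) t - cumul (rl (F n)) t"
      unfolding cumul_def by (intro integral_diff decr_integrable[OF dec_elem_decr] y G order.refl)
    finally show ?thesis .
  qed
  ultimately show "(\<lambda>n. cumul (y n) t - cumul (rl (F n)) t) \<longlonglongrightarrow> 0" by simp
qed

text \<open>
  Mass of \<open>F n\<close> outside a large set \<open>A\<close> is excluded by comparing distribution functions at a
  continuity point of the distribution function of \<open>f\<close>.
\<close>

lemma loc_meas_imp_glob_meas:
  assumes F: "\<And>n. F n \<in> RE" and f: "f \<in> RE" and loc: "loc_meas F f"
    and lim: "\<And>t. t \<in> I \<Longrightarrow> 0 < t \<Longrightarrow> (\<lambda>n. cumul (rl (F n)) t) \<longlonglongrightarrow> cumul (rl f) t"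
  shows "glob_meas F f"
  unfolding glob_meas_def
proof (intro allI impI)
  fix \<epsilon> :: real assume \<epsilon>: "0 < \<epsilon>"
  have fin: "dst h r < \<infinity>" if "h \<in> RE" "0 < r" for h r
    using distr_fun_finite[of "\<lambda>s. ereal (h s)" r] that by (simp add: RE_def dst_eq)
  define lev where "lev = (\<lambda>(h::real \<Rightarrow> real) r. {s \<in> I. r < \<bar>h s\<bar>})"
  have lev: "lev h r \<in> fmeasurable M" if h: "h \<in> RE" and r: "0 < r" for h r
  proof (rule fmeasurableI)
    note [measurable] = RE_measurable[OF h]
    have "{s \<in> space M. r < \<bar>h s\<bar>} \<in> sets M" by measurable
    then show "lev h r \<in> sets M" by (simp add: lev_def)
    show "emeasure M (lev h r) < \<infinity>" using fin[OF h r] by (simp add: lev_def dst_def)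
  qed
  have dst_lev: "dst h r = ennreal (measure M (lev h r))" if "h \<in> RE" "0 < r" for h r
    using emeasure_eq_measure2[OF lev[OF that]] by (simp add: dst_def lev_def)
  define D where "D = (\<lambda>r. measure M (lev f r))"
  have Danti: "D b \<le> D a" if "0 < a" "a \<le> b" for a b
    unfolding D_def by (rule measure_mono_fmeasurable) (use lev[OF f] that in \<open>auto simp: lev_def\<close>)
  have "countable {r \<in> {0<..}. \<not> isCont (\<lambda>r. - D r) r}"
    by (rule mono_on_ctble_discont_open) (auto simp: mono_on_def Danti)
  moreover have "uncountable {0<..<\<epsilon> / 2}" using \<epsilon> by (simp add: uncountable_open_interval)
  ultimately have "\<not> {0<..<\<epsilon> / 2} \<subseteq> {r \<in> {0<..}. \<not> isCont (\<lambda>r. - D r) r}"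
    using countable_subset by metis
  \<comment> \<open>Since 2 c < \<epsilon>, a deviation above \<epsilon> forces
    \<bar>\<open>F n s\<close>\<bar> or \<bar>\<open>f s\<close>\<bar> above c.\<close>
  then obtain c where c: "0 < c" "c < \<epsilon> / 2" "isCont (\<lambda>r. - D r) c" by auto
  then have cont: "isCont D c" using isCont_minus[of c "\<lambda>r. - D r"] by simp
  have dev: "{s \<in> I. \<epsilon> < \<bar>F n s - f s\<bar>} = lev (\<lambda>s. F n s - f s) \<epsilon>" for n by (simp add: lev_def)
  have "(\<lambda>n. measure M (lev (\<lambda>s. F n s - f s) \<epsilon>)) \<longlonglongrightarrow> 0"
  proof (rule LIMSEQ_I)
    fix e :: real assume e: "0 < e"
    \<comment> \<open>The deviation set is covered by parts of measure below \<tau>, 4 \<tau> and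
      \<tau>.\<close>
    define \<tau> where "\<tau> = e / 8"
    have \<tau>: "0 < \<tau>" using e by (simp add: \<tau>_def)
    have "\<forall>\<^sub>F r in at c. dist (D r) (D c) < \<tau>" using tendstoD[OF cont[unfolded isCont_def] \<tau>] .
    then obtain d where d: "0 < d" "\<And>r. r \<noteq> c \<Longrightarrow> \<bar>r - c\<bar> < d \<Longrightarrow> \<bar>D r - D c\<bar> < \<tau>"
      unfolding eventually_at dist_real_def by auto
    \<comment> \<open>The levels a < c < b leave room on both sides: a for bounding the level set of
      \<open>F n\<close> at c from above, b for bounding its part in a fixed set from below. By
      continuity D changes little between them.\<close>
    define a where "a = max (c / 2) (c - d / 2)"
    define b where "b = c + d / 2"
    have l1: "0 < a" "a < c" "D a < D c + \<tau>"
    proof -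
      show "0 < a" "a < c" using c d by (auto simp: a_def)
      moreover have "\<bar>a - c\<bar> < d" using c d(1) by (auto simp: a_def max_def)
      ultimately show "D a < D c + \<tau>" using d(2)[of a] by auto
    qed
    have l2: "c < b" "D c - \<tau> < D b" using d(1) d(2)[of b] by (auto simp: b_def)
    define A where "A = (\<lambda>k::nat. lev f b \<inter> {..<real k})"
    have lev2: "lev f b \<in> fmeasurable M" using lev[OF f] c l2 by simp
    have Ik: "I \<inter> {..<real k} \<in> sets M" for k by (rule sets_M) auto
    have Aeq: "A k = lev f b \<inter> (I \<inter> {..<real k})" for k by (auto simp: A_def lev_def)
    have A: "A k \<in> fmeasurable M" for k
      unfolding Aeq by (rule fmeasurable_Int_fmeasurable[OF lev2 Ik])
    have "(\<lambda>k. measure M (A k)) \<longlonglongrightarrow> measure M (\<Union>k. A k)"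
    proof (rule Lim_measure_incseq)
      show "range A \<subseteq> sets M" using A by (auto dest: fmeasurableD)
      show "incseq A" by (auto simp: A_def incseq_def)
      have "(\<Union>k. A k) \<subseteq> lev f b" by (auto simp: A_def)
      then show "emeasure M (\<Union>k. A k) \<noteq> \<infinity>"
        using emeasure_mono[of "\<Union>k. A k" "lev f b" M] fmeasurableD[OF lev2] fmeasurableD2[OF lev2]
        by (auto simp: top_unique)
    qed
    moreover have "(\<Union>k. A k) = lev f b" using reals_Archimedean2 by (auto simp: A_def)
    ultimately have "(\<lambda>k. measure M (A k)) \<longlonglongrightarrow> D b" by (simp add: D_def)
    then have "\<forall>\<^sub>F k in sequentially. D c - \<tau> < measure M (A k)" using l2(2) by (rule order_tendstoD)
    then obtain k where k: "D c - \<tau> < measure M (A k)" unfolding eventually_sequentially by blast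
    define B where "B = (\<lambda>n \<rho>. {s \<in> A k. \<rho> < \<bar>F n s - f s\<bar>})"
    have Bm: "B n \<rho> \<in> fmeasurable M" for n \<rho>
    proof (rule fmeasurableI2[OF A[of k]])
      show "B n \<rho> \<subseteq> A k" by (auto simp: B_def)
      show "B n \<rho> \<in> sets M"
        unfolding B_def by (rule deviation_sets[OF RE_measurable[OF F] RE_measurable[OF f] fmeasurableD[OF A]])
    qed
    have B0: "\<forall>\<^sub>F n in sequentially. measure M (B n \<rho>) < \<tau>" if \<rho>: "0 < \<rho>" for \<rho>
    proof -
      have "(\<lambda>n. emeasure M (B n \<rho>)) \<longlonglongrightarrow> 0"
        using loc \<rho> fmeasurableD[OF A[of k]] fmeasurableD2[OF A[of k]]
        unfolding loc_meas_def B_def by (auto simp: less_top)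
      then have "\<forall>\<^sub>F n in sequentially. emeasure M (B n \<rho>) < ennreal \<tau>"
        using \<tau> by (intro order_tendstoD) auto
      then show ?thesis
        by eventually_elim (simp add: emeasure_eq_measure2[OF Bm] ennreal_less_iff)
    qed
    \<comment> \<open>Choose t slightly above \<open>D a\<close> such that \<open>rl (F n) t\<close>
      tends to \<open>rl f t\<close>, which is at most a. Then \<open>rl (F n) t\<close> is
      eventually below c, so the level set of \<open>F n\<close> at c has measure at most t.\<close>
    have up: "\<forall>\<^sub>F n in sequentially. measure M (lev (F n) c) \<le> D a + \<tau>"
    proof -
      obtain C where C: "countable C"
        "\<And>s. s \<in> I \<Longrightarrow> 0 < s \<Longrightarrow> s \<notin> C \<Longrightarrow> (\<lambda>n. rl (F n) s) \<longlonglongrightarrow> rl f s"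
        using dec_elem_tendsto[OF dec_elem_rl[OF F] dec_elem_rl[OF f] lim] by blast
      have "uncountable {D a<..<D a + \<tau>}" using \<tau> by (simp add: uncountable_open_interval)
      then have "\<not> {D a<..<D a + \<tau>} \<subseteq> C" using C(1) countable_subset by metis
      then obtain t where "t \<in> {D a<..<D a + \<tau>}" "t \<notin> C" by blast
      then have t: "D a < t" "t < D a + \<tau>" "t \<notin> C" by auto
      have t0: "0 < t" by (rule le_less_trans[OF measure_nonneg t(1)[unfolded D_def]])
      have fR: "(\<lambda>s. ereal (f s)) \<in> E" "\<And>n. (\<lambda>s. ereal (F n s)) \<in> E" using f F by (auto simp: RE_def)
      have "\<forall>\<^sub>F n in sequentially. rl (F n) t < c"
      proof (cases "t \<in> I")
        case True
        have "dst f a \<le> ennreal t"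
          using dst_lev[OF f l1(1)] t(1) by (simp add: D_def ennreal_leI)
        then have "\<not> a < rl f t"
          using less_rr_iff[OF fR(1) t0, of a] l1(1) by (simp add: dst_eq not_less)
        then have "rl f t < c" using l1(2) by simp
        then show ?thesis using order_tendstoD(2)[OF C(2)[OF True t0 t(3)]] by blast
      next
        case False
        then show ?thesis using rr_eq_0_outside[OF fR(2) t0] c(1) by simp
      qed
      then show ?thesis
      proof eventually_elim
        case (elim n)
        then have "dst (F n) c \<le> ennreal t"
          using less_rr_iff[OF fR(2) t0, of c n] c(1) by (simp add: dst_eq not_less[symmetric])
        then have "measure M (lev (F n) c) \<le> t"
          using dst_lev[OF F c(1)] t0 by (simp add: ennreal_le_iff)
        then show ?case using t by simp
      qed
    qed
    have "0 < b - c" using l2(1) by simp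
    from up B0[OF this] B0[OF \<epsilon>]
    have "\<forall>\<^sub>F n in sequentially. measure M (lev (\<lambda>s. F n s - f s) \<epsilon>) < e"
    proof eventually_elim
      case (elim n)
      have sub: "lev (\<lambda>s. F n s - f s) \<epsilon> \<subseteq> B n \<epsilon> \<union> ((lev (F n) c - A k) \<union> (lev f c - A k))"
        using c(2) by (auto simp: lev_def B_def)
      note lF = lev[OF F c(1), of n] and lf = lev[OF f c(1)]
      have fm: "lev (F n) c - A k \<in> fmeasurable M" "lev f c - A k \<in> fmeasurable M"
        using lF lf A[of k] by (auto intro: fmeasurable_Diff fmeasurableD)
      have "measure M (lev (\<lambda>s. F n s - f s) \<epsilon>) \<le> measure M (B n \<epsilon> \<union> ((lev (F n) c - A k) \<union> (lev f c - A k)))"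
        using fm Bm lev[OF RE_diff[OF F f] \<epsilon>] by (intro measure_mono_fmeasurable[OF sub]) (auto dest: fmeasurableD)
      also have "\<dots> \<le> measure M (B n \<epsilon>) + (measure M (lev (F n) c - A k) + measure M (lev f c - A k))"
        using measure_Un_le[of "B n \<epsilon>" M "(lev (F n) c - A k) \<union> (lev f c - A k)"]
          measure_Un_le[of "lev (F n) c - A k" M "lev f c - A k"] fm Bm[of n \<epsilon>] by (auto dest!: fmeasurableD)
      finally have total: "measure M (lev (\<lambda>s. F n s - f s) \<epsilon>) \<le>
        measure M (B n \<epsilon>) + (measure M (lev (F n) c - A k) + measure M (lev f c - A k))" .
      have split: "measure M S = measure M (S \<inter> A k) + measure M (S - A k)" if "S \<in> fmeasurable M" for S
        using measurable_measure_Diff[OF that, of "S \<inter> A k"] that A[of k]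
        by (simp add: Diff_Int fmeasurableD)
      have "A k \<subseteq> lev f c" using l2(1) by (auto simp: A_def lev_def)
      then have "lev f c \<inter> A k = A k" by auto
      then have 1: "measure M (lev f c - A k) < \<tau>" using split[OF lf] k by (simp add: D_def)
      have "A k \<subseteq> (lev (F n) c \<inter> A k) \<union> B n (b - c)"
        by (auto simp: A_def lev_def B_def)
      then have "measure M (A k) \<le> measure M ((lev (F n) c \<inter> A k) \<union> B n (b - c))"
        using lF A[of k] Bm by (intro measure_mono_fmeasurable) (auto dest: fmeasurableD)
      also have "\<dots> \<le> measure M (lev (F n) c \<inter> A k) + measure M (B n (b - c))"
        using lF A[of k] Bm[of n "b - c"] by (intro measure_Un_le) (auto dest: fmeasurableD)
      \<comment> \<open>On \<open>A k\<close> the function \<bar>f\<bar> exceeds b, so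
        \<bar>\<open>F n\<close>\<bar> exceeds c except on a small set. As the whole level set of
        \<open>F n\<close> has measure below D c + 2 \<tau>, less than 4 \<tau> remains outside
        \<open>A k\<close>.\<close>
      finally have "D c - 2 * \<tau> < measure M (lev (F n) c \<inter> A k)" using k elim(2) l2 by simp
      then have 2: "measure M (lev (F n) c - A k) < 4 * \<tau>" using split[OF lF] elim(1) l1 by simp
      have "e = 8 * \<tau>" by (simp add: \<tau>_def)
      then show ?case using total 1 2 elim(3) \<tau> by linarith
    qed
    then show "\<exists>no. \<forall>n\<ge>no. norm (measure M (lev (\<lambda>s. F n s - f s) \<epsilon>) - 0) < e"
      by (simp add: eventually_sequentially)
  qed
  then have "(\<lambda>n. ennreal (measure M (lev (\<lambda>s. F n s - f s) \<epsilon>))) \<longlonglongrightarrow> ennreal 0"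
    by (rule tendsto_ennrealI)
  then show "(\<lambda>n. emeasure M {s \<in> I. \<epsilon> < \<bar>F n s - f s\<bar>}) \<longlonglongrightarrow> 0"
    unfolding dev by (simp add: emeasure_eq_measure2[OF lev[OF RE_diff[OF F f] \<epsilon>]])
qed

section \<open>Convergence of maximal functions\<close>

lemma maximal_fun_deviation:
  assumes x: "x \<in> E" and y: "y \<in> E" and s: "0 < s"
  shows "\<bar>maximal_fun I y s - maximal_fun I x s\<bar> > ereal \<epsilon> \<longleftrightarrow> \<epsilon> < \<bar>cumul (rr y) s / s - cumul (rr x) s / s\<bar>"
  by (simp add: maximal_fun_eq[OF x decr_rr_E[OF x] s] maximal_fun_eq[OF y decr_rr_E[OF y] s])

lemma measurable_average:
  assumes "x \<in> E"
  shows "(\<lambda>s. if 0 < s then cumul (rr x) s / s else 0) \<in> borel_measurable M"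
proof -
  have "(\<lambda>s. if 0 < s then cumul (rr x) s / s else 0) \<in> borel_measurable borel"
    by (rule borel_measurable_antimono_pos) (rule cumul_average_antimono[OF decr_rr_E[OF assms]])
  then have "(\<lambda>s. if 0 < s then cumul (rr x) s / s else 0) \<in> borel_measurable lborel" by simp
  then show ?thesis by (intro measurable_restrict_space1 measurable_completion)
qed

lemma maximal_fun_deviation_sets:
  assumes x: "x \<in> E" and y: "y \<in> E"
  shows "{s \<in> I. \<bar>maximal_fun I y s - maximal_fun I x s\<bar> > ereal \<epsilon>} \<in> sets M" (is "?S \<in> _")
proof -
  let ?T = "{s \<in> I. 0 < s \<and> \<epsilon> < \<bar>(if 0 < s then cumul (rr y) s / s else 0) - (if 0 < s then cumul (rr x) s / s else 0)\<bar>}"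
  have "I \<inter> {0<..} \<in> sets M" by (intro sets_M sets.Int) auto
  from deviation_sets[OF measurable_average[OF y] measurable_average[OF x] this, of \<epsilon>]
  have T: "?T \<in> sets M" by (simp add: conj_assoc)
  have "?S - {0} = ?T"
    using maximal_fun_deviation[OF x y] I_nonneg by (auto simp: less_le)
  \<comment> \<open>The comparison with primitives holds for s > 0 only; membership of 0 is left
    open.\<close>
  then have or: "?S = ?T \<or> ?S = insert 0 ?T" by blast
  have ins: "insert 0 ?T \<in> sets M"
  proof (rule sets.insert_in_sets[OF _ T])
    show "{0} \<in> sets M" using interval by (intro sets_M) auto
  qed
  from or show ?thesis
  proof
    assume "?S = ?T" then show ?thesis using T by (rule ssubst)
  next
    assume "?S = insert 0 ?T" then show ?thesis using ins by (rule ssubst)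
  qed
qed

text \<open>Averages of decreasing functions decrease. On the half-line pick T where that of x is
  below \<epsilon>: eventually the averages of \<open>X n\<close> are below \<epsilon> at T as well,
  so beyond T no deviation exceeds \<epsilon>. What remains has finite measure, and there pointwise
  convergence suffices.\<close>

lemma maximal_fun_converges:
  assumes x: "x \<in> E" and X: "\<And>n. X n \<in> E"
    and lim: "\<And>t. t \<in> I \<Longrightarrow> 0 < t \<Longrightarrow> (\<lambda>n. cumul (rr (X n)) t) \<longlonglongrightarrow> cumul (rr x) t"
  shows "converges_globally_in_measure I (\<lambda>n. maximal_fun I (X n)) (maximal_fun I x)"
  unfolding converges_globally_in_measure_def
proof (intro allI impI)
  fix \<epsilon> :: real assume \<epsilon>: "0 < \<epsilon>"
  define u where "u = (\<lambda>y s. if 0 < s then cumul (rr y) s / s else 0)"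
  have um: "u y \<in> borel_measurable M" if "y \<in> E" for y unfolding u_def by (rule measurable_average[OF that])
  have unn: "0 \<le> u y s" if "y \<in> E" for y s
    using cumul_nonneg[OF decr_rr_E[OF that], of s] by (auto simp: u_def)
  have ulim: "(\<lambda>n. u (X n) s) \<longlonglongrightarrow> u x s" if "s \<in> I" "0 < s" for s
    using that by (simp add: u_def tendsto_divide lim)
  obtain W where W: "W \<in> sets M" "emeasure M W < \<infinity>"
    "\<forall>\<^sub>F n in sequentially. \<forall>s\<in>I. s \<notin> W \<longrightarrow> \<bar>u (X n) s - u x s\<bar> \<le> \<epsilon>"
  proof (cases rule: I_cases)
    case 1
    then show ?thesis by (intro that[of I]) auto
  next
    case 2
    have "\<forall>\<^sub>F t in at_top. cumul (rr x) t / t < \<epsilon> \<and> 0 < t"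
      using order_tendstoD(2)[OF cumul_average_tendsto_0[OF decr_rr_E[OF x] rr_tendsto_0[OF x]] \<epsilon>]
      by (intro eventually_conj eventually_gt_at_top)
    then obtain T where T: "cumul (rr x) T / T < \<epsilon>" "0 < T" unfolding eventually_at_top_linorder by blast
    then have TI: "T \<in> I" "u x T < \<epsilon>" using 2 by (auto simp: u_def)
    have umono: "u y s \<le> u y T" if "y \<in> E" "T \<le> s" for y s
      using cumul_average_antimono[OF decr_rr_E[OF that(1)] T(2) that(2)] T that by (simp add: u_def)
    show ?thesis
    proof (rule that[OF M_initial(2)[OF TI(1)]])
      show "emeasure M {0..<T} < \<infinity>" by (simp add: M_initial(1)[OF TI(1)])
      have "\<forall>\<^sub>F n in sequentially. u (X n) T < \<epsilon>"
        by (rule order_tendstoD(2)[OF ulim[OF TI(1) T(2)] TI(2)])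
      then show "\<forall>\<^sub>F n in sequentially. \<forall>s\<in>I. s \<notin> {0..<T} \<longrightarrow> \<bar>u (X n) s - u x s\<bar> \<le> \<epsilon>"
      proof eventually_elim
        case (elim n)
        show ?case
        proof (intro ballI impI)
          fix s assume "s \<in> I" "s \<notin> {0..<T}"
          then have "T \<le> s" using I_nonneg by auto
          then show "\<bar>u (X n) s - u x s\<bar> \<le> \<epsilon>"
            using umono[OF X, of s n] umono[OF x, of s] unn[OF X, of n s] unn[OF x, of s] elim TI(2) by linarith
        qed
      qed
    qed
  qed
  have lim0: "(\<lambda>n. emeasure M {s \<in> W. \<epsilon> < \<bar>u (X n) s - u x s\<bar>}) \<longlonglongrightarrow> 0"
  proof (rule AE_tendsto_imp_in_measure[OF W(1,2) um[OF X] um[OF x] _ \<epsilon>])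
    show "AE s in M. s \<in> W \<longrightarrow> (\<lambda>n. u (X n) s) \<longlonglongrightarrow> u x s"
      using AE_M_pos by eventually_elim (simp add: ulim)
  qed
  have le: "\<forall>\<^sub>F n in sequentially. emeasure M {s \<in> I. \<bar>maximal_fun I (X n) s - maximal_fun I x s\<bar> > ereal \<epsilon>}
    \<le> emeasure M {s \<in> W. \<epsilon> < \<bar>u (X n) s - u x s\<bar>}"
    using W(3)
  proof eventually_elim
    case (elim n)
    show ?case
    proof (rule emeasure_mono_AE)
      show "AE s in M. s \<in> {s \<in> I. \<bar>maximal_fun I (X n) s - maximal_fun I x s\<bar> > ereal \<epsilon>} \<longrightarrow>
        s \<in> {s \<in> W. \<epsilon> < \<bar>u (X n) s - u x s\<bar>}"
        using AE_M_pos
      proof eventually_elim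
        case (elim s)
        then show ?case
          using \<open>\<forall>s\<in>I. s \<notin> W \<longrightarrow> \<bar>u (X n) s - u x s\<bar> \<le> \<epsilon>\<close> maximal_fun_deviation[OF x X, of s \<epsilon> n]
          by (force simp: u_def)
      qed
      show "{s \<in> W. \<epsilon> < \<bar>u (X n) s - u x s\<bar>} \<in> sets M"
        by (rule deviation_sets[OF um[OF X] um[OF x] W(1)])
    qed
  qed
  show "(\<lambda>n. emeasure M {s \<in> I. \<bar>maximal_fun I (X n) s - maximal_fun I x s\<bar> > ereal \<epsilon>}) \<longlonglongrightarrow> 0"
    by (rule tendsto_sandwich[OF always_eventually le tendsto_const lim0]) simp
qed

text \<open>Maximal functions decrease and that of x is continuous. A deviation of e at t thus
  persists, up to e/2, on an interval next to t: on the left if \<open>X n\<close> is too large, on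
  the right if it is too small. The length of this interval does not depend on n.\<close>

lemma maximal_fun_converges_pointwise:
  assumes x: "x \<in> E" and X: "\<And>n. X n \<in> E"
    and conv: "converges_globally_in_measure I (\<lambda>n. maximal_fun I (X n)) (maximal_fun I x)"
    and t: "t \<in> I" "0 < t"
  shows "(\<lambda>n. cumul (rr (X n)) t) \<longlonglongrightarrow> cumul (rr x) t"
proof -
  define u where "u = (\<lambda>y s. cumul (rr y) s / s)"
  have anti: "u y b \<le> u y a" if "y \<in> E" "0 < a" "a \<le> b" for y a b
    unfolding u_def using cumul_average_antimono[OF decr_rr_E[OF that(1)] that(2,3)] .
  have "(\<lambda>n. u (X n) t) \<longlonglongrightarrow> u x t"
  proof (rule LIMSEQ_I)
    fix e :: real assume e: "0 < e"
    obtain b0 where b0: "b0 \<in> I" "t < b0" using I_right_open[OF t(1)] by auto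
    have "continuous_on {t / 2..b0} (cumul (rr x))"
      by (rule continuous_on_subset[OF continuous_on_cumul[OF decr_rr_E[OF x]]]) (use t in auto)
    then have "continuous_on {t / 2..b0} (u x)"
      unfolding u_def using t by (intro continuous_intros) auto
    moreover have "t \<in> {t / 2..b0}" using t b0 by auto
    ultimately obtain d where d: "0 < d" "\<And>s. s \<in> {t / 2..b0} \<Longrightarrow> dist s t < d \<Longrightarrow> dist (u x s) (u x t) < e / 2"
      using e unfolding continuous_on_iff by (metis half_gt_zero)
    define a where "a = max (t / 2) (t - d / 2)"
    define b where "b = min b0 (t + d / 2)"
    have ab: "0 < a" "a < t" "t < b" "b \<in> I"
      using t d b0 I_downward[OF b0(1)] by (auto simp: a_def b_def)
    have "a \<in> {t / 2..b0}" "dist a t < d" "b \<in> {t / 2..b0}" "dist b t < d"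
      using t b0 d(1) by (auto simp: a_def b_def dist_real_def max_def min_def)
    then have ua: "u x a < u x t + e / 2" and ub: "u x t - e / 2 < u x b"
      using d(2)[of a] d(2)[of b] unfolding dist_real_def by linarith+
    have sub: "{a<..<t} \<subseteq> I" "{t<..<b} \<subseteq> I" using ab t I_downward by (auto intro: I_downward[OF ab(4)] I_downward[OF t(1)])
    define m where "m = min (t - a) (b - t)"
    have "\<forall>\<^sub>F n in sequentially. emeasure M {s \<in> I. \<bar>maximal_fun I (X n) s - maximal_fun I x s\<bar> > ereal (e / 2)} < ennreal m"
      using conv e ab unfolding converges_globally_in_measure_def
      by (intro order_tendstoD(2)[where y = 0]) (auto simp: m_def)
    then have "\<forall>\<^sub>F n in sequentially. \<bar>u (X n) t - u x t\<bar> < e"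
    proof eventually_elim
      case (elim n)
      let ?S = "{s \<in> I. \<bar>maximal_fun I (X n) s - maximal_fun I x s\<bar> > ereal (e / 2)}"
      have big: "u (X n) t < u x t + e"
      proof (rule ccontr)
        assume c: "\<not> u (X n) t < u x t + e"
        have "{a<..<t} \<subseteq> ?S"
        proof
          fix s assume s: "s \<in> {a<..<t}"
          then have "u (X n) t \<le> u (X n) s" "u x s \<le> u x a" using ab by (auto intro: anti X x)
          then have "e / 2 < \<bar>u (X n) s - u x s\<bar>" using c ua by linarith
          then show "s \<in> ?S" using maximal_fun_deviation[OF x X, of s "e / 2" n] s sub ab by (auto simp: u_def)
        qed
        then have "emeasure M {a<..<t} \<le> emeasure M ?S"
          by (rule emeasure_mono) (rule maximal_fun_deviation_sets[OF x X])
        then have "ennreal (t - a) < ennreal m" using elim ab by (simp add: emeasure_M[OF sub(1)])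
        then show False using ab by (simp add: m_def ennreal_less_iff)
      qed
      have small: "u x t - e < u (X n) t"
      proof (rule ccontr)
        assume c: "\<not> u x t - e < u (X n) t"
        have "{t<..<b} \<subseteq> ?S"
        proof
          fix s assume s: "s \<in> {t<..<b}"
          then have "u (X n) s \<le> u (X n) t" "u x b \<le> u x s" using ab t by (auto intro: anti X x)
          then have "e / 2 < \<bar>u (X n) s - u x s\<bar>" using c ub by linarith
          then show "s \<in> ?S" using maximal_fun_deviation[OF x X, of s "e / 2" n] s sub t by (auto simp: u_def)
        qed
        then have "emeasure M {t<..<b} \<le> emeasure M ?S"
          by (rule emeasure_mono) (rule maximal_fun_deviation_sets[OF x X])
        then have "ennreal (b - t) < ennreal m" using elim ab by (simp add: emeasure_M[OF sub(2)])
        then show False using ab by (simp add: m_def ennreal_less_iff)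
      qed
      from big small show ?case by linarith
    qed
    then show "\<exists>no. \<forall>n\<ge>no. norm (u (X n) t - u x t) < e" by (simp add: eventually_sequentially)
  qed
  then have "(\<lambda>n. u (X n) t * t) \<longlonglongrightarrow> u x t * t" by (intro tendsto_intros)
  then show ?thesis using t by (simp add: u_def)
qed

end

section \<open>Kadec-Klee properties under strict K-monotonicity\<close>

context strictly_K_monotone_space
begin

text \<open>\<open>cumul_tendsto_of_majorizing\<close> applies to the maxima, and their primitives
  differ from those of \<open>rl (F n)\<close> by a null sequence.\<close>

lemma cumul_rl_tendsto:
  assumes F: "\<And>n. F n \<in> RE" and f: "f \<in> RE" and loc: "loc_meas F f"
    and lim: "(\<lambda>n. nrm (F n)) \<longlonglongrightarrow> nrm f" and t: "t \<in> I" "0 < t"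
  shows "(\<lambda>n. cumul (rl (F n)) t) \<longlonglongrightarrow> cumul (rl f) t"
proof -
  let ?y = "\<lambda>n s. max (rl (F n) s) (rl f s)"
  note g = dec_elem_rl[OF f] and G = dec_elem_rl[OF F]
  have y: "dec_elem (?y n)" for n by (rule dec_elem_max[OF G g])
  have "(\<lambda>n. cumul (?y n) t) \<longlonglongrightarrow> cumul (rl f) t"
  proof (rule cumul_tendsto_of_majorizing[OF g y _ _ t])
    show "cumul (rl f) s \<le> cumul (?y n) s" for n s
      by (rule cumul_mono_fun[OF dec_elem_decr[OF g] dec_elem_decr[OF y]]) simp
    show "(\<lambda>n. nrm (?y n)) \<longlonglongrightarrow> nrm (rl f)"
      using max_rearr_nrm[OF F f loc lim] by (simp add: nrm_rl[OF f])
  qed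
  from tendsto_diff[OF this max_rearr_cumul[OF F f loc lim, of t]] show ?thesis by simp
qed

lemma glob_meas_of_loc_meas:
  assumes "\<And>n. F n \<in> RE" "f \<in> RE" "loc_meas F f" "(\<lambda>n. nrm (F n)) \<longlonglongrightarrow> nrm f"
  shows "glob_meas F f"
  by (rule loc_meas_imp_glob_meas[OF assms(1-3)]) (rule cumul_rl_tendsto[OF assms])

lemma kadec_klee_global_imp_local:
  assumes "kadec_klee_global I E N" shows "kadec_klee_local I E N"
  using assms glob_meas_of_loc_meas unfolding kadec_klee_global_iff kadec_klee_local_iff by blast

text \<open>The Kadec-Klee property is applied to the rearrangements, for which convergence of
  primitives yields convergence a.e.\<close>

lemma nrm_tendsto_of_cumul:
  assumes kk: "kadec_klee_local I E N" and x: "x \<in> E" and X: "\<And>n. X n \<in> E"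
    and lim: "\<And>t. t \<in> I \<Longrightarrow> 0 < t \<Longrightarrow> (\<lambda>n. cumul (rr (X n)) t) \<longlonglongrightarrow> cumul (rr x) t"
    and nlim: "(\<lambda>n. N (X n)) \<longlonglongrightarrow> N x"
  shows "(\<lambda>n. N (\<lambda>s. rearr I (X n) s - rearr I x s)) \<longlonglongrightarrow> 0"
    and "(\<lambda>n. N (\<lambda>s. rearr I x s - rearr I (X n) s)) \<longlonglongrightarrow> 0"
proof -
  note g = dec_elem_rr_E[OF x] and G = dec_elem_rr_E[OF X]
  have ae: "AE s in M. (\<lambda>n. rr (X n) s) \<longlonglongrightarrow> rr x s"
    by (rule dec_elem_tendsto_AE[OF G g]) (rule lim)
  have "loc_meas (\<lambda>n. rr (X n)) (rr x)"
    unfolding loc_meas_def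
  proof (intro ballI impI allI)
    fix A and \<epsilon> :: real assume "A \<in> sets M" "emeasure M A < \<infinity>" "0 < \<epsilon>"
    then show "(\<lambda>n. emeasure M {s \<in> A. \<epsilon> < \<bar>rr (X n) s - rr x s\<bar>}) \<longlonglongrightarrow> 0"
      using ae by (intro AE_tendsto_imp_in_measure RE_measurable rr_mem x X) auto
  qed
  then have lim0: "(\<lambda>n. nrm (\<lambda>s. rr (X n) s - rr x s)) \<longlonglongrightarrow> 0"
    using kk rr_mem[OF x] rr_mem[OF X] nlim nrm_rr[OF x] nrm_rr[OF X] unfolding kadec_klee_local_iff by simp
  then show "(\<lambda>n. N (\<lambda>s. rearr I (X n) s - rearr I x s)) \<longlonglongrightarrow> 0"
    by (simp add: nrm_rr_diff X x)
  show "(\<lambda>n. N (\<lambda>s. rearr I x s - rearr I (X n) s)) \<longlonglongrightarrow> 0"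
    using lim0 by (simp add: nrm_rr_diff X x nrm_diff_commute[OF rr_mem[OF x] rr_mem[OF X]])
qed

lemma kadec_klee_imp_maximal:
  assumes "kadec_klee_local I E N" "x \<in> E" "\<And>n. X n \<in> E"
    "converges_globally_in_measure I (\<lambda>n. maximal_fun I (X n)) (maximal_fun I x)" "(\<lambda>n. N (X n)) \<longlonglongrightarrow> N x"
  shows "(\<lambda>n. N (\<lambda>s. rearr I (X n) s - rearr I x s)) \<longlonglongrightarrow> 0"
  by (rule nrm_tendsto_of_cumul(1)[OF assms(1-3) _ assms(5)])
    (rule maximal_fun_converges_pointwise[OF assms(2-4)])

lemma kadec_klee_imp_lower:
  assumes kk: "kadec_klee_local I E N" shows "lower_loc_unif_K_monotone I E N"
  unfolding lower_loc_unif_K_monotone_def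
proof (intro ballI allI impI, elim conjE)
  fix x X assume x: "x \<in> E" and X: "\<forall>n. X n \<in> E" "\<forall>n. submajorized I (X n) x" and nlim: "(\<lambda>n. N (X n)) \<longlonglongrightarrow> N x"
  have XE: "X n \<in> E" for n using X by blast
  show "(\<lambda>n. N (\<lambda>s. rearr I x s - rearr I (X n) s)) \<longlonglongrightarrow> 0"
  proof (rule nrm_tendsto_of_cumul(2)[OF kk x XE _ nlim])
    fix t assume "t \<in> I" "0 < t"
    then show "(\<lambda>n. cumul (rr (X n)) t) \<longlonglongrightarrow> cumul (rr x) t"
      using X(2) submajorized_iff[OF XE x] nlim nrm_rr[OF x] nrm_rr[OF XE]
      by (intro cumul_tendsto_of_majorized[OF dec_elem_rr_E[OF x] dec_elem_rr_E[OF XE]]) auto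
  qed
qed

lemma kadec_klee_imp_upper:
  assumes kk: "kadec_klee_local I E N" shows "upper_loc_unif_K_monotone I E N"
  unfolding upper_loc_unif_K_monotone_def
proof (intro ballI allI impI, elim conjE)
  fix x X assume x: "x \<in> E" and X: "\<forall>n. X n \<in> E" "\<forall>n. submajorized I x (X n)" and nlim: "(\<lambda>n. N (X n)) \<longlonglongrightarrow> N x"
  have XE: "X n \<in> E" for n using X by blast
  show "(\<lambda>n. N (\<lambda>s. rearr I x s - rearr I (X n) s)) \<longlonglongrightarrow> 0"
  proof (rule nrm_tendsto_of_cumul(2)[OF kk x XE _ nlim])
    fix t assume "t \<in> I" "0 < t"
    then show "(\<lambda>n. cumul (rr (X n)) t) \<longlonglongrightarrow> cumul (rr x) t"
      using X(2) submajorized_iff[OF x XE] nlim nrm_rr[OF x] nrm_rr[OF XE]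
      by (intro cumul_tendsto_of_majorizing[OF dec_elem_rr_E[OF x] dec_elem_rr_E[OF XE]]) auto
  qed
qed

text \<open>Strict K-monotonicity makes the convergence in measure global, after which
  \<open>nrm_tendsto_of_rearr\<close> lifts convergence from rearrangements to functions.\<close>

lemma kadec_klee_local_of_rearr:
  assumes "\<And>F f. (\<And>n. F n \<in> RE) \<Longrightarrow> f \<in> RE \<Longrightarrow> loc_meas F f \<Longrightarrow> (\<lambda>n. nrm (F n)) \<longlonglongrightarrow> nrm f \<Longrightarrow>
    (\<lambda>n. nrm (\<lambda>s. rl (F n) s - rl f s)) \<longlonglongrightarrow> 0"
  shows "kadec_klee_local I E N"
  unfolding kadec_klee_local_iff
proof (intro ballI allI impI, elim conjE)
  fix f F assume f: "f \<in> RE" and "\<forall>n. F n \<in> RE" and loc: "loc_meas F f" and lim: "(\<lambda>n. nrm (F n)) \<longlonglongrightarrow> nrm f"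
  then have F: "F n \<in> RE" for n by blast
  show "(\<lambda>n. nrm (\<lambda>s. F n s - f s)) \<longlonglongrightarrow> 0"
    using glob_meas_of_loc_meas[OF F f loc lim] assms[OF F f loc lim]
    by (intro nrm_tendsto_of_rearr[OF F f]) (simp_all add: glob_meas_def)
qed

lemma maximal_imp_kadec_klee:
  assumes "\<And>x X. x \<in> E \<Longrightarrow> (\<And>n. X n \<in> E) \<Longrightarrow>
    converges_globally_in_measure I (\<lambda>n. maximal_fun I (X n)) (maximal_fun I x) \<Longrightarrow> (\<lambda>n. N (X n)) \<longlonglongrightarrow> N x \<Longrightarrow>
    (\<lambda>n. N (\<lambda>s. rearr I (X n) s - rearr I x s)) \<longlonglongrightarrow> 0"
  shows "kadec_klee_local I E N"
proof (rule kadec_klee_local_of_rearr)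
  fix F f assume F: "\<And>n. F n \<in> RE" and f: "f \<in> RE" and loc: "loc_meas F f" and lim: "(\<lambda>n. nrm (F n)) \<longlonglongrightarrow> nrm f"
  have fE: "(\<lambda>s. ereal (f s)) \<in> E" and FE: "\<And>n. (\<lambda>s. ereal (F n s)) \<in> E"
    using f F by (auto simp: RE_def)
  have "(\<lambda>n. N (\<lambda>s. rearr I (\<lambda>s. ereal (F n s)) s - rearr I (\<lambda>s. ereal (f s)) s)) \<longlonglongrightarrow> 0"
  proof (rule assms[OF fE FE])
    show "converges_globally_in_measure I (\<lambda>n. maximal_fun I (\<lambda>s. ereal (F n s))) (maximal_fun I (\<lambda>s. ereal (f s)))"
      by (rule maximal_fun_converges[OF fE FE]) (rule cumul_rl_tendsto[OF F f loc lim])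
    show "(\<lambda>n. N (\<lambda>s. ereal (F n s))) \<longlonglongrightarrow> N (\<lambda>s. ereal (f s))" using lim by (simp add: nrm_def)
  qed
  then show "(\<lambda>n. nrm (\<lambda>s. rl (F n) s - rl f s)) \<longlonglongrightarrow> 0" by (simp add: nrm_rr_diff FE fE)
qed

text \<open>The hypothesis applies to the maxima \<open>y n\<close>, which majorize f exactly; the
  triangle inequality through \<open>y n\<close> then returns to \<open>rl (F n)\<close>.\<close>

lemma upper_imp_kadec_klee:
  assumes upper: "upper_loc_unif_K_monotone I E N"
  shows "kadec_klee_local I E N"
proof (rule kadec_klee_local_of_rearr)
  fix F f assume F: "\<And>n. F n \<in> RE" and f: "f \<in> RE" and loc: "loc_meas F f" and lim: "(\<lambda>n. nrm (F n)) \<longlonglongrightarrow> nrm f"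
  have fE: "(\<lambda>s. ereal (f s)) \<in> E" using f by (simp add: RE_def)
  define y where "y = (\<lambda>n s. max (rl (F n) s) (rl f s))"
    note g = dec_elem_rl[OF f] and G = dec_elem_rl[OF F]
  have y: "dec_elem (y n)" for n unfolding y_def by (rule dec_elem_max[OF G g])
  have ynrm: "(\<lambda>n. nrm (y n)) \<longlonglongrightarrow> nrm f"
    unfolding y_def by (rule max_rearr_nrm[OF F f loc lim])
  have diff: "(\<lambda>n. nrm (\<lambda>s. y n s - rl (F n) s)) \<longlonglongrightarrow> 0"
    unfolding y_def by (rule max_rearr_diff[OF F f loc lim])
  have fy: "rl f s \<le> y n s" for n s by (simp add: y_def)
  have "(\<lambda>n. N (\<lambda>s. rearr I (\<lambda>s. ereal (f s)) s - rearr I (\<lambda>s. ereal (y n s)) s)) \<longlonglongrightarrow> 0"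
  proof (rule upper[unfolded upper_loc_unif_K_monotone_def, rule_format, OF fE], intro conjI allI)
    show "(\<lambda>s. ereal (y n s)) \<in> E" for n by (rule dec_elem_mem[OF y])
    show "submajorized I (\<lambda>s. ereal (f s)) (\<lambda>s. ereal (y n s))" for n
      using cumul_mono_fun[OF dec_elem_decr[OF g] dec_elem_decr[OF y[of n]] fy]
      by (simp add: submajorized_iff[OF fE dec_elem_mem[OF y]] dec_elem_cumul_rr[OF y])
    show "(\<lambda>n. N (\<lambda>s. ereal (y n s))) \<longlonglongrightarrow> N (\<lambda>s. ereal (f s))"
      using ynrm by (simp add: nrm_def)
  qed
  then have "(\<lambda>n. nrm (\<lambda>s. rl f s - rl (y n) s)) \<longlonglongrightarrow> 0"
    by (simp add: nrm_rr_diff fE dec_elem_mem[OF y])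
  moreover have "nrm (\<lambda>s. rl f s - rl (y n) s) = nrm (\<lambda>s. y n s - rl f s)" for n
  proof -
    have "nrm (\<lambda>s. rl f s - rl (y n) s) = nrm (\<lambda>s. rl f s - y n s)"
    \<comment> \<open>\<open>y n\<close> is decreasing and hence a.e. equal to its
      rearrangement.\<close>
    proof (rule nrm_cong_AE)
      show "(\<lambda>s. rl f s - rl (y n) s) \<in> borel_measurable M"
        by (intro RE_measurable RE_diff dec_elem_RE[OF g] rr_mem dec_elem_mem[OF y])
      show "(\<lambda>s. rl f s - y n s) \<in> RE" by (intro RE_diff dec_elem_RE y g)
      show "AE s in M. rl f s - rl (y n) s = rl f s - y n s"
        using dec_elem_rr_ae[OF y[of n]] by eventually_elim simp
    qed
    then show ?thesis using nrm_diff_commute[OF dec_elem_RE[OF g] dec_elem_RE[OF y]] by simp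
  qed
  ultimately have "(\<lambda>n. nrm (\<lambda>s. y n s - rl (F n) s) + nrm (\<lambda>s. y n s - rl f s)) \<longlonglongrightarrow> 0 + 0"
    by (intro tendsto_add diff) simp
  then have lim0: "(\<lambda>n. nrm (\<lambda>s. y n s - rl f s) + nrm (\<lambda>s. y n s - rl (F n) s)) \<longlonglongrightarrow> 0"
    by (simp add: add.commute)
  have le: "nrm (\<lambda>s. rl (F n) s - rl f s) \<le> nrm (\<lambda>s. y n s - rl f s) + nrm (\<lambda>s. y n s - rl (F n) s)" for n
    using nrm_diff_le[OF RE_diff[OF dec_elem_RE[OF y] dec_elem_RE[OF g]] RE_diff[OF dec_elem_RE[OF y] dec_elem_RE[OF G]], of n n n]
    by simp
  have ge: "0 \<le> nrm (\<lambda>s. rl (F n) s - rl f s)" for n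
    by (intro nrm_nonneg RE_diff dec_elem_RE g G)
  show "(\<lambda>n. nrm (\<lambda>s. rl (F n) s - rl f s)) \<longlonglongrightarrow> 0"
    by (rule tendsto_sandwich[OF always_eventually always_eventually tendsto_const lim0]) (use le ge in auto)
qed

end

section \<open>The equivalences\<close>

lemma (in order_continuous_symmetric_space) strictly_K_monotone_spaceI:
  assumes "strictly_K_monotone I E N"
  shows "strictly_K_monotone_space I E N"
  using assms strictly_K_monotone_imp_loc_integrable[OF assms]
  by unfold_locales auto

theorem theorem3p13:
  fixes I :: "real set" and E :: "(real \<Rightarrow> ereal) set" and N :: "(real \<Rightarrow> ereal) \<Rightarrow> real"
  assumes "symmetric_space I E N"
    and "fatou_property I E N"
    and "order_continuous_norm I E N"
  shows "((strictly_K_monotone I E N \<and>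
           (\<forall>x\<in>E. \<forall>X. (\<forall>n. X n \<in> E) \<and>
              converges_globally_in_measure I (\<lambda>n. maximal_fun I (X n)) (maximal_fun I x) \<and>
              (\<lambda>n. N (X n)) \<longlonglongrightarrow> N x
            \<longrightarrow> (\<lambda>n. N (\<lambda>s. rearr I (X n) s - rearr I x s)) \<longlonglongrightarrow> 0))
          \<longleftrightarrow> (lower_loc_unif_K_monotone I E N \<and> kadec_klee_global I E N))
       \<and> ((lower_loc_unif_K_monotone I E N \<and> kadec_klee_global I E N)
          \<longleftrightarrow> (strictly_K_monotone I E N \<and> kadec_klee_global I E N))
       \<and> ((strictly_K_monotone I E N \<and> kadec_klee_global I E N)
          \<longleftrightarrow> (strictly_K_monotone I E N \<and> kadec_klee_local I E N))
       \<and> ((strictly_K_monotone I E N \<and> kadec_klee_local I E N)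
          \<longleftrightarrow> upper_loc_unif_K_monotone I E N)"
proof -
  interpret symmetric_space I E N by (rule assms(1))
  interpret order_continuous_symmetric_space I E N
    by unfold_locales (rule assms(3))
  let ?S = "strictly_K_monotone I E N"
  let ?i = "\<forall>x\<in>E. \<forall>X. (\<forall>n. X n \<in> E) \<and>
    converges_globally_in_measure I (\<lambda>n. maximal_fun I (X n)) (maximal_fun I x) \<and>
    (\<lambda>n. N (X n)) \<longlonglongrightarrow> N x \<longrightarrow> (\<lambda>n. N (\<lambda>s. rearr I (X n) s - rearr I x s)) \<longlonglongrightarrow> 0"
  have strict: "?S \<Longrightarrow> strictly_K_monotone_space I E N" by (rule strictly_K_monotone_spaceI)
  have i_local: "kadec_klee_local I E N" if S: ?S and i: ?i
    by (rule strictly_K_monotone_space.maximal_imp_kadec_klee[OF strict[OF S]]) (use i in blast)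
  have local_i: ?i if S: ?S and L: "kadec_klee_local I E N"
    using strictly_K_monotone_space.kadec_klee_imp_maximal[OF strict[OF S] L] by blast
  have global_local: "kadec_klee_local I E N" if "?S" "kadec_klee_global I E N"
    using strictly_K_monotone_space.kadec_klee_global_imp_local[OF strict] that by blast
  have local_lower: "lower_loc_unif_K_monotone I E N" if "?S" "kadec_klee_local I E N"
    using strictly_K_monotone_space.kadec_klee_imp_lower[OF strict] that by blast
  have local_upper: "upper_loc_unif_K_monotone I E N" if "?S" "kadec_klee_local I E N"
    using strictly_K_monotone_space.kadec_klee_imp_upper[OF strict] that by blast
  have upper_local: "kadec_klee_local I E N" if "upper_loc_unif_K_monotone I E N"
    using strictly_K_monotone_space.upper_imp_kadec_klee[OF strict[OF upper_imp_strictly_K_monotone]] that by blast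
  \<comment> \<open>All other conditions are compared with (iv).\<close>
  let ?L = "?S \<and> kadec_klee_local I E N"
  have i: "(?S \<and> ?i) = ?L"
  proof (rule conj_cong[OF refl])
    assume S: ?S
    show "?i = kadec_klee_local I E N" by (rule iffI[OF i_local[OF S] local_i[OF S]])
  qed
  have ii: "(lower_loc_unif_K_monotone I E N \<and> kadec_klee_global I E N) = ?L"
    using lower_imp_strictly_K_monotone global_local local_lower kadec_klee_local_imp_global by blast
  have iii: "(?S \<and> kadec_klee_global I E N) = ?L"
    using global_local kadec_klee_local_imp_global by blast
  have v: "upper_loc_unif_K_monotone I E N = ?L"
    using upper_imp_strictly_K_monotone upper_local local_upper by blast
  show ?thesis unfolding i ii iii v by (intro conjI refl)
qed

end
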